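(* Let $0<q<1$. For $\nu>-1$ and $n\in\mathbb N$, consider the matrix $$M=\left(s_{j+k+1,\nu}\right)_{j,k=0}^{n}.$$ (1) Its determinant is $$\det M=\frac{2^{-n(n+1)}\,q^{n(n+1)(4n+6\nu+5)}}{(q^{\nu+1};q^2)_{n+1}\ \prod_{m=1}^{n}(q^{\nu+1};q)_{2m}}.$$ (2) Its inverse matrix $(\gamma_{j,k})_{j,k=0}^n$ has entries $$\gamma_{j,k}=(-4)^{j+k}q^{j(j-\nu)+k(k-\nu)}\sum_{\ell=\max(j,k)}^{n}\left[\begin{array}{c}\ell+j\\ \ell-j\end{array}\right]_q\left[\begin{array}{c}\ell+k\\ \ell-k\end{array}\right]_q\frac{1-q^{2\ell+\nu+1}}{q^{(2j+2k+1)\ell}}\,\frac{(q^{\nu+1};q)_{\ell+j}}{(q^{\nu+1};q)_{\ell-j}}\,\frac{(q^{\nu+1};q)_{\ell+k}}{(q^{\nu+1};q)_{\ell-k}}.$$ (3) The smallest eigenvalue $\lambda_s$ of $M$ has the lower bound $$\lambda_s\ge\left\{\sum_{\ell=0}^{n}\frac{(1-q^{2\ell+\nu+1})\,h_{2\ell,\nu+1}^2(i;q)}{q^{2\ell\nu+\ell(2n+1)}}\right\}^{-1},$$ where $i=\sqrt{-1}$ and $$h_{2n,\nu}(x;q)=q^{n(n+\nu-1)}\sum_{k=0}^{n}\frac{(q^\nu,q;q)_{n+k}\,(-4x^2)^k\,q^{k(k-2n-\nu+1)}}{(-1)^n(q^\nu,q;q)_{n-k}\,(q;q)_{2k}}.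$$
   Context: For $a\in\mathbb C$ and $q\in(0,1)$: $(a;q)_\infty=\prod_{m=0}^\infty(1-aq^m)$, $(a;q)_m=(a;q)_\infty/(aq^m;q)_\infty$ for $m\in\mathbb Z$, $(a_1,\dots,a_r;q)_m=\prod_{k=1}^r(a_k;q)_m$, and $\left[\begin{array}{c}m\\ j\end{array}\right]_q=\frac{(q;q)_m}{(q;q)_j(q;q)_{m-j}}$ for $0\le j\le m$. Jackson's $q$-Bessel function is $$J_\nu^{(2)}(z;q)=\frac{(q^{\nu+1};q)_\infty}{(q;q)_\infty}\sum_{n=0}^\infty\frac{(-1)^nq^{n(\nu+n)}}{(q,q^{\nu+1};q)_n}\left(\frac z2\right)^{\nu+2n}.$$ For $\nu>-1$, let $0<j_{\nu,1}(q)<j_{\nu,2}(q)<\cdots$ be the positive zeros of $z^{-\nu}J_\nu^{(2)}(z;q)$. Define $$w_\ell=\frac{-4J_{\nu+1}^{(2)}(j_{\nu,\ell}(q);q)}{\partial_zJ_\nu^{(2)}(z;q)\big|_{z=j_{\nu,\ell}(q)}},\qquad s_{n,\nu}=\sum_{\ell=1}^\infty\frac{w_\ell}{j_{\nu,\ell}(q)^{2n}}.$$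
   Formalization: In (1) the printed determinant is false (q=1/2, ν=0, n=1 gives det M = 8/63); the formal statement has 2^{-2n(n+1)} for 2^{-n(n+1)}, q^{n(n+1)(4n+6ν+5)/6} for q^{n(n+1)(4n+6ν+5)}, and (q^{ν+1};q)_{2m} squared in the product. *)

theory Defs
  imports "HOL-Analysis.Analysis" "Jordan_Normal_Form.Spectral_Radius"
begin

definition qpoch_inf :: "'a::real_normed_field \<Rightarrow> 'a \<Rightarrow> 'a" where
  "qpoch_inf a q = (\<Prod>m. 1 - a * q ^ m)"

definition qpoch :: "'a::real_normed_field \<Rightarrow> 'a \<Rightarrow> int \<Rightarrow> 'a" where
  "qpoch a q m = qpoch_inf a q / qpoch_inf (a * q powi m) q"

definition qbinom :: "nat \<Rightarrow> nat \<Rightarrow> real \<Rightarrow> real" where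
  "qbinom m j q = qpoch q q (int m) / (qpoch q q (int j) * qpoch q q (int (m - j)))"

(* Meant for z > 0, where the real power agrees with the principal branch of the complex one. *)
definition jackson_J2 :: "real \<Rightarrow> real \<Rightarrow> real \<Rightarrow> real" where
  "jackson_J2 \<nu> q z =
     qpoch_inf (q powr (\<nu> + 1)) q / qpoch_inf q q *
     (\<Sum>n. (- 1) ^ n * q powr (real n * (\<nu> + real n)) /
            (qpoch q q (int n) * qpoch (q powr (\<nu> + 1)) q (int n)) *
            (z / 2) powr (\<nu> + 2 * real n))"

(* Indexed from 0: jackson_zero \<nu> q l is the (l+1)-st positive zero. *)
definition jackson_zero :: "real \<Rightarrow> real \<Rightarrow> nat \<Rightarrow> real" where
  "jackson_zero \<nu> q =
     (THE j. strict_mono j \<and> range j = {z. 0 < z \<and> z powr (- \<nu>) * jackson_J2 \<nu> q z = 0})"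

definition jackson_weight :: "real \<Rightarrow> real \<Rightarrow> nat \<Rightarrow> real" where
  "jackson_weight \<nu> q l =
     - 4 * jackson_J2 (\<nu> + 1) q (jackson_zero \<nu> q l) /
     deriv (jackson_J2 \<nu> q) (jackson_zero \<nu> q l)"

definition rayleigh_sum :: "real \<Rightarrow> real \<Rightarrow> nat \<Rightarrow> real" where
  "rayleigh_sum \<nu> q n = (\<Sum>l. jackson_weight \<nu> q l / jackson_zero \<nu> q l ^ (2 * n))"

definition rayleigh_hankel :: "real \<Rightarrow> real \<Rightarrow> nat \<Rightarrow> real mat" where
  "rayleigh_hankel \<nu> q n =
     Matrix.mat (n + 1) (n + 1) (\<lambda>(j, k). rayleigh_sum \<nu> q (j + k + 1))"

(* Only even degrees are defined: q_lommel_even n \<nu> q x is h_{2n,\<nu>}(x;q). *)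
definition q_lommel_even :: "nat \<Rightarrow> real \<Rightarrow> real \<Rightarrow> complex \<Rightarrow> complex" where
  "q_lommel_even n \<nu> q x =
     of_real (q powr (real n * (real n + \<nu> - 1))) *
     (\<Sum>k\<le>n. of_real (qpoch (q powr \<nu>) q (int (n + k)) * qpoch q q (int (n + k))) *
             (- 4 * x ^ 2) ^ k *
             of_real (q powr (real k * (real k - 2 * real n - \<nu> + 1))) /
             of_real ((- 1) ^ n * (qpoch (q powr \<nu>) q (int (n - k)) * qpoch q q (int (n - k))) *
                      qpoch q q (int (2 * k))))"

lemma q_lommel_even_imaginary_unit_real: "q_lommel_even n \<nu> q \<i> \<in> \<real>"
proof -
  have "- 4 * \<i> ^ 2 = complex_of_real 4" by simp
  then show ?thesis
    unfolding q_lommel_even_def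
    by (simp only:) (intro Reals_mult Reals_divide sum_in_Reals Reals_power Reals_of_real)
qed

end

theory Submission
  imports Defs "HOL-Computational_Algebra.Formal_Power_Series" "HOL-Complex_Analysis.Complex_Analysis" "HOL-Real_Asymp.Real_Asymp"
begin

text \<open>Put \<open>b = q\<^sup>\<nu>\<close> and \<open>t = z\<^sup>2 / 4\<close>. Up to an elementary factor \<open>J\<^bsub>\<nu>+k\<^esub>(z)\<close> is an entire function \<open>F\<^sub>k(t)\<close>, and
  \<open>F\<^sub>k = F\<^bsub>k+1\<^esub> - \<beta>\<^sub>k t F\<^bsub>k+2\<^esub>\<close> with \<open>\<beta>\<^sub>k > 0\<close>.

  Iterating this recurrence on power series gives \<open>R\<^sub>k G - S\<^sub>k = O(t\<^sup>k)\<close> for the quotient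
  \<open>G = F\<^sub>1 / ((1 - b q) F\<^sub>0) = \<Sum> g\<^sub>m t\<^sup>m\<close>, where the \<open>R\<^sub>k\<close> are q-Lommel polynomials with explicit coefficients.
  Comparing coefficients, the reversed \<open>R\<^bsub>2l\<^esub>\<close> are orthogonal with respect to the moments \<open>g\<^sub>m\<close>: a lower
  triangular \<open>C\<close> makes \<open>C M C\<^sup>T\<close> diagonal. The determinant, the inverse \<open>C\<^sup>T D C\<close> and the eigenvalue bound
  all follow from this.

  That \<open>s\<^bsub>m+1\<^esub> = g\<^sub>m / 4\<^sup>m\<close> is a partial fraction expansion of \<open>G\<close>. The recurrence also controls
  \<open>Im (t F\<^bsub>k+1\<^esub> cnj F\<^sub>k)\<close>, which yields \<open>\<bar>Im t\<bar> \<bar>F\<^sub>1\<bar> \<le> \<bar>t\<bar> \<bar>F\<^sub>0\<bar>\<close>; so the zeros of \<open>F\<^sub>0\<close> are positive and simple, the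
  residues of \<open>G\<close> there are negative, and \<open>(1 - t\<^sup>2 / R\<^sup>2) G\<close> is bounded by a constant on every circle \<open>\<bar>t\<bar> = R\<close>.
  The residue theorem then expresses \<open>g\<^sub>m\<close> as a sum over the zeros for \<open>m \<ge> 1\<close>. For \<open>m = 0\<close> the circle
  integral need not tend to 0; instead the expansion of \<open>(G(0) - G(-T)) / T\<close> is used together with
  \<open>G(-T) \<rightarrow> 0\<close> as \<open>T \<rightarrow> \<infinity>\<close>.\<close>

section \<open>Orthogonality of the q-Lommel polynomials\<close>

text \<open>The q-shifted factorial \<open>(a;q)_n\<close> as a finite product. For
  \<open>0 \<le> q < 1\<close> and \<open>a < 1\<close>, \<open>qpoch_eq_qfact\<close> identifies it
  with the quotient of infinite products.\<close>

definition qfact :: "real \<Rightarrow> real \<Rightarrow> nat \<Rightarrow> real" where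
  "qfact a q n = (\<Prod>k<n. 1 - a * q ^ k)"

lemma qfact_0 [simp]: "qfact a q 0 = 1"
  by (simp add: qfact_def)

lemma qfact_Suc: "qfact a q (Suc n) = qfact a q n * (1 - a * q ^ n)"
  by (simp add: qfact_def)

lemma qfact_Suc_shift: "qfact a q (Suc n) = (1 - a) * qfact (a * q) q n"
  unfolding qfact_def prod.lessThan_Suc_shift by (simp add: mult.assoc)

lemma one_minus_mult_power_pos:
  fixes a q :: real
  assumes "0 \<le> q" "q < 1" "a < 1"
  shows "0 < 1 - a * q ^ m"
proof (cases "a \<le> 0")
  case True
  then have "a * q ^ m \<le> 0" using assms by (simp add: mult_nonpos_nonneg)
  then show ?thesis by linarith
next
  case False
  have "a * q ^ m \<le> a * 1" using False assms by (intro mult_left_mono power_le_one) auto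
  then show ?thesis using assms by linarith
qed

lemma qfact_pos: "0 < qfact a q n" if "0 < q" "q < 1" "a < 1"
  using one_minus_mult_power_pos[of q a] that by (auto simp: qfact_def intro!: prod_pos)

text \<open>The parameter \<open>b\<close> stands for \<open>q^\<nu>\<close>, which keeps real
  powers out of the algebra. The condition \<open>b * q < 1\<close> encodes
  \<open>\<nu> > -1\<close>, so \<open>b\<close> itself may be 1 or larger.\<close>

locale q_bessel =
  fixes q b :: real
  assumes q_pos: "0 < q" and q_less_1: "q < 1" and b_pos: "0 < b" and bq_less_1: "b * q < 1"
begin

lemma qpow_less_1: "q ^ Suc k < 1"
  using q_pos q_less_1 by (intro power_Suc_less_one) auto

lemma bq_pow_less_1: "b * q ^ Suc k < 1"
proof -
  have "b * q * q ^ k \<le> b * q * 1"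
    using q_pos q_less_1 b_pos by (intro mult_left_mono power_le_one) auto
  then show ?thesis using bq_less_1 by (simp add: algebra_simps)
qed

lemma qfact_q_pos: "0 < qfact q q n"
  using q_pos q_less_1 by (simp add: qfact_pos)

lemma qfact_bq_pos: "0 < qfact (b * q ^ Suc k) q n"
  using qfact_pos[OF q_pos q_less_1 bq_pow_less_1] .

lemma qfact_bq_0_pos: "0 < qfact (b * q) q n"
  using qfact_bq_pos[of 0] by simp

text \<open>The coefficient of \<open>t^n\<close> in \<open>F_k\<close>, normalized by
  \<open>F_k(0) = 1\<close>: the power \<open>q^(n (\<nu> + k + n))\<close> of Jackson's series
  becomes \<open>q^(n^2) (b q^k)^n\<close>.\<close>

definition bessel_coeff :: "nat \<Rightarrow> nat \<Rightarrow> real" where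
  "bessel_coeff k n = (- 1) ^ n * q ^ n\<^sup>2 * (b * q ^ k) ^ n / (qfact q q n * qfact (b * q ^ Suc k) q n)"

definition recur :: "nat \<Rightarrow> real" where
  "recur k = b * q ^ Suc k / ((1 - b * q ^ Suc k) * (1 - b * q ^ Suc (Suc k)))"

lemma recur_pos: "0 < recur k"
  using bq_pow_less_1[of k] bq_pow_less_1[of "Suc k"] b_pos q_pos by (simp add: recur_def del: power_Suc)

lemma bessel_coeff_0 [simp]: "bessel_coeff k 0 = 1"
  by (simp add: bessel_coeff_def)

text \<open>The three terms are multiples of one quantity, namely \<open>- W * P\<close>,
  \<open>- W * S\<close> and \<open>W\<close>. The recurrence is therefore \<open>P - S = 1\<close>,
  which is \<open>eq\<close> divided by \<open>1 - q * u\<close>.\<close>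

lemma bessel_coeff_recurrence:
  "bessel_coeff k (Suc n) = bessel_coeff (Suc k) (Suc n) - recur k * bessel_coeff (Suc (Suc k)) n"
proof -
  define c where "c = b * q ^ k"
  define u where "u = q ^ n"
  have c1: "c * q < 1" "c * q\<^sup>2 < 1" "c * q * u * q < 1" "q * u < 1"
    using bq_pow_less_1[of k] bq_pow_less_1[of "Suc k"] bq_pow_less_1[of "Suc (n + k)"] qpow_less_1[of n]
    by (auto simp: c_def u_def power_add power2_eq_square algebra_simps)
  define A where "A = qfact q q n"
  define B where "B = qfact (c * q * q * q) q n"
  have A: "A \<noteq> 0" and B: "B \<noteq> 0"
    using qfact_q_pos[of n] qfact_bq_pos[of "Suc (Suc k)" n] by (auto simp: A_def B_def c_def algebra_simps)
  have B1: "qfact (c * q * q) q (Suc n) = (1 - c * q * q) * B"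
    by (simp add: qfact_Suc_shift B_def)
  \<comment> \<open>Both sides equal \<open>qfact (c * q) q (Suc (Suc n))\<close>, with the first or
    the last factor split off.\<close>
  have "(1 - c * q) * qfact (c * q * q) q (Suc n) = qfact (c * q) q (Suc n) * (1 - c * q * q ^ Suc n)"
    by (metis qfact_Suc qfact_Suc_shift)
  moreover have "c * q * q ^ Suc n = c * q * u * q" by (simp add: u_def)
  ultimately have "qfact (c * q) q (Suc n) * (1 - c * q * u * q) = (1 - c * q) * ((1 - c * q * q) * B)"
    by (simp only: B1)
  moreover have "1 - c * q * u * q \<noteq> 0" using c1 by linarith
  ultimately have B0: "qfact (c * q) q (Suc n) = (1 - c * q) * ((1 - c * q * q) * B) / (1 - c * q * u * q)"
    by (intro nonzero_eq_divide_eq[THEN iffD2])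
  have A1: "qfact q q (Suc n) = A * (1 - q * u)"
    by (simp add: qfact_Suc A_def u_def)
  have un: "(c * q) ^ n = c ^ n * u" "(c * q * q) ^ n = c ^ n * u * u" "q ^ (Suc n)\<^sup>2 = q ^ n\<^sup>2 * u * u * q"
    by (auto simp: u_def power_mult_distrib power2_eq_square power_add)
  have nz: "1 - c * q \<noteq> 0" "1 - c * q * q \<noteq> 0" "1 - c * q * u * q \<noteq> 0" "1 - q * u \<noteq> 0"
    using c1 by (auto simp: power2_eq_square mult.assoc)
  have bq: "b * q ^ Suc k = c * q" "b * q ^ Suc (Suc k) = c * q * q" "b * q ^ Suc (Suc (Suc k)) = c * q * q * q"
    by (auto simp: c_def algebra_simps)
  have eq: "(1 - c * q * u * q) - q * u * (1 - c * q) = 1 - q * u"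
    by (simp add: algebra_simps)
  define W where "W = (-1) ^ n * (q ^ n\<^sup>2 * u * u * q) * c ^ n * c / ((1 - c * q) * (1 - c * q * q) * A * B)"
  define P where "P = (1 - c * q * u * q) / (1 - q * u)"
  define S where "S = (q * u * (1 - c * q)) / (1 - q * u)"
  have "P - S = 1" using nz unfolding P_def S_def diff_divide_distrib[symmetric] eq by simp
  then have P: "P = S + 1" by simp
  have "bessel_coeff k (Suc n) = - W * P"
    unfolding bessel_coeff_def bq c_def[symmetric] A1 B0 un W_def P_def power_Suc[of c] power_Suc[of "-1"] using nz A B
    by (simp add: divide_simps)
  moreover have "bessel_coeff (Suc k) (Suc n) = - W * S"
    unfolding bessel_coeff_def bq A1 B1 un W_def S_def power_Suc[of "c*q"] power_Suc[of "-1"] using nz A B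
    by (simp add: divide_simps un)
  moreover have "recur k * bessel_coeff (Suc (Suc k)) n = W"
    unfolding bessel_coeff_def recur_def bq A_def[symmetric] B_def[symmetric] un W_def using nz A B
    by (simp add: divide_simps)
  ultimately show ?thesis by (simp only: P) (simp add: ring_distribs)
qed

section \<open>The formal quotient \<open>G\<close>, the q-Lommel polynomials and their
  orthogonality\<close>

definition bessel_fps :: "nat \<Rightarrow> real fps" where
  "bessel_fps k = Abs_fps (bessel_coeff k)"

definition bessel_ratio :: "real fps" where
  "bessel_ratio = fps_const (1 / (1 - b * q)) * bessel_fps 1 / bessel_fps 0"

definition moment :: "nat \<Rightarrow> real" where
  "moment m = bessel_ratio $ m"

text \<open>The coefficient of \<open>t^j\<close> in \<open>R_k\<close>: up to sign and powers, the
  q-binomial of \<open>k - j\<close> over \<open>j\<close> times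
  \<open>(bq;q)_(k-j) / (bq;q)_j\<close>. The guard keeps truncated subtraction from producing
  spurious terms.\<close>

definition lommel_coeff :: "nat \<Rightarrow> nat \<Rightarrow> real" where
  "lommel_coeff k j = (if 2 * j \<le> k then
     (- b) ^ j * q ^ j\<^sup>2 * (qfact q q (k - j) / (qfact q q j * qfact q q (k - 2 * j)))
       * (qfact (b * q) q (k - j) / qfact (b * q) q j) else 0)"

lemma lommel_coeff_shift:
  "lommel_coeff (2 * j + d) j = (- b) ^ j * q ^ j\<^sup>2 * (qfact q q (j + d) / (qfact q q j * qfact q q d))
       * (qfact (b * q) q (j + d) / qfact (b * q) q j)"
  by (simp add: lommel_coeff_def mult_2)

lemma lommel_coeff_recurrence_0:
  "lommel_coeff (Suc k) 0 = (1 - b * q ^ Suc k) * lommel_coeff k 0"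
  using qfact_q_pos[of k] qpow_less_1[of k] by (simp add: lommel_coeff_def qfact_Suc)

text \<open>For \<open>k < 2 * j\<close> all terms vanish, and for \<open>k = 2 * j\<close> the
  middle one does. Otherwise put \<open>k = 2 * j + Suc d\<close>; after extracting the common
  factor \<open>W\<close> only the polynomial identity \<open>poly\<close> in
  \<open>A = q^(d+1)\<close> and \<open>B = q^(j+1)\<close> remains.\<close>

lemma lommel_coeff_recurrence:
  "lommel_coeff (Suc (Suc k)) (Suc j) =
     (1 - b * q ^ Suc (Suc k)) * lommel_coeff (Suc k) (Suc j) - b * q ^ Suc k * lommel_coeff k j"
proof -
  consider "k < 2 * j" | "k = 2 * j" | d where "k = 2 * j + Suc d"
    by (metis less_imp_Suc_add linorder_neqE_nat add_Suc_right)
  then show ?thesis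
  proof cases
    case 1
    then show ?thesis by (simp add: lommel_coeff_def)
  next
    case 2
    have "lommel_coeff (2 * Suc j + 0) (Suc j) = - b * q ^ Suc (2 * j) * lommel_coeff (2 * j + 0) j"
      unfolding lommel_coeff_shift
      using qfact_q_pos[of j] qfact_q_pos[of "Suc j"] qfact_bq_0_pos[of j] qfact_bq_0_pos[of "Suc j"]
      by (simp add: power2_eq_square power_add power_mult power_mult_distrib)
    moreover have "lommel_coeff (Suc (2 * j)) (Suc j) = 0" by (simp add: lommel_coeff_def)
    ultimately show ?thesis using 2 by simp
  next
    case (3 d)
    define A where "A = q ^ Suc d"
    define B where "B = q ^ Suc j"
    define Q where "Q = qfact q q"
    define P where "P = qfact (b * q) q"
    have pos: "Q i > 0" "P i > 0" for i by (auto simp: Q_def P_def qfact_q_pos qfact_bq_0_pos)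
    have s: "Q (Suc j) = Q j * (1 - B)" "Q (Suc d) = Q d * (1 - A)"
      "Q (Suc j + Suc d) = Q (j + Suc d) * (1 - A * B)" "Q (Suc j + d) = Q (j + Suc d)"
      "P (Suc j) = P j * (1 - b * B)"
      "P (Suc j + Suc d) = P (j + Suc d) * (1 - b * (A * B))" "P (Suc j + d) = P (j + Suc d)"
      by (simp_all add: Q_def P_def A_def B_def qfact_Suc power_add algebra_simps)
    have "B < 1" "A < 1" "b * B < 1" using qpow_less_1 bq_pow_less_1 by (auto simp: A_def B_def)
    then have nz: "1 - B \<noteq> 0" "1 - A \<noteq> 0" "1 - b * B \<noteq> 0" by auto
    have k: "Suc (Suc k) = 2 * Suc j + Suc d" "Suc k = 2 * Suc j + d" using 3 by auto
    have kp: "q ^ Suc (Suc k) = A * B * B" "q ^ Suc k = q * A * q ^ (2 * j)" "q ^ (Suc j)\<^sup>2 = q ^ j\<^sup>2 * q * q ^ (2 * j)"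
      using 3 by (auto simp: A_def B_def power_add power_mult power2_eq_square algebra_simps)
    define W where "W = (- b) ^ j * (- b) * q ^ j\<^sup>2 * q * q ^ (2 * j) * Q (j + Suc d) * P (j + Suc d) /
      (Q j * (1 - B) * Q d * (1 - A) * P j * (1 - b * B))"
    have poly: "(1 - A * B) * (1 - b * (A * B)) = (1 - b * (A * B * B)) * (1 - A) + A * (1 - B) * (1 - b * B)"
      by (simp add: algebra_simps)
    have "lommel_coeff (2 * Suc j + Suc d) (Suc j) = W * ((1 - A * B) * (1 - b * (A * B)))"
      unfolding lommel_coeff_shift Q_def[symmetric] P_def[symmetric] s W_def kp
      using nz pos[of j] pos[of d] by (simp add: divide_simps)
    moreover have "lommel_coeff (2 * Suc j + d) (Suc j) = W * (1 - A)"
      unfolding lommel_coeff_shift Q_def[symmetric] P_def[symmetric] s W_def kp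
      using nz pos[of j] pos[of d] by (simp add: divide_simps)
    moreover have "- b * q ^ Suc k * lommel_coeff (2 * j + Suc d) j = W * (A * (1 - B) * (1 - b * B))"
      unfolding lommel_coeff_shift Q_def[symmetric] P_def[symmetric] s W_def kp
      using nz pos[of j] pos[of d] by (simp add: divide_simps)
    ultimately show ?thesis unfolding k kp(1)[unfolded k] using 3 kp(1)[unfolded k]
      by (simp add: poly ring_distribs)
  qed
qed

definition lommel_fps :: "nat \<Rightarrow> real fps" where
  "lommel_fps k = Abs_fps (lommel_coeff k)"

lemma lommel_fps_recurrence:
  "lommel_fps (Suc (Suc k)) = fps_const (1 - b * q ^ Suc (Suc k)) * lommel_fps (Suc k)
     - fps_const (b * q ^ Suc k) * fps_X * lommel_fps k"
proof (rule fps_ext)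
  fix n
  show "lommel_fps (Suc (Suc k)) $ n = (fps_const (1 - b * q ^ Suc (Suc k)) * lommel_fps (Suc k)
     - fps_const (b * q ^ Suc k) * fps_X * lommel_fps k) $ n"
    by (cases n) (simp_all add: lommel_fps_def lommel_coeff_recurrence lommel_coeff_recurrence_0 mult.assoc del: power_Suc)
qed

lemma lommel_fps_0: "lommel_fps 0 = 1"
  by (rule fps_ext) (simp add: lommel_fps_def lommel_coeff_def)

lemma lommel_fps_1: "lommel_fps 1 = fps_const (1 - b * q)"
  by (rule fps_ext) (use q_less_1 in \<open>simp add: lommel_fps_def lommel_coeff_def qfact_def\<close>)

text \<open>The second solution of the recurrence of \<open>lommel_fps\<close>: the numerators
  \<open>S_k\<close> of the approximants \<open>S_k / R_k\<close> of \<open>G\<close>.\<close>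

fun lommel_assoc :: "nat \<Rightarrow> real fps" where
  "lommel_assoc 0 = 0"
| "lommel_assoc (Suc 0) = 1"
| "lommel_assoc (Suc (Suc k)) = fps_const (1 - b * q ^ Suc (Suc k)) * lommel_assoc (Suc k)
     - fps_const (b * q ^ Suc k) * fps_X * lommel_assoc k"

text \<open>Two steps of the recurrence bring in only one factor \<open>fps_X\<close>, so
  \<open>S_k\<close> has degree below \<open>k / 2\<close>. Hence \<open>R_k G\<close> has a gap
  between degree \<open>k / 2\<close> and degree \<open>k\<close>, and this gap is the
  orthogonality.\<close>

lemma lommel_assoc_nth_eq_0: "k \<le> 2 * m \<Longrightarrow> lommel_assoc k $ m = 0"
proof (induction k arbitrary: m rule: lommel_assoc.induct)
  case (2 m)
  then show ?case by (cases m) auto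
next
  case (3 k m)
  then show ?case by (cases m) (auto simp: mult.assoc)
qed simp

definition lead :: "nat \<Rightarrow> real" where
  "lead k = b ^ k * (\<Prod>i<k. q ^ Suc i)"

lemma lead_pos: "0 < lead k"
  using b_pos q_pos by (auto simp: lead_def intro!: mult_pos_pos prod_pos)

text \<open>Dividing \<open>F_k\<close> by \<open>(bq;q)_k\<close> clears the denominators of
  \<open>recur\<close>, leaving coefficients of the kind found in
  \<open>lommel_fps_recurrence\<close>.\<close>

definition bessel_normal :: "nat \<Rightarrow> real fps" where
  "bessel_normal k = fps_const (1 / qfact (b * q) q k) * bessel_fps k"

lemma bessel_normal_recurrence:
  "fps_const (b * q ^ Suc k) * fps_X * bessel_normal (Suc (Suc k)) =
     fps_const (1 - b * q ^ Suc k) * bessel_normal (Suc k) - bessel_normal k"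
proof -
  define P where "P = qfact (b * q) q k"
  define c where "c = b * q ^ Suc k"
  define u where "u = 1 - c"
  define v where "v = 1 - b * q ^ Suc (Suc k)"
  have r: "recur k = c / (u * v)" by (simp only: recur_def c_def u_def v_def)
  have nz: "u \<noteq> 0" "v \<noteq> 0" "P \<noteq> 0"
    using bq_pow_less_1[of k] bq_pow_less_1[of "Suc k"] qfact_bq_0_pos[of k]
    by (auto simp: P_def c_def u_def v_def simp del: power_Suc)
  have P: "qfact (b * q) q (Suc k) = P * u" "qfact (b * q) q (Suc (Suc k)) = P * u * v"
    by (simp_all add: qfact_Suc P_def c_def u_def v_def mult.assoc)
  show ?thesis
  proof (rule fps_ext)
    fix n
    show "(fps_const (b * q ^ Suc k) * fps_X * bessel_normal (Suc (Suc k))) $ n =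
     (fps_const (1 - b * q ^ Suc k) * bessel_normal (Suc k) - bessel_normal k) $ n"
    proof (cases n)
      case 0
      then show ?thesis unfolding bessel_normal_def P P_def[symmetric] c_def[symmetric] u_def[symmetric]
        using nz by (simp add: bessel_fps_def mult.assoc del: power_Suc)
    next
      case (Suc m)
      show ?thesis unfolding bessel_normal_def P P_def[symmetric] c_def[symmetric] u_def[symmetric]
        using nz by (simp add: Suc bessel_fps_def bessel_coeff_recurrence[of k] r mult.assoc
            right_diff_distrib diff_divide_distrib del: power_Suc)
    qed
  qed
qed

text \<open>\<open>R_k\<close> and \<open>S_k\<close> solve the same three-term recurrence, hence so
  does the left-hand side. In the induction step \<open>bessel_normal_recurrence\<close> at index
  \<open>Suc k\<close> merges the two remainders into one with a further factor
  \<open>fps_X\<close>.\<close>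

lemma lommel_bessel_identity:
  "lommel_fps k * bessel_normal 1 - lommel_assoc k * bessel_normal 0 =
     fps_const (lead k) * fps_X ^ k * bessel_normal (Suc k)"
proof (induction k rule: induct_nat_012)
  case 0
  show ?case by (simp add: lommel_fps_0 lead_def)
next
  case 1
  show ?case using bessel_normal_recurrence[of 0] by (simp add: lommel_fps_1[simplified] lead_def)
next
  case (ge2 k)
  have lead: "lead (Suc k) = lead k * (b * q ^ Suc k)" "lead (Suc (Suc k)) = lead (Suc k) * (b * q ^ Suc (Suc k))"
    by (simp_all add: lead_def algebra_simps)
  define c where "c = b * q ^ Suc k"
  define d where "d = b * q ^ Suc (Suc k)"
  have "lommel_fps (Suc (Suc k)) * bessel_normal 1 - lommel_assoc (Suc (Suc k)) * bessel_normal 0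
    = fps_const (1 - d) * (lommel_fps (Suc k) * bessel_normal 1 - lommel_assoc (Suc k) * bessel_normal 0)
      - fps_const c * fps_X * (lommel_fps k * bessel_normal 1 - lommel_assoc k * bessel_normal 0)"
    by (simp add: lommel_fps_recurrence c_def d_def algebra_simps del: power_Suc)
  also have "\<dots> = fps_const (1 - d) * (fps_const (lead (Suc k)) * fps_X ^ Suc k * bessel_normal (Suc (Suc k)))
      - fps_const c * fps_X * (fps_const (lead k) * fps_X ^ k * bessel_normal (Suc k))"
    using ge2 by simp
  also have "fps_const c * fps_X * (fps_const (lead k) * fps_X ^ k * bessel_normal (Suc k)) =
      fps_const (lead (Suc k)) * fps_X ^ Suc k * bessel_normal (Suc k)"
    unfolding lead(1) c_def[symmetric] fps_const_mult[symmetric] by (simp add: algebra_simps del: fps_const_mult)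
  also have "fps_const (1 - d) * (fps_const (lead (Suc k)) * fps_X ^ Suc k * bessel_normal (Suc (Suc k)))
      - fps_const (lead (Suc k)) * fps_X ^ Suc k * bessel_normal (Suc k)
    = fps_const (lead (Suc k)) * fps_X ^ Suc k * (fps_const (1 - d) * bessel_normal (Suc (Suc k)) - bessel_normal (Suc k))"
    by (simp add: algebra_simps)
  also have "\<dots> = fps_const (lead (Suc k)) * fps_X ^ Suc k * (fps_const d * fps_X * bessel_normal (Suc (Suc (Suc k))))"
    unfolding d_def bessel_normal_recurrence ..
  also have "\<dots> = fps_const (lead (Suc (Suc k))) * fps_X ^ Suc (Suc k) * bessel_normal (Suc (Suc (Suc k)))"
    unfolding lead(2) d_def[symmetric] fps_const_mult[symmetric] by (simp add: algebra_simps del: fps_const_mult)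
  finally show ?case .
qed

lemma bessel_fps_0_nth_0: "bessel_fps k $ 0 = 1"
  by (simp add: bessel_fps_def)

lemma bessel_ratio_mult: "bessel_ratio * bessel_normal 0 = bessel_normal 1"
  using bessel_fps_0_nth_0[of 0]
  by (simp add: bessel_ratio_def bessel_normal_def fps_divide_unit mult.assoc inverse_mult_eq_1 qfact_Suc)

lemma lommel_ratio_identity:
  "lommel_fps k * bessel_ratio =
     lommel_assoc k + fps_X ^ k * (fps_const (lead k) * bessel_normal (Suc k) * inverse (bessel_fps 0))"
proof -
  have n0: "bessel_normal 0 = bessel_fps 0" by (simp add: bessel_normal_def)
  have inv: "bessel_fps 0 * inverse (bessel_fps 0) = 1"
    using bessel_fps_0_nth_0[of 0] by (simp add: inverse_mult_eq_1')
  have "bessel_ratio = bessel_normal 1 * inverse (bessel_fps 0)"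
    using bessel_ratio_mult inv by (metis n0 mult.assoc mult.right_neutral)
  then have "lommel_fps k * bessel_ratio = (lommel_fps k * bessel_normal 1) * inverse (bessel_fps 0)"
    by (simp add: mult.assoc)
  also have "lommel_fps k * bessel_normal 1 =
     lommel_assoc k * bessel_fps 0 + fps_const (lead k) * fps_X ^ k * bessel_normal (Suc k)"
    using lommel_bessel_identity[of k] unfolding n0 by (simp add: algebra_simps)
  also have "\<dots> * inverse (bessel_fps 0) = lommel_assoc k * (bessel_fps 0 * inverse (bessel_fps 0)) +
     fps_X ^ k * (fps_const (lead k) * bessel_normal (Suc k) * inverse (bessel_fps 0))"
    by (simp add: algebra_simps)
  finally show ?thesis by (simp add: inv)
qed

text \<open>The sum is the coefficient of \<open>t^(l+i)\<close> in \<open>R_(2l) G\<close>. There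
  \<open>S_(2l)\<close> contributes nothing, having degree below \<open>l\<close>, and the remainder
  starts at \<open>t^(2l)\<close>; so only \<open>i = l\<close> survives, with the leading
  coefficient of the remainder.\<close>

lemma moment_orthogonality:
  assumes "i \<le> l"
  shows "(\<Sum>a\<le>l. lommel_coeff (2 * l) (l - a) * moment (i + a)) =
    (if i = l then lead (2 * l) / qfact (b * q) q (Suc (2 * l)) else 0)"
proof -
  have "(\<Sum>a\<le>l. lommel_coeff (2 * l) (l - a) * moment (i + a)) =
      (\<Sum>j\<le>l. lommel_coeff (2 * l) j * moment (i + (l - j)))"
    by (rule sum.reindex_bij_witness[of _ "\<lambda>j. l - j" "\<lambda>j. l - j"]) auto
  also have "\<dots> = (\<Sum>j\<le>l. lommel_coeff (2 * l) j * moment (l + i - j))"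
  proof (intro sum.cong refl)
    fix j assume "j \<in> {..l}"
    then have "i + (l - j) = l + i - j" by auto
    then show "lommel_coeff (2 * l) j * moment (i + (l - j)) = lommel_coeff (2 * l) j * moment (l + i - j)"
      by simp
  qed
  also have "\<dots> = (\<Sum>j=0..l+i. lommel_coeff (2 * l) j * moment (l + i - j))"
    by (rule sum.mono_neutral_left) (auto simp: lommel_coeff_def)
  also have "\<dots> = (lommel_fps (2 * l) * bessel_ratio) $ (l + i)"
    by (simp add: fps_mult_nth lommel_fps_def moment_def)
  also have "\<dots> = (fps_X ^ (2 * l) * (fps_const (lead (2 * l)) * bessel_normal (Suc (2 * l)) * inverse (bessel_fps 0))) $ (l + i)"
    by (simp add: lommel_ratio_identity lommel_assoc_nth_eq_0)
  also have "\<dots> = (if i = l then lead (2 * l) / qfact (b * q) q (Suc (2 * l)) else 0)"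
    using assms by (simp add: fps_X_power_mult_nth bessel_normal_def bessel_fps_0_nth_0)
  finally show ?thesis .
qed

end

section \<open>Matrices with a triangular orthogonalization\<close>

lemma nonzero_vec_entry:
  assumes "v \<in> carrier_vec N" "v \<noteq> 0\<^sub>v N"
  obtains i where "i < N" "vec_index v i \<noteq> 0"
proof -
  have "\<exists>i<N. vec_index v i \<noteq> 0"
  proof (rule ccontr)
    assume "\<not> ?thesis"
    then have "v = 0\<^sub>v N" using assms(1) by (intro eq_vecI) auto
    with assms(2) show False by simp
  qed
  then show thesis using that by blast
qed

text \<open>A complex eigenvector \<open>x + iy\<close> exists. Symmetry of \<open>M\<close> forces
  \<open>Im \<mu>\<close> times the squared norm to vanish, so \<open>\<mu>\<close> is real and
  whichever of \<open>x\<close>, \<open>y\<close> is nonzero is a real eigenvector. This makes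
  \<open>Min (spectrum M)\<close> meaningful.\<close>

lemma real_symmetric_has_eigenvalue:
  fixes M :: "real mat"
  assumes M: "M \<in> carrier_mat N N" and N: "0 < N"
    and sym: "\<And>i j. i < N \<Longrightarrow> j < N \<Longrightarrow> M $$ (i, j) = M $$ (j, i)"
  shows "spectrum M \<noteq> {}"
proof -
  let ?Mc = "map_mat complex_of_real M"
  have Mc: "?Mc \<in> carrier_mat N N" using M by simp
  from spectrum_non_empty[OF Mc N] obtain \<mu> where "eigenvalue ?Mc \<mu>"
    by (auto simp: spectrum_def)
  then obtain v where v: "v \<in> carrier_vec N" "v \<noteq> 0\<^sub>v N" "?Mc *\<^sub>v v = \<mu> \<cdot>\<^sub>v v"
    using Mc by (auto simp: eigenvalue_def eigenvector_def)
  define x where "x = (\<lambda>j. Re (vec_index v j))"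
  define y where "y = (\<lambda>j. Im (vec_index v j))"
  have ev: "(\<Sum>k<N. complex_of_real (M $$ (j, k)) * vec_index v k) = \<mu> * vec_index v j" if "j < N" for j
  proof -
    have "(\<Sum>k<N. complex_of_real (M $$ (j, k)) * vec_index v k) = vec_index (?Mc *\<^sub>v v) j"
      using that v(1) M by (simp add: scalar_prod_def atLeast0LessThan)
    then show ?thesis using that v(1) by (simp add: v(3))
  qed
  have Mx: "(\<Sum>k<N. M $$ (j, k) * x k) = Re \<mu> * x j - Im \<mu> * y j"
    and My: "(\<Sum>k<N. M $$ (j, k) * y k) = Re \<mu> * y j + Im \<mu> * x j" if "j < N" for j
    using arg_cong[OF ev[OF that], of Re] arg_cong[OF ev[OF that], of Im]
    by (simp_all add: x_def y_def)
  have "(\<Sum>j<N. y j * (\<Sum>k<N. M $$ (j, k) * x k)) = (\<Sum>j<N. \<Sum>k<N. M $$ (j, k) * y j * x k)"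
    by (simp add: sum_distrib_left mult_ac)
  also have "\<dots> = (\<Sum>k<N. \<Sum>j<N. M $$ (j, k) * y j * x k)" by (rule sum.swap)
  also have "\<dots> = (\<Sum>k<N. x k * (\<Sum>j<N. M $$ (k, j) * y j))"
    by (auto simp: sum_distrib_left mult_ac sym intro!: sum.cong)
  finally have "(\<Sum>j<N. y j * (Re \<mu> * x j - Im \<mu> * y j)) = (\<Sum>j<N. x j * (Re \<mu> * y j + Im \<mu> * x j))"
    using Mx My by simp
  then have "(\<Sum>j<N. x j * (Re \<mu> * y j + Im \<mu> * x j) - y j * (Re \<mu> * x j - Im \<mu> * y j)) = 0"
    by (simp add: sum_subtractf)
  also have "(\<Sum>j<N. x j * (Re \<mu> * y j + Im \<mu> * x j) - y j * (Re \<mu> * x j - Im \<mu> * y j)) =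
      Im \<mu> * (\<Sum>j<N. (x j)\<^sup>2 + (y j)\<^sup>2)"
    by (simp add: sum_distrib_left power2_eq_square algebra_simps)
  finally have im: "Im \<mu> * (\<Sum>j<N. (x j)\<^sup>2 + (y j)\<^sup>2) = 0" .
  obtain i where i: "i < N" "vec_index v i \<noteq> 0"
    by (rule nonzero_vec_entry[OF v(1,2)])
  then have xyi: "x i \<noteq> 0 \<or> y i \<noteq> 0" by (auto simp: x_def y_def complex_eq_iff)
  have "0 < (\<Sum>j<N. (x j)\<^sup>2 + (y j)\<^sup>2)"
    using xyi by (intro sum_pos2[of _ i]) (auto simp: i sum_power2_gt_zero_iff)
  with im have im0: "Im \<mu> = 0" by simp
  have "eigenvalue M (Re \<mu>)" if z: "\<And>j. j < N \<Longrightarrow> (\<Sum>k<N. M $$ (j, k) * z k) = Re \<mu> * z j" and zi: "z i \<noteq> 0" for z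
  proof -
    have "eigenvector M (Matrix.vec N z) (Re \<mu>)"
      unfolding eigenvector_def
    proof (intro conjI)
      show "M *\<^sub>v Matrix.vec N z = Re \<mu> \<cdot>\<^sub>v Matrix.vec N z"
        using M z by (intro eq_vecI) (auto simp: scalar_prod_def atLeast0LessThan)
      show "Matrix.vec N z \<noteq> 0\<^sub>v (dim_row M)"
      proof
        assume "Matrix.vec N z = 0\<^sub>v (dim_row M)"
        then have "vec_index (Matrix.vec N z) i = vec_index (0\<^sub>v N) i" using M by simp
        then show False using zi i(1) by simp
      qed
    qed (use M in auto)
    then show ?thesis by (auto simp: eigenvalue_def)
  qed
  from this[of x] this[of y] xyi Mx My im0 have "eigenvalue M (Re \<mu>)" by auto
  then show ?thesis by (auto simp: spectrum_def)
qed

text \<open>\<open>D\<close> lists the reciprocals of the diagonal entries of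
  \<open>C M C^T\<close>. Orthogonality is demanded only for \<open>i < l\<close>; the symmetry of
  \<open>M\<close> supplies the other half.\<close>

locale triangular_orthogonalization =
  fixes N :: nat and M C :: "real mat" and D :: "nat \<Rightarrow> real"
  assumes N_pos: "0 < N" and M: "M \<in> carrier_mat N N" and C: "C \<in> carrier_mat N N"
    and sym: "\<And>i j. i < N \<Longrightarrow> j < N \<Longrightarrow> M $$ (i, j) = M $$ (j, i)"
    and lower: "\<And>l a. l < a \<Longrightarrow> a < N \<Longrightarrow> C $$ (l, a) = 0"
    and orth: "\<And>i l. i < l \<Longrightarrow> l < N \<Longrightarrow> (\<Sum>a<N. C $$ (l, a) * M $$ (a, i)) = 0"
    and orth_diag: "\<And>l. l < N \<Longrightarrow> (\<Sum>a<N. C $$ (l, a) * M $$ (a, l)) * C $$ (l, l) = 1 / D l"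
    and D_pos: "\<And>l. l < N \<Longrightarrow> 0 < D l"
begin

text \<open>Row \<open>l\<close> of \<open>C M\<close> vanishes left of column \<open>l\<close>, and
  row \<open>m\<close> of \<open>C\<close> vanishes right of column \<open>m\<close>. So the entry
  \<open>e l m\<close> is zero for \<open>m < l\<close>, by symmetry for \<open>l < m\<close>, and a
  single product for \<open>l = m\<close>.\<close>

lemma congruent_diag: "C * M * C\<^sup>T = mat_diag N (\<lambda>l. 1 / D l)"
proof -
  define e where "e = (\<lambda>l m. \<Sum>i<N. (\<Sum>a<N. C $$ (l, a) * M $$ (a, i)) * C $$ (m, i))"
  have e_less: "e l m = 0" if "m < l" "l < N" for l m
    unfolding e_def
  proof (rule sum.neutral, rule ballI)
    fix i assume "i \<in> {..<N}"
    then show "(\<Sum>a<N. C $$ (l, a) * M $$ (a, i)) * C $$ (m, i) = 0"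
      using orth[of i l] lower[of m i] that by (cases "i \<le> m") auto
  qed
  have e_sym: "e l m = e m l" if "l < N" "m < N" for l m
  proof -
    have "e l m = (\<Sum>i<N. \<Sum>a<N. C $$ (l, a) * M $$ (a, i) * C $$ (m, i))"
      by (simp add: e_def sum_distrib_right)
    also have "\<dots> = (\<Sum>a<N. \<Sum>i<N. C $$ (l, a) * M $$ (a, i) * C $$ (m, i))" by (rule sum.swap)
    also have "\<dots> = e m l"
      by (auto simp: e_def sum_distrib_right sym intro!: sum.cong)
    finally show ?thesis .
  qed
  have e_diag: "e l l = 1 / D l" if "l < N" for l
  proof -
    have "(\<Sum>a<N. C $$ (l, a) * M $$ (a, i)) * C $$ (l, i) = 0" if "i \<in> {..<N} - {l}" for i
      using orth[of i l] lower[of l i] \<open>l < N\<close> that by (cases "i < l") auto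
    then have "e l l = (\<Sum>i\<in>{l}. (\<Sum>a<N. C $$ (l, a) * M $$ (a, i)) * C $$ (l, i))"
      unfolding e_def by (intro sum.mono_neutral_right) (use that in auto)
    then show ?thesis using orth_diag[OF that] by simp
  qed
  have e: "e l m = (if l = m then 1 / D l else 0)" if "l < N" "m < N" for l m
    using e_less[of m l] e_less[of l m] e_sym[of l m] e_diag that
    by (metis linorder_neqE_nat)
  show ?thesis
  proof (rule eq_matI)
    fix l m assume "l < dim_row (mat_diag N (\<lambda>l. 1 / D l))" "m < dim_col (mat_diag N (\<lambda>l. 1 / D l))"
    then have lm: "l < N" "m < N" by (auto simp: mat_diag_def)
    have "(C * M * C\<^sup>T) $$ (l, m) = (\<Sum>a<N. C $$ (l, a) * (\<Sum>i<N. M $$ (a, i) * C $$ (m, i)))"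
      using M C lm by (auto simp: scalar_prod_def atLeast0LessThan intro!: sum.cong)
    also have "\<dots> = (\<Sum>a<N. \<Sum>i<N. C $$ (l, a) * M $$ (a, i) * C $$ (m, i))"
      by (simp add: sum_distrib_left mult_ac)
    also have "\<dots> = (\<Sum>i<N. \<Sum>a<N. C $$ (l, a) * M $$ (a, i) * C $$ (m, i))" by (rule sum.swap)
    also have "\<dots> = e l m" by (simp add: e_def sum_distrib_right)
    finally show "(C * M * C\<^sup>T) $$ (l, m) = mat_diag N (\<lambda>l. 1 / D l) $$ (l, m)"
      using lm by (simp add: e mat_diag_def)
  qed (use M C in \<open>auto simp: mat_diag_def\<close>)
qed

definition inv_mat :: "real mat" where
  "inv_mat = Matrix.mat N N (\<lambda>(j, k). \<Sum>l<N. D l * C $$ (l, j) * C $$ (l, k))"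

lemma inv_mat_carrier: "inv_mat \<in> carrier_mat N N"
  by (simp add: inv_mat_def)

lemma inv_mat_eq: "inv_mat = C\<^sup>T * (mat_diag N D * C)"
proof (rule eq_matI)
  fix j k assume "j < dim_row (C\<^sup>T * (mat_diag N D * C))" "k < dim_col (C\<^sup>T * (mat_diag N D * C))"
  then have "j < N" "k < N" using C by auto
  then show "inv_mat $$ (j, k) = (C\<^sup>T * (mat_diag N D * C)) $$ (j, k)"
    using C by (auto simp: inv_mat_def mat_diag_mult_left[OF C] scalar_prod_def atLeast0LessThan mult_ac intro!: sum.cong)
qed (use C in \<open>auto simp: inv_mat_def\<close>)

text \<open>Since \<open>(C M C^T) D = 1\<close>, the square matrix \<open>C\<close> has the right
  inverse \<open>M C^T D\<close>, which is then also a left inverse. Reading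
  \<open>(M C^T D) C = 1\<close> with other brackets gives \<open>M (C^T D C) = 1\<close>.\<close>

lemma right_inverse: "M * inv_mat = 1\<^sub>m N"
  and left_inverse: "inv_mat * M = 1\<^sub>m N"
proof -
  have CT: "C\<^sup>T \<in> carrier_mat N N" and DD: "mat_diag N D \<in> carrier_mat N N"
    using C by (auto simp: mat_diag_def)
  have "mat_diag N (\<lambda>l. 1 / D l) * mat_diag N D = 1\<^sub>m N"
    unfolding mat_diag_diag using D_pos by (intro eq_matI) (auto simp: mat_diag_def less_imp_neq[symmetric])
  then have "C * M * C\<^sup>T * mat_diag N D = 1\<^sub>m N" by (simp add: congruent_diag)
  then have "C * (M * C\<^sup>T * mat_diag N D) = 1\<^sub>m N"
    using C M CT DD by (simp add: assoc_mult_mat[of _ N N _ N _ N])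
  from mat_mult_left_right_inverse[OF C _ this]
  have "(M * C\<^sup>T * mat_diag N D) * C = 1\<^sub>m N"
    using M CT DD by (meson mult_carrier_mat)
  then show r: "M * inv_mat = 1\<^sub>m N"
    using C M CT DD by (simp add: inv_mat_eq assoc_mult_mat[of _ N N _ N _ N])
  show "inv_mat * M = 1\<^sub>m N"
    by (rule mat_mult_left_right_inverse[OF M inv_mat_carrier r])
qed

lemma det_eq: "Determinant.det M * (\<Prod>l<N. C $$ (l, l))\<^sup>2 = (\<Prod>l<N. 1 / D l)"
proof -
  have dC: "Determinant.det C = (\<Prod>l<N. C $$ (l, l))"
    using det_lower_triangular[OF lower C] C
    by (simp add: prod_list_diag_prod atLeast0LessThan)
  have dD: "Determinant.det (mat_diag N (\<lambda>l. 1 / D l)) = (\<Prod>l<N. 1 / D l)"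
    by (subst det_upper_triangular[of _ N])
      (auto simp: prod_list_diag_prod atLeast0LessThan mat_diag_def)
  have "Determinant.det (C * M * C\<^sup>T) = Determinant.det C * Determinant.det M * Determinant.det C"
    using C M by (simp add: det_mult[of _ N] det_transpose[OF C])
  then show ?thesis using congruent_diag dC dD by (simp add: power2_eq_square mult_ac)
qed

text \<open>For an eigenvector \<open>x\<close>, the squared norm \<open>s\<close> equals
  \<open>\<mu>\<close> times \<open>Q\<close>, the quadratic form of the inverse matrix. That form
  is the sum of \<open>D l\<close> times the square of \<open>(C x)_l\<close>, and
  \<open>\<bar>x_j\<bar> \<le> sqrt s\<close> bounds it by \<open>B * s\<close>. Absolute row sums
  are used because they turn out to be values of q-Lommel polynomials at the imaginary unit.\<close>

lemma eigenvalue_lower_bound: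
  assumes "eigenvalue M \<mu>" and B: "(\<Sum>l<N. D l * (\<Sum>a<N. \<bar>C $$ (l, a)\<bar>)\<^sup>2) \<le> B"
  shows "inverse B \<le> \<mu>"
proof -
  obtain v where v: "v \<in> carrier_vec N" "v \<noteq> 0\<^sub>v N" "M *\<^sub>v v = \<mu> \<cdot>\<^sub>v v"
    using assms(1) M by (auto simp: eigenvalue_def eigenvector_def)
  define x where "x = vec_index v"
  have "v = (inv_mat * M) *\<^sub>v v" using left_inverse v by simp
  also have "\<dots> = inv_mat *\<^sub>v (\<mu> \<cdot>\<^sub>v v)" using v M inv_mat_carrier by (simp add: v(3)[symmetric])
  finally have iv: "v = inv_mat *\<^sub>v (\<mu> \<cdot>\<^sub>v v)" .
  have x: "x j = (\<Sum>k<N. inv_mat $$ (j, k) * (\<mu> * x k))" if "j < N" for j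
    using arg_cong[OF iv, of "\<lambda>v. vec_index v j"] that v inv_mat_carrier
    by (simp add: x_def scalar_prod_def atLeast0LessThan)
  obtain i where i: "i < N" "x i \<noteq> 0"
    unfolding x_def by (rule nonzero_vec_entry[OF v(1,2)])
  define s where "s = (\<Sum>j<N. (x j)\<^sup>2)"
  have s: "0 < s" unfolding s_def using i by (intro sum_pos2[of _ i]) auto
  define Q where "Q = (\<Sum>l<N. D l * (\<Sum>j<N. C $$ (l, j) * x j)\<^sup>2)"
  have "s = (\<Sum>j<N. x j * (\<Sum>k<N. inv_mat $$ (j, k) * (\<mu> * x k)))"
    unfolding s_def power2_eq_square
    by (intro sum.cong refl arg_cong[where f = "(*) (x _)"] x) simp
  also have "\<dots> = (\<Sum>j<N. x j * (\<Sum>k<N. (\<Sum>l<N. D l * C $$ (l, j) * C $$ (l, k)) * (\<mu> * x k)))"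
    by (simp add: inv_mat_def)
  also have "\<dots> = (\<Sum>j<N. \<Sum>k<N. \<Sum>l<N. \<mu> * (D l * (C $$ (l, j) * x j) * (C $$ (l, k) * x k)))"
    unfolding sum_distrib_left sum_distrib_right by (simp only: mult_ac)
  also have "\<dots> = (\<Sum>j<N. \<Sum>l<N. \<Sum>k<N. \<mu> * (D l * (C $$ (l, j) * x j) * (C $$ (l, k) * x k)))"
    by (intro sum.cong sum.swap refl)
  also have "\<dots> = (\<Sum>l<N. \<Sum>j<N. \<Sum>k<N. \<mu> * (D l * (C $$ (l, j) * x j) * (C $$ (l, k) * x k)))"
    by (rule sum.swap)
  also have "\<dots> = (\<Sum>l<N. \<mu> * (D l * (\<Sum>j<N. C $$ (l, j) * x j)\<^sup>2))"
    unfolding power2_eq_square sum_product by (simp only: sum_distrib_left mult.assoc)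
  also have "\<dots> = \<mu> * Q"
    unfolding Q_def sum_distrib_left ..
  finally have sQ: "s = \<mu> * Q" .
  have "(\<Sum>j<N. C $$ (l, j) * x j)\<^sup>2 \<le> (\<Sum>a<N. \<bar>C $$ (l, a)\<bar>)\<^sup>2 * s" for l
  proof -
    have xj: "\<bar>x j\<bar> \<le> sqrt s" if "j < N" for j
    proof -
      have "(x j)\<^sup>2 \<le> s" unfolding s_def using that by (intro member_le_sum) auto
      then show ?thesis using real_le_rsqrt[of "\<bar>x j\<bar>" s] by simp
    qed
    have "\<bar>\<Sum>j<N. C $$ (l, j) * x j\<bar> \<le> (\<Sum>j<N. \<bar>C $$ (l, j)\<bar> * sqrt s)"
      by (rule order_trans[OF sum_abs]) (auto simp: abs_mult intro!: sum_mono mult_left_mono xj)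
    also have "\<dots> = (\<Sum>a<N. \<bar>C $$ (l, a)\<bar>) * sqrt s" by (simp add: sum_distrib_right)
    finally have "\<bar>\<Sum>j<N. C $$ (l, j) * x j\<bar>\<^sup>2 \<le> ((\<Sum>a<N. \<bar>C $$ (l, a)\<bar>) * sqrt s)\<^sup>2"
      by (intro power_mono) auto
    then show ?thesis using s by (simp add: power_mult_distrib)
  qed
  then have "Q \<le> (\<Sum>l<N. D l * ((\<Sum>a<N. \<bar>C $$ (l, a)\<bar>)\<^sup>2 * s))"
    unfolding Q_def using D_pos by (intro sum_mono mult_left_mono) (auto intro: less_imp_le)
  also have "\<dots> = (\<Sum>l<N. D l * (\<Sum>a<N. \<bar>C $$ (l, a)\<bar>)\<^sup>2) * s"
    unfolding sum_distrib_right by (simp only: mult.assoc)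
  also have "\<dots> \<le> B * s" using B s by (intro mult_right_mono) auto
  finally have QB: "Q \<le> B * s" .
  have "0 \<le> Q" unfolding Q_def using D_pos by (intro sum_nonneg mult_nonneg_nonneg) (auto intro: less_imp_le)
  have mu: "0 < \<mu>"
  proof (rule ccontr)
    assume "\<not> 0 < \<mu>"
    then have "\<mu> * Q \<le> 0" using \<open>0 \<le> Q\<close> by (intro mult_nonpos_nonneg) auto
    with sQ s show False by simp
  qed
  have "\<mu> * Q \<le> \<mu> * (B * s)" using QB mu by (intro mult_left_mono) auto
  then have "s \<le> \<mu> * (B * s)" unfolding sQ[symmetric] .
  then have "1 * s \<le> (\<mu> * B) * s" by (simp add: mult.assoc)
  then have "1 \<le> \<mu> * B" using s by (rule mult_right_le_imp_le)
  moreover from this have "0 < \<mu> * B" by linarith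
  then have "0 < B" using mu by (rule zero_less_mult_pos)
  ultimately show ?thesis by (simp add: field_simps)
qed

lemma Min_spectrum_lower_bound:
  assumes "(\<Sum>l<N. D l * (\<Sum>a<N. \<bar>C $$ (l, a)\<bar>)\<^sup>2) \<le> B"
  shows "inverse B \<le> Min (spectrum M)"
proof (subst Min_ge_iff)
  show "finite (spectrum M)" using card_finite_spectrum(1)[OF M] .
  show "spectrum M \<noteq> {}" using real_symmetric_has_eigenvalue[OF M N_pos sym] .
  show "\<forall>a\<in>spectrum M. inverse B \<le> a"
    using eigenvalue_lower_bound[OF _ assms] by (auto simp: spectrum_def)
qed

end

section \<open>The Hankel matrix of the moments\<close>

context q_bessel
begin

definition hankel :: "nat \<Rightarrow> real mat" where
  "hankel n = Matrix.mat (Suc n) (Suc n) (\<lambda>(i, j). moment (i + j) / 4 ^ (i + j))"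

text \<open>Row \<open>l\<close> holds the coefficients of the reversed polynomial
  \<open>R_(2l)\<close>; the factor \<open>4 ^ a\<close> cancels the column scaling of
  \<open>hankel\<close>.\<close>

definition lommel_mat :: "nat \<Rightarrow> real mat" where
  "lommel_mat n = Matrix.mat (Suc n) (Suc n) (\<lambda>(l, a). if a \<le> l then lommel_coeff (2 * l) (l - a) * 4 ^ a else 0)"

definition lommel_weight :: "nat \<Rightarrow> real" where
  "lommel_weight l = (1 - b * q ^ Suc (2 * l)) / lead (2 * l)"

lemma lommel_mat_hankel:
  assumes "i \<le> l" "l \<le> n"
  shows "(\<Sum>a<Suc n. lommel_mat n $$ (l, a) * hankel n $$ (a, i)) =
    (if i = l then lead (2 * l) / qfact (b * q) q (Suc (2 * l)) / 4 ^ l else 0)"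
proof -
  have "(\<Sum>a<Suc n. lommel_mat n $$ (l, a) * hankel n $$ (a, i)) =
      (\<Sum>a<Suc n. if a \<le> l then lommel_coeff (2 * l) (l - a) * moment (i + a) / 4 ^ i else 0)"
    using assms by (intro sum.cong) (auto simp: lommel_mat_def hankel_def power_add add.commute)
  also have "\<dots> = (\<Sum>a\<le>l. lommel_coeff (2 * l) (l - a) * moment (i + a) / 4 ^ i)"
    using assms by (intro sum.mono_neutral_cong_right) auto
  also have "\<dots> = (\<Sum>a\<le>l. lommel_coeff (2 * l) (l - a) * moment (i + a)) / 4 ^ i"
    by (simp add: sum_divide_distrib)
  finally show ?thesis using assms by (simp add: moment_orthogonality)
qed

lemma lommel_mat_diag: "l \<le> n \<Longrightarrow> lommel_mat n $$ (l, l) = qfact (b * q) q (2 * l) * 4 ^ l"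
  using qfact_q_pos[of "2 * l"] by (simp add: lommel_mat_def lommel_coeff_def)

lemma hankel_orthogonalization:
  "triangular_orthogonalization (Suc n) (hankel n) (lommel_mat n) lommel_weight"
proof
  show "hankel n $$ (i, j) = hankel n $$ (j, i)" if "i < Suc n" "j < Suc n" for i j
    using that by (simp add: hankel_def add.commute)
  show "lommel_mat n $$ (l, a) = 0" if "l < a" "a < Suc n" for l a
    using that by (simp add: lommel_mat_def)
  show "(\<Sum>a<Suc n. lommel_mat n $$ (l, a) * hankel n $$ (a, i)) = 0" if "i < l" "l < Suc n" for i l
    using that by (simp add: lommel_mat_hankel del: sum.lessThan_Suc)
  show "(\<Sum>a<Suc n. lommel_mat n $$ (l, a) * hankel n $$ (a, l)) * lommel_mat n $$ (l, l) = 1 / lommel_weight l"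
    if "l < Suc n" for l
  proof -
    have "(\<Sum>a<Suc n. lommel_mat n $$ (l, a) * hankel n $$ (a, l)) * lommel_mat n $$ (l, l) =
      lead (2 * l) / qfact (b * q) q (Suc (2 * l)) * qfact (b * q) q (2 * l)"
      using that by (simp add: lommel_mat_hankel lommel_mat_diag del: sum.lessThan_Suc)
    then show ?thesis
      using qfact_bq_0_pos[of "2 * l"] by (simp add: lommel_weight_def qfact_Suc mult.assoc)
  qed
  show "0 < lommel_weight l" for l
    using bq_pow_less_1[of "2 * l"] lead_pos[of "2 * l"] by (simp add: lommel_weight_def)
qed (auto simp: hankel_def lommel_mat_def)

text \<open>Stated for the unscaled moments; it serves to exclude a measure with finitely many atoms
  in \<open>infinite_zeros\<close>.\<close>

lemma hankel_nonsingular: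
  assumes "\<And>i. i \<le> n \<Longrightarrow> (\<Sum>a\<le>n. moment (i + a) * v a) = 0" "a \<le> n"
  shows "v a = 0"
proof -
  interpret triangular_orthogonalization "Suc n" "hankel n" "lommel_mat n" lommel_weight
    by (rule hankel_orthogonalization)
  define w where "w = Matrix.vec (Suc n) (\<lambda>a. v a * 4 ^ a)"
  have "hankel n *\<^sub>v w = 0\<^sub>v (Suc n)"
  proof (rule eq_vecI)
    fix i assume i: "i < dim_vec (0\<^sub>v (Suc n) :: real Matrix.vec)"
    have "vec_index (hankel n *\<^sub>v w) i = (\<Sum>a<Suc n. moment (i + a) / 4 ^ (i + a) * (v a * 4 ^ a))"
      using i by (simp add: hankel_def w_def scalar_prod_def atLeast0LessThan del: sum.lessThan_Suc)
    also have "\<dots> = (\<Sum>a<Suc n. moment (i + a) * v a / 4 ^ i)"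
      by (intro sum.cong) (auto simp: power_add)
    also have "\<dots> = (\<Sum>a\<le>n. moment (i + a) * v a) / 4 ^ i"
      unfolding sum_divide_distrib lessThan_Suc_atMost ..
    finally show "vec_index (hankel n *\<^sub>v w) i = vec_index (0\<^sub>v (Suc n)) i"
      using assms(1) i by simp
  qed (simp add: hankel_def)
  moreover have w: "w \<in> carrier_vec (Suc n)" by (simp add: w_def)
  moreover have "w = (inv_mat * hankel n) *\<^sub>v w" using left_inverse w by simp
  moreover have "(inv_mat * hankel n) *\<^sub>v w = inv_mat *\<^sub>v (hankel n *\<^sub>v w)"
    using inv_mat_carrier M w by simp
  ultimately have "w = inv_mat *\<^sub>v 0\<^sub>v (Suc n)" by simp
  then have "w = 0\<^sub>v (Suc n)" using inv_mat_carrier by (intro eq_vecI) (auto simp: inv_mat_def scalar_prod_def)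
  then have "vec_index w a = 0" using assms(2) by simp
  then show ?thesis using assms(2) by (simp add: w_def)
qed

end

section \<open>The entire functions and their zeros\<close>

context q_bessel
begin

lemma abs_bessel_coeff: "\<bar>bessel_coeff k n\<bar> = q ^ n\<^sup>2 * (b * q ^ k) ^ n / (qfact q q n * qfact (b * q ^ Suc k) q n)"
  using q_pos b_pos qfact_q_pos[of n] qfact_bq_pos[of k n]
  by (simp add: bessel_coeff_def abs_mult power_abs)

lemma qfact_mono: "a' \<le> a \<Longrightarrow> a < 1 \<Longrightarrow> qfact a q n \<le> qfact a' q n"
  unfolding qfact_def
proof (rule prod_mono, intro conjI)
  fix k assume "a' \<le> a" "a < 1"
  have qk: "0 \<le> q ^ k" "q ^ k \<le> 1" using q_pos q_less_1 by (auto intro: power_le_one)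
  have "a * q ^ k \<le> 1"
    using \<open>a < 1\<close> qk by (cases "a \<le> 0") (auto intro: mult_le_one order_trans[OF mult_nonpos_nonneg])
  then show "0 \<le> 1 - a * q ^ k" by simp
  show "1 - a * q ^ k \<le> 1 - a' * q ^ k"
    using \<open>a' \<le> a\<close> qk by (simp add: mult_right_mono)
qed

text \<open>The gain \<open>q ^ (k * n)\<close> has two uses: it makes \<open>F_k\<close> tend to 1
  as \<open>k\<close> grows, and with \<open>k = 1\<close> it shows that \<open>F_1\<close> is small
  compared with \<open>F_0\<close> far out on the negative axis.\<close>

lemma abs_bessel_coeff_le: "\<bar>bessel_coeff k n\<bar> \<le> q ^ (k * n) * \<bar>bessel_coeff 0 n\<bar>"
proof -
  have "b * q ^ Suc k \<le> b * q"
    using q_pos q_less_1 b_pos by (simp add: mult_left_le power_le_one)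
  then have "qfact (b * q) q n \<le> qfact (b * q ^ Suc k) q n"
    using bq_less_1 by (rule qfact_mono)
  then have "q ^ n\<^sup>2 * (b * q ^ k) ^ n / (qfact q q n * qfact (b * q ^ Suc k) q n) \<le>
     q ^ n\<^sup>2 * (b * q ^ k) ^ n / (qfact q q n * qfact (b * q) q n)"
    using q_pos b_pos qfact_q_pos[of n] qfact_bq_0_pos[of n]
    by (intro divide_left_mono mult_left_mono mult_pos_pos) (auto simp: qfact_bq_pos simp del: power_Suc)
  also have "\<dots> = q ^ (k * n) * \<bar>bessel_coeff 0 n\<bar>"
    by (simp add: abs_bessel_coeff power_mult_distrib power_mult)
  finally show ?thesis unfolding abs_bessel_coeff .
qed

text \<open>The quotient of consecutive coefficients is \<open>O(q^n)\<close>, so the ratio test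
  works for every radius and \<open>F_0\<close> is entire.\<close>

lemma abs_bessel_coeff_Suc_le: "\<bar>bessel_coeff 0 (Suc n)\<bar> \<le> q ^ n * (b / ((1 - q) * (1 - b * q))) * \<bar>bessel_coeff 0 n\<bar>"
proof -
  have q1: "q * q ^ n \<le> q" "b * q * q ^ n \<le> b * q"
    using q_pos q_less_1 b_pos by (auto simp: mult_left_le power_le_one)
  define A where "A = qfact q q n * qfact (b * q) q n"
  have A: "A > 0" using qfact_q_pos qfact_bq_0_pos by (simp add: A_def)
  have "\<bar>bessel_coeff 0 (Suc n)\<bar> = q ^ n\<^sup>2 * b ^ n / A * (q ^ (2 * n + 1) * b / ((1 - q * q ^ n) * (1 - b * q * q ^ n)))"
    by (simp add: abs_bessel_coeff qfact_Suc A_def power2_eq_square power_add mult_ac power_mult)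
  also have "\<dots> \<le> q ^ n\<^sup>2 * b ^ n / A * (q ^ n * b / ((1 - q) * (1 - b * q)))"
    using q1 q_pos q_less_1 bq_less_1 b_pos A qpow_less_1[of n]
    by (intro mult_left_mono frac_le mult_mono mult_pos_pos mult_right_mono power_decreasing) auto
  also have "\<dots> = q ^ n * (b / ((1 - q) * (1 - b * q))) * \<bar>bessel_coeff 0 n\<bar>"
    by (simp add: abs_bessel_coeff A_def mult_ac)
  finally show ?thesis .
qed

lemma summable_abs_bessel_coeff: "summable (\<lambda>n. \<bar>bessel_coeff k n\<bar> * r ^ n)" if "0 \<le> r"
proof -
  define K where "K = b / ((1 - q) * (1 - b * q)) * r"
  have "(\<lambda>n. q ^ n * K) \<longlonglongrightarrow> 0"
    using q_pos q_less_1 by (auto intro!: tendsto_eq_intros LIMSEQ_power_zero)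
  then have "\<forall>\<^sub>F n in sequentially. q ^ n * K < 1 / 2" by (rule order_tendstoD) simp
  then obtain N where N: "\<And>n. N \<le> n \<Longrightarrow> q ^ n * K < 1 / 2" by (auto simp: eventually_sequentially)
  have "summable (\<lambda>n. \<bar>bessel_coeff 0 n\<bar> * r ^ n)"
  proof (rule summable_ratio_test[of "1 / 2" N])
    fix n assume "N \<le> n"
    have "\<bar>bessel_coeff 0 (Suc n)\<bar> * r ^ Suc n \<le> q ^ n * (b / ((1 - q) * (1 - b * q))) * \<bar>bessel_coeff 0 n\<bar> * r ^ Suc n"
      using that by (intro mult_right_mono abs_bessel_coeff_Suc_le) auto
    also have "\<dots> = q ^ n * K * (\<bar>bessel_coeff 0 n\<bar> * r ^ n)"
      by (simp add: K_def)
    also have "\<dots> \<le> 1 / 2 * (\<bar>bessel_coeff 0 n\<bar> * r ^ n)"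
      using N[OF \<open>N \<le> n\<close>] that by (intro mult_right_mono) auto
    finally show "norm (\<bar>bessel_coeff 0 (Suc n)\<bar> * r ^ Suc n) \<le> 1 / 2 * norm (\<bar>bessel_coeff 0 n\<bar> * r ^ n)"
      using that by simp
  qed simp
  then show ?thesis
  proof (rule summable_comparison_test'[of _ 0])
    fix n
    have "\<bar>bessel_coeff k n\<bar> \<le> 1 * \<bar>bessel_coeff 0 n\<bar>"
      using q_pos q_less_1 by (intro order_trans[OF abs_bessel_coeff_le] mult_right_mono power_le_one) auto
    then show "norm (\<bar>bessel_coeff k n\<bar> * r ^ n) \<le> \<bar>bessel_coeff 0 n\<bar> * r ^ n"
      using that by (simp add: mult_right_mono)
  qed
qed

section \<open>The entire functions \<open>F_k\<close> and positivity of their Wronskians\<close>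

definition bessel_cfps :: "nat \<Rightarrow> complex fps" where
  "bessel_cfps k = Abs_fps (\<lambda>n. of_real (bessel_coeff k n))"

definition bessel :: "nat \<Rightarrow> complex \<Rightarrow> complex" where
  "bessel k t = (\<Sum>n. of_real (bessel_coeff k n) * t ^ n)"

lemma summable_bessel: "summable (\<lambda>n. of_real (bessel_coeff k n) * t ^ n :: complex)"
  by (rule summable_norm_cancel)
    (use summable_abs_bessel_coeff[of "norm t" k] in \<open>simp add: norm_mult norm_power\<close>)

lemma bessel_eq_eval_fps: "bessel k = eval_fps (bessel_cfps k)"
  by (simp add: fun_eq_iff bessel_def eval_fps_def bessel_cfps_def)

lemma fps_conv_radius_bessel: "fps_conv_radius (bessel_cfps k) = \<infinity>"
proof -
  have "conv_radius (\<lambda>n. of_real (bessel_coeff k n) :: complex) = \<infinity>"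
    by (rule conv_radius_inftyI'') (rule summable_bessel)
  then show ?thesis by (simp add: fps_conv_radius_def bessel_cfps_def)
qed

lemma holomorphic_bessel: "bessel k holomorphic_on A"
  unfolding bessel_eq_eval_fps by (rule holomorphic_on_eval_fps) (simp add: fps_conv_radius_bessel)

lemma bessel_has_fps_expansion: "bessel k has_fps_expansion bessel_cfps k"
  unfolding bessel_eq_eval_fps
  by (rule eval_fps_has_fps_expansion) (simp add: fps_conv_radius_bessel)

lemma bessel_0 [simp]: "bessel k 0 = 1"
  by (simp add: bessel_def)

lemma bessel_recurrence:
  "bessel k t = bessel (Suc k) t - of_real (recur k) * t * bessel (Suc (Suc k)) t"
proof -
  define a where "a = (\<lambda>k n. of_real (bessel_coeff k n) * t ^ n)"
  have sm: "summable (a k)" for k unfolding a_def by (rule summable_bessel)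
  have s: "(\<Sum>n. a k n) = 1 + (\<Sum>n. a k (Suc n))" for k
    using suminf_split_head[OF sm[of k]] by (simp add: a_def)
  have "(\<Sum>n. a k (Suc n)) = (\<Sum>n. a (Suc k) (Suc n) - of_real (recur k) * t * a (Suc (Suc k)) n)"
    by (simp add: a_def bessel_coeff_recurrence[of k] algebra_simps)
  also have "\<dots> = (\<Sum>n. a (Suc k) (Suc n)) - of_real (recur k) * t * (\<Sum>n. a (Suc (Suc k)) n)"
    using sm sm[THEN summable_Suc_iff[THEN iffD2]]
    by (subst suminf_diff[symmetric]) (auto intro!: summable_mult suminf_mult)
  finally show ?thesis using s[of k] s[of "Suc k"] unfolding bessel_def a_def by simp
qed

text \<open>Every nonconstant term of \<open>F_k\<close> carries a factor at most
  \<open>q ^ k\<close> relative to the absolute series of \<open>F_0\<close>.\<close>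

lemma bessel_tendsto_1: "(\<lambda>k. bessel k t) \<longlonglongrightarrow> 1"
proof -
  define S where "S = (\<Sum>n. \<bar>bessel_coeff 0 n\<bar> * norm t ^ n)"
  have sm: "summable (\<lambda>n. \<bar>bessel_coeff k n\<bar> * norm t ^ n)" for k
    by (rule summable_abs_bessel_coeff) simp
  have "norm (bessel k t - 1) \<le> q ^ k * S" for k
  proof -
    define a where "a = (\<lambda>n. \<bar>bessel_coeff 0 (Suc n)\<bar> * norm t ^ Suc n)"
    have sa: "summable a"
      unfolding a_def by (rule summable_Suc_iff[THEN iffD2, OF sm[of 0]])
    have "(\<Sum>n. of_real (bessel_coeff k (Suc n)) * t ^ Suc n) = bessel k t - of_real (bessel_coeff k 0) * t ^ 0"
      unfolding bessel_def by (rule suminf_split_head[OF summable_bessel])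
    then have "bessel k t - 1 = (\<Sum>n. of_real (bessel_coeff k (Suc n)) * t ^ Suc n)"
      by simp
    also have "norm \<dots> \<le> (\<Sum>n. q ^ k * a n)"
    proof (rule norm_suminf_le)
      fix n
      have "\<bar>bessel_coeff k (Suc n)\<bar> \<le> q ^ (k * Suc n) * \<bar>bessel_coeff 0 (Suc n)\<bar>"
        by (rule abs_bessel_coeff_le)
      also have "\<dots> \<le> q ^ k * \<bar>bessel_coeff 0 (Suc n)\<bar>"
        using q_pos q_less_1 by (intro mult_right_mono power_decreasing) auto
      finally have "\<bar>bessel_coeff k (Suc n)\<bar> * norm t ^ Suc n \<le> q ^ k * \<bar>bessel_coeff 0 (Suc n)\<bar> * norm t ^ Suc n"
        by (rule mult_right_mono) simp
      then show "norm (complex_of_real (bessel_coeff k (Suc n)) * t ^ Suc n) \<le> q ^ k * a n"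
        unfolding a_def norm_mult norm_power norm_of_real mult.assoc .
    qed (rule summable_mult[OF sa])
    also have "\<dots> = q ^ k * (\<Sum>n. a n)"
      using sa by (rule suminf_mult)
    also have "\<dots> \<le> q ^ k * S"
    proof (rule mult_left_mono)
      have "suminf a = S - \<bar>bessel_coeff 0 0\<bar> * norm t ^ 0"
        unfolding a_def S_def by (rule suminf_split_head[OF sm])
      then show "suminf a \<le> S" by simp
    qed (use q_pos in simp)
    finally show ?thesis .
  qed
  moreover have "(\<lambda>k. q ^ k * S) \<longlonglongrightarrow> 0"
    by (rule tendsto_mult_left_zero, rule LIMSEQ_power_zero) (use q_pos q_less_1 in simp)
  ultimately have "(\<lambda>k. bessel k t - 1) \<longlonglongrightarrow> 0"
    by (rule Lim_null_comparison[OF always_eventually, OF allI])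
  then show ?thesis by (rule LIM_zero_cancel)
qed

text \<open>The additional factor \<open>Im t\<close> makes the quantity positive in both
  half-planes at once.\<close>

definition wronskian :: "nat \<Rightarrow> complex \<Rightarrow> real" where
  "wronskian k t = Im t * Im (t * bessel (Suc k) t * cnj (bessel k t))"

text \<open>Substitute the recurrence for \<open>F_k\<close>, then the one for
  \<open>F_(k+1)\<close>. Each time the squared modulus of a single function splits off and the
  mixed term reappears with shifted indices.\<close>

lemma wronskian_recurrence:
  "wronskian k t = (Im t)\<^sup>2 * (norm (bessel (Suc k) t))\<^sup>2 +
     recur k * recur (Suc k) * (norm t)\<^sup>2 * wronskian (Suc (Suc k)) t"
proof -
  define u where "u = bessel (Suc k) t"
  define v where "v = bessel (Suc (Suc k)) t"
  define w where "w = bessel (Suc (Suc (Suc k))) t"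
  have k: "bessel k t = u - of_real (recur k) * t * v" unfolding u_def v_def by (rule bessel_recurrence)
  have u: "u = v - of_real (recur (Suc k)) * t * w" unfolding u_def v_def w_def by (rule bessel_recurrence)
  have "Im (t * u * cnj (bessel k t)) = Im t * (norm u)\<^sup>2 + recur k * (norm t)\<^sup>2 * Im (v * cnj u)"
    by (simp only: k cmod_power2) (simp add: algebra_simps power2_eq_square)
  also have "Im (v * cnj u) = recur (Suc k) * Im (t * w * cnj v)"
    by (simp only: u) (simp add: algebra_simps)
  finally have "Im (t * u * cnj (bessel k t)) =
    Im t * (norm u)\<^sup>2 + recur k * (norm t)\<^sup>2 * (recur (Suc k) * Im (t * w * cnj v))" .
  then show ?thesis
    unfolding wronskian_def u_def[symmetric] v_def[symmetric] w_def[symmetric]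
    by (simp only:) (simp only: algebra_simps power2_eq_square)
qed

text \<open>The Wronskians tend to \<open>(Im t)\<^sup>2\<close> as \<open>k \<rightarrow> \<infinity>\<close>, so they are eventually positive; the recurrence
  carries this positivity down to every index.\<close>

lemma wronskian_pos:
  assumes "Im t \<noteq> 0"
  shows "0 < wronskian k t"
proof -
  have "(\<lambda>k. wronskian k t) \<longlonglongrightarrow> Im t * Im (t * 1 * cnj 1)"
    unfolding wronskian_def
    by (intro tendsto_intros bessel_tendsto_1 LIMSEQ_Suc)
  then have "\<forall>\<^sub>F k in sequentially. 0 < wronskian k t"
    by (rule order_tendstoD) (use assms in \<open>auto simp: power2_eq_square[symmetric]\<close>)
  then obtain N where N: "\<And>n. N \<le> n \<Longrightarrow> 0 < wronskian n t" by (auto simp: eventually_sequentially)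
  have "0 < wronskian m t" if "N \<le> m + 2 * j" for m j
    using that
  proof (induction j arbitrary: m)
    case 0
    then show ?case using N by simp
  next
    case (Suc j)
    have "0 < wronskian (Suc (Suc m)) t" using Suc by simp
    then have "0 < recur m * recur (Suc m) * (norm t)\<^sup>2 * wronskian (Suc (Suc m)) t"
      using recur_pos assms by (intro mult_pos_pos) auto
    then show ?case by (subst wronskian_recurrence) (simp add: add_nonneg_pos)
  qed
  from this[of k N] show ?thesis by simp
qed

lemma wronskian_ge: "(Im t)\<^sup>2 * (norm (bessel (Suc k) t))\<^sup>2 \<le> wronskian k t"
proof (cases "Im t = 0")
  case False
  have "0 \<le> recur k * recur (Suc k) * (norm t)\<^sup>2 * wronskian (Suc (Suc k)) t"
    using recur_pos[of k] recur_pos[of "Suc k"] wronskian_pos[OF False, of "Suc (Suc k)"] by simp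
  then show ?thesis using wronskian_recurrence[of k t] by linarith
qed (simp add: wronskian_def)

text \<open>Bound the imaginary part in \<open>wronskian_ge\<close> by the modulus and cancel
  \<open>\<bar>Im t\<bar> * norm (bessel (Suc k) t)\<close>.\<close>

lemma bessel_ratio_bound: "\<bar>Im t\<bar> * norm (bessel (Suc k) t) \<le> norm t * norm (bessel k t)"
proof (cases "Im t = 0 \<or> bessel (Suc k) t = 0")
  case False
  have "(Im t)\<^sup>2 * (norm (bessel (Suc k) t))\<^sup>2 \<le> \<bar>Im t\<bar> * \<bar>Im (t * bessel (Suc k) t * cnj (bessel k t))\<bar>"
    using wronskian_ge[of t k] unfolding wronskian_def abs_mult[symmetric] by linarith
  also have "\<dots> \<le> \<bar>Im t\<bar> * norm (t * bessel (Suc k) t * cnj (bessel k t))"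
    by (intro mult_left_mono abs_Im_le_cmod) auto
  finally have "(\<bar>Im t\<bar> * norm (bessel (Suc k) t)) * (\<bar>Im t\<bar> * norm (bessel (Suc k) t)) \<le>
     (\<bar>Im t\<bar> * norm (bessel (Suc k) t)) * (norm t * norm (bessel k t))"
    by (simp add: norm_mult power2_eq_square mult_ac)
  then show ?thesis using False by (subst (asm) mult_le_cancel_left_pos) auto
qed auto

lemma bessel_nonzero_nonreal: "Im t \<noteq> 0 \<Longrightarrow> bessel k t \<noteq> 0"
  using wronskian_pos[of t k] by (auto simp: wronskian_def)

lemma bessel_of_real: "bessel k (of_real x) = of_real (\<Sum>n. bessel_coeff k n * x ^ n)"
proof -
  have "summable (\<lambda>n. bessel_coeff k n * x ^ n)"
    by (rule summable_rabs_cancel)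
      (use summable_abs_bessel_coeff[of "\<bar>x\<bar>" k] in \<open>simp add: abs_mult power_abs\<close>)
  from suminf_of_real[OF this, where 'a = complex] show ?thesis by (simp add: bessel_def)
qed

lemma bessel_coeff_alternating: "bessel_coeff k n * (- x) ^ n = \<bar>bessel_coeff k n\<bar> * x ^ n"
proof -
  define X where "X = q ^ n\<^sup>2 * (b * q ^ k) ^ n / (qfact q q n * qfact (b * q ^ Suc k) q n)"
  have "bessel_coeff k n = (-1) ^ n * X" by (simp add: bessel_coeff_def X_def)
  then have "bessel_coeff k n * (- x) ^ n = ((-1) ^ n * (-1) ^ n) * X * x ^ n"
    by (simp only: power_minus[of x] mult_ac)
  also have "\<dots> = X * x ^ n" by simp
  finally show ?thesis unfolding abs_bessel_coeff X_def .
qed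

lemma bessel_neg: "bessel k (- of_real x) = of_real (\<Sum>n. \<bar>bessel_coeff k n\<bar> * x ^ n)"
  using bessel_of_real[of k "- x"] by (simp add: bessel_coeff_alternating)

lemma bessel_neg_ge: "\<bar>bessel_coeff k n\<bar> * x ^ n \<le> (\<Sum>n. \<bar>bessel_coeff k n\<bar> * x ^ n)" if "0 \<le> x"
  using that summable_abs_bessel_coeff[OF that, of k]
  by (intro order_trans[OF _ sum_le_suminf[of _ "{n}"]]) auto

lemma bessel_neg_ge_1: "1 \<le> (\<Sum>n. \<bar>bessel_coeff k n\<bar> * x ^ n)" if "0 \<le> x"
  using bessel_neg_ge[OF that, of k 0] by simp

text \<open>Nonreal zeros are excluded by the Wronskian. At real \<open>t \<le> 0\<close> all terms
  of the series are nonnegative and the constant term is 1.\<close>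

lemma bessel_zero_real_pos:
  assumes "bessel k t = 0"
  obtains x where "0 < x" "t = of_real x"
proof -
  have im: "Im t = 0" using assms bessel_nonzero_nonreal by auto
  then have t: "t = of_real (Re t)" by (simp add: complex_eq_iff)
  have "0 < Re t"
  proof (rule ccontr)
    assume "\<not> 0 < Re t"
    then have "bessel k t = of_real (\<Sum>n. \<bar>bessel_coeff k n\<bar> * (- Re t) ^ n)"
      using bessel_neg[of k "- Re t"] t by simp
    then show False using bessel_neg_ge_1[of "- Re t" k] \<open>\<not> 0 < Re t\<close> assms by simp
  qed
  with t that show thesis by blast
qed

text \<open>By the recurrence, a common zero of two consecutive functions would be a zero of all
  later ones, against \<open>bessel_tendsto_1\<close>.\<close>

lemma bessel_no_common_zero:
  assumes "bessel k t = 0"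
  shows "bessel (Suc k) t \<noteq> 0"
proof
  assume s: "bessel (Suc k) t = 0"
  have t: "t \<noteq> 0" using assms by auto
  have "bessel (k + j) t = 0 \<and> bessel (Suc (k + j)) t = 0" for j
  proof (induction j)
    case (Suc j)
    then have z: "bessel (k + j) t = 0" "bessel (Suc (k + j)) t = 0" by auto
    then have "of_real (recur (k + j)) * t * bessel (Suc (Suc (k + j))) t = 0"
      using bessel_recurrence[of "k + j" t] by simp
    then show ?case using z t recur_pos[of "k + j"] by simp
  qed (use assms s in auto)
  then have "\<forall>\<^sub>F m in sequentially. bessel m t = 0"
    by (auto simp: eventually_sequentially nat_le_iff_add)
  with bessel_tendsto_1[of t] have "(\<lambda>m. 0 :: complex) \<longlonglongrightarrow> 1"
    by (rule Lim_transform_eventually)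
  then show False by (simp add: LIMSEQ_const_iff)
qed

end

text \<open>The residue theorem combined with the length estimate, divided by \<open>2 * pi\<close>.
  Poles in \<open>P\<close> outside the circle are allowed, since their winding number is 0.\<close>

lemma residue_sum_circle_bound:
  assumes R: "0 < R" "R < R'" and P: "finite P" and hol: "F holomorphic_on ball 0 R' - P"
    and bound: "\<And>z. norm z = R \<Longrightarrow> z \<notin> P \<and> norm (F z) \<le> B"
  shows "norm (\<Sum>p\<in>{p\<in>P. norm p < R}. residue F p) \<le> R * B"
proof -
  have "norm (F (of_real R)) \<le> B" using bound[of "of_real R"] R(1) by simp
  then have "0 \<le> B" by (rule order_trans[OF norm_ge_zero])
  have sub: "path_image (circlepath 0 R) \<subseteq> ball 0 R' - P"
    using R bound by (auto simp: path_image_circlepath)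
  have out: "winding_number (circlepath 0 R) z = 0" if "R < norm z" for z
    by (rule winding_number_zero_outside[of _ "cball 0 R"]) (use that R in \<open>auto simp: path_image_circlepath\<close>)
  have I: "contour_integral (circlepath 0 R) F =
      2 * pi * \<i> * (\<Sum>p\<in>P. winding_number (circlepath 0 R) p * residue F p)"
    using R sub out by (intro Residue_theorem[of "ball 0 R'"] P hol) auto
  have "(\<Sum>p\<in>P. winding_number (circlepath 0 R) p * residue F p) = (\<Sum>p\<in>{p\<in>P. norm p < R}. residue F p)"
  proof (rule sum.mono_neutral_cong_right)
    show "\<forall>i\<in>P - {p \<in> P. norm p < R}. winding_number (circlepath 0 R) i * residue F i = 0"
    proof
      fix i assume i: "i \<in> P - {p \<in> P. norm p < R}"
      then have "norm i \<noteq> R" using bound by blast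
      then have "R < norm i" using i by auto
      then show "winding_number (circlepath 0 R) i * residue F i = 0" by (simp add: out)
    qed
    show "winding_number (circlepath 0 R) p * residue F p = residue F p" if "p \<in> {p \<in> P. norm p < R}" for p
      using that by (simp add: winding_number_circlepath)
  qed (use P in auto)
  with I have I: "contour_integral (circlepath 0 R) F = 2 * pi * \<i> * (\<Sum>p\<in>{p\<in>P. norm p < R}. residue F p)"
    by simp
  have "F contour_integrable_on circlepath 0 R"
  proof (rule contour_integrable_holomorphic_simple[OF hol])
    show "open (ball 0 R' - P)" using P by (intro open_Diff finite_imp_closed) auto
  qed (use sub in auto)
  then have "norm (contour_integral (circlepath 0 R) F) \<le> B * (2 * pi * R)"
    by (intro has_contour_integral_bound_circlepath[OF has_contour_integral_integral])
      (use bound R \<open>0 \<le> B\<close> in auto)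
  then have "(2 * pi) * norm (\<Sum>p\<in>{p\<in>P. norm p < R}. residue F p) \<le> (2 * pi) * (R * B)"
    unfolding I by (simp add: norm_mult mult_ac)
  then show ?thesis by (subst (asm) mult_le_cancel_left_pos) auto
qed

section \<open>Simple zeros, residues of \<open>G\<close> and the residue balance on a
  circle\<close>

context q_bessel
begin

lemma bessel_field_derivative: "(bessel k has_field_derivative deriv (bessel k) t) (at t)"
  by (rule holomorphic_derivI[of _ UNIV]) (auto intro: holomorphic_bessel)

lemma bessel_real_derivative:
  "((\<lambda>x. Re (bessel k (of_real x))) has_real_derivative Re (deriv (bessel k) (of_real x))) (at x)"
  and deriv_bessel_real: "Im (deriv (bessel k) (of_real x)) = 0"
proof -
  have v: "((\<lambda>x. bessel k (of_real x)) has_vector_derivative deriv (bessel k) (of_real x)) (at x)"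
    by (rule has_vector_derivative_real_field) (rule bessel_field_derivative)
  show "((\<lambda>x. Re (bessel k (of_real x))) has_real_derivative Re (deriv (bessel k) (of_real x))) (at x)"
    by (rule has_field_derivative_Re[OF v])
  have "((\<lambda>x. Im (bessel k (of_real x))) has_real_derivative Im (deriv (bessel k) (of_real x))) (at x)"
    by (rule has_field_derivative_Im[OF v])
  then have "((\<lambda>x. 0) has_real_derivative Im (deriv (bessel k) (of_real x))) (at x)"
    by (simp add: bessel_of_real)
  then show "Im (deriv (bessel k) (of_real x)) = 0"
    using DERIV_unique DERIV_const by blast
qed

text \<open>Dividing the Wronskian bound at \<open>x + i\<epsilon>\<close> by \<open>\<epsilon>\<^sup>2\<close> and letting \<open>\<epsilon> \<rightarrow> 0\<close> gives the sign of the residues.\<close>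

lemma bessel_zero_derivative:
  assumes "bessel k (of_real x) = 0"
  shows "x * Re (bessel (Suc k) (of_real x) * cnj (deriv (bessel k) (of_real x))) < 0"
proof -
  define d where "d = deriv (bessel k) (of_real x)"
  define h where "h = (\<lambda>t. (bessel k t - bessel k (of_real x)) / (t - of_real x))"
  define e where "e = (\<lambda>n. inverse (real (Suc n)))"
  have e: "0 < e n" for n by (simp add: e_def)
  have "e \<longlonglongrightarrow> 0" unfolding e_def by (rule LIMSEQ_inverse_real_of_nat)
  define u where "u = (\<lambda>n. complex_of_real x + \<i> * of_real (e n))"
  have h: "(h \<longlongrightarrow> d) (at (of_real x))"
    using bessel_field_derivative[of k "of_real x"] by (simp add: has_field_derivative_iff h_def d_def)
  have u: "u \<longlonglongrightarrow> of_real x"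
    unfolding u_def by (rule tendsto_eq_intros \<open>e \<longlonglongrightarrow> 0\<close> refl | simp)+
  have ux: "u n \<noteq> of_real x" for n using e[of n] by (simp add: u_def)
  have hu: "(\<lambda>n. h (u n)) \<longlonglongrightarrow> d"
    by (rule filterlim_compose[OF h]) (use u ux in \<open>auto simp: filterlim_at\<close>)
  have f1: "(\<lambda>n. bessel (Suc k) (u n)) \<longlonglongrightarrow> bessel (Suc k) (of_real x)"
    by (rule isCont_tendsto_compose[OF _ u])
      (rule DERIV_isCont[OF bessel_field_derivative])
  have le: "(norm (bessel (Suc k) (u n)))\<^sup>2 \<le> - Re (u n * bessel (Suc k) (u n) * cnj (h (u n)))" for n
  proof -
    have im: "Im (u n) = e n" by (simp add: u_def)
    have "u n - of_real x = \<i> * of_real (e n)" by (simp add: u_def)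
    then have bu: "bessel k (u n) = \<i> * of_real (e n) * h (u n)"
      using e[of n] assms by (simp add: h_def)
    have "Im (z * cnj (\<i> * of_real r * w)) = - r * Re (z * cnj w)" for z w r
      by (simp add: algebra_simps)
    from this[of "u n * bessel (Suc k) (u n)" "e n" "h (u n)"]
    have "Im (u n * bessel (Suc k) (u n) * cnj (bessel k (u n))) =
       - e n * Re (u n * bessel (Suc k) (u n) * cnj (h (u n)))"
      unfolding bu .
    then have "(e n)\<^sup>2 * (norm (bessel (Suc k) (u n)))\<^sup>2 \<le>
        e n * (- e n * Re (u n * bessel (Suc k) (u n) * cnj (h (u n))))"
      using wronskian_ge[of "u n" k] unfolding wronskian_def im by simp
    also have "\<dots> = (e n)\<^sup>2 * (- Re (u n * bessel (Suc k) (u n) * cnj (h (u n))))"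
      by (simp only: power2_eq_square mult_minus_left mult_minus_right mult.assoc)
    finally show ?thesis using e[of n] by (subst (asm) mult_le_cancel_left_pos) simp_all
  qed
  have "(norm (bessel (Suc k) (of_real x)))\<^sup>2 \<le> - Re (of_real x * bessel (Suc k) (of_real x) * cnj d)"
    by (rule LIMSEQ_le[OF tendsto_power[OF tendsto_norm[OF f1]] tendsto_minus[OF tendsto_Re[OF tendsto_mult[OF tendsto_mult[OF u f1] tendsto_cnj[OF hu]]]]])
      (use le in blast)
  moreover have "0 < (norm (bessel (Suc k) (of_real x)))\<^sup>2"
    using bessel_no_common_zero[OF assms] by simp
  moreover have "Re (of_real x * bessel (Suc k) (of_real x) * cnj d) = x * Re (bessel (Suc k) (of_real x) * cnj d)"
    by (simp add: algebra_simps)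
  ultimately show ?thesis unfolding d_def[symmetric] by linarith
qed

definition zeros :: "real set" where
  "zeros = {x. bessel 0 (of_real x) = 0}"

lemma zeros_pos: "x \<in> zeros \<Longrightarrow> 0 < x"
  using bessel_zero_real_pos[of 0 "of_real x"] by (auto simp: zeros_def)

lemma bessel_eq_0_iff: "bessel 0 t = 0 \<longleftrightarrow> t \<in> of_real ` zeros"
  using bessel_zero_real_pos[of 0 t] by (auto simp: zeros_def)

text \<open>Minus the residue of \<open>G\<close> at a zero \<open>x\<close> of \<open>F_0\<close>;
  the sign is chosen to make it positive.\<close>

definition zero_weight :: "real \<Rightarrow> real" where
  "zero_weight x = - Re (bessel 1 (of_real x)) / ((1 - b * q) * Re (deriv (bessel 0) (of_real x)))"

lemma deriv_zero_real: "deriv (bessel k) (of_real x) = of_real (Re (deriv (bessel k) (of_real x)))"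
  by (simp add: complex_eq_iff deriv_bessel_real)

lemma bessel_real: "bessel k (of_real x) = of_real (Re (bessel k (of_real x)))"
  by (simp add: bessel_of_real)

lemma zero_weight_sign:
  assumes "x \<in> zeros"
  shows "Re (bessel 1 (of_real x)) * Re (deriv (bessel 0) (of_real x)) < 0"
proof -
  have "x * Re (bessel (Suc 0) (of_real x) * cnj (deriv (bessel 0) (of_real x))) < 0"
    using assms by (intro bessel_zero_derivative) (auto simp: zeros_def)
  then have "Re (bessel (Suc 0) (of_real x) * cnj (deriv (bessel 0) (of_real x))) < 0"
    using zeros_pos[OF assms] by (simp add: mult_less_0_iff del: times_complex.sel)
  then show ?thesis by (simp add: deriv_bessel_real)
qed

lemma deriv_zeros_nonzero: "x \<in> zeros \<Longrightarrow> deriv (bessel 0) (of_real x) \<noteq> 0"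
  using zero_weight_sign[of x] by auto

lemma zero_weight_pos:
  assumes "x \<in> zeros"
  shows "0 < zero_weight x"
proof -
  define u where "u = Re (bessel 1 (of_real x))"
  define d where "d = Re (deriv (bessel 0) (of_real x))"
  have "u * d < 0" using zero_weight_sign[OF assms] by (simp only: u_def d_def)
  then have "0 < - u / d" by (auto simp: zero_less_divide_iff mult_less_0_iff divide_less_0_iff)
  then have "0 < (- u / d) / (1 - b * q)" by (rule divide_pos_pos) (use bq_less_1 in simp)
  then show ?thesis by (simp add: zero_weight_def u_def d_def mult.commute)
qed

lemma finite_zeros_atMost: "finite (zeros \<inter> {..r})"
proof -
  have "\<not> bessel 0 constant_on UNIV"
  proof
    assume "bessel 0 constant_on UNIV"
    then obtain c where c: "\<And>t. bessel 0 t = c" by (auto simp: constant_on_def)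
    \<comment> \<open>\<open>S\<close> is the value of \<open>F_0\<close> at \<open>-1\<close>,
      where no terms cancel. The coefficient of degree 1 alone already makes it exceed
      \<open>F_0(0) = 1\<close>.\<close>
    define S where "S = (\<Sum>n. \<bar>bessel_coeff 0 n\<bar> * 1 ^ n)"
    have "of_real S = bessel 0 (- of_real 1)" unfolding S_def bessel_neg ..
    also have "\<dots> = bessel 0 0" unfolding c ..
    finally have "complex_of_real S = 1" by simp
    then have s1: "S = 1" by (simp only: of_real_eq_1_iff)
    have "(\<Sum>n\<in>{0, 1}. \<bar>bessel_coeff 0 n\<bar> * 1 ^ n) \<le> S"
      unfolding S_def by (rule sum_le_suminf) (use summable_abs_bessel_coeff[of 1 0] in auto)
    moreover have "0 < \<bar>bessel_coeff 0 1\<bar>"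
      unfolding abs_bessel_coeff using q_pos b_pos qfact_q_pos[of 1] qfact_bq_0_pos[of 1] by simp
    ultimately show False using s1 by simp
  qed
  then have "finite {z \<in> cball 0 \<bar>r\<bar>. bessel 0 z = 0}"
    by (intro holomorphic_compact_finite_zeros[of _ UNIV]) (auto intro: holomorphic_bessel)
  moreover have "of_real ` (zeros \<inter> {..r}) \<subseteq> {z \<in> cball 0 \<bar>r\<bar>. bessel 0 z = 0}"
  proof clarify
    fix x assume "x \<in> zeros" "x \<le> r"
    then show "complex_of_real x \<in> cball 0 \<bar>r\<bar> \<and> bessel 0 (of_real x) = 0"
      using zeros_pos[of x] by (simp add: zeros_def dist_norm)
  qed
  ultimately have "finite (complex_of_real ` (zeros \<inter> {..r}))" by (rule finite_subset[rotated])
  then show ?thesis by (rule finite_imageD) (auto simp: inj_on_def)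
qed

text \<open>This is \<open>G(t) (1 - t^2 / R^2) K(t)\<close>. The kernel \<open>K\<close> will be
  \<open>1 / t^(m+1)\<close> to extract a moment, and \<open>1 / (t (t + T))\<close> to compare
  \<open>G(0)\<close> with \<open>G(-T)\<close>.\<close>

definition kernel_quotient :: "real \<Rightarrow> (complex \<Rightarrow> complex) \<Rightarrow> complex \<Rightarrow> complex" where
  "kernel_quotient R K t = bessel 1 t * (1 - t\<^sup>2 / of_real (R\<^sup>2)) / (of_real (1 - b * q) * bessel 0 t) * K t"

text \<open>The factor \<open>1 - t\<^sup>2 / R\<^sup>2\<close> has modulus \<open>2 \<bar>Im t\<bar> / \<bar>t\<bar>\<close> on the circle of radius \<open>R\<close>, which is exactly
  what the Wronskian bound can absorb.\<close>

lemma kernel_quotient_bound: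
  assumes "0 < R" "R \<notin> zeros" "norm t = R" "norm (K t) \<le> \<kappa>"
  shows "bessel 0 t \<noteq> 0" "norm (kernel_quotient R K t) \<le> 2 / (1 - b * q) * \<kappa>"
proof -
  show nz: "bessel 0 t \<noteq> 0"
  proof
    assume "bessel 0 t = 0"
    then obtain x where "x \<in> zeros" "t = of_real x" by (auto simp: bessel_eq_0_iff)
    with zeros_pos[of x] assms show False by simp
  qed
  have t: "t \<noteq> 0" using assms by auto
  have "of_real (R\<^sup>2) = t * cnj t" using assms(3) by (metis complex_norm_square of_real_power)
  then have "1 - t\<^sup>2 / of_real (R\<^sup>2) = (cnj t - t) / cnj t"
    using t by (simp add: power2_eq_square divide_simps)
  also have "norm \<dots> = 2 * \<bar>Im t\<bar> / norm t"
    by (simp add: norm_divide complex_norm_square[symmetric] norm_minus_commute[of "cnj t"] complex_diff_cnj norm_mult)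
  finally have n: "norm (1 - t\<^sup>2 / of_real (R\<^sup>2)) = 2 * \<bar>Im t\<bar> / norm t" .
  have "norm (bessel 1 t) * (2 * \<bar>Im t\<bar> / norm t) \<le> 2 * norm (bessel 0 t)"
    using bessel_ratio_bound[of t 0] t by (simp add: field_simps)
  then have "norm (bessel 1 t) * norm (1 - t\<^sup>2 / of_real (R\<^sup>2)) / ((1 - b * q) * norm (bessel 0 t)) \<le>
      2 * norm (bessel 0 t) / ((1 - b * q) * norm (bessel 0 t))"
    unfolding n using bq_less_1 by (intro divide_right_mono) auto
  also have "\<dots> = 2 / (1 - b * q)" using nz by simp
  finally have "norm (bessel 1 t) * norm (1 - t\<^sup>2 / of_real (R\<^sup>2)) / ((1 - b * q) * norm (bessel 0 t)) * norm (K t)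
      \<le> 2 / (1 - b * q) * \<kappa>"
    using assms(4) bq_less_1 by (intro mult_mono) auto
  moreover have "norm (of_real (1 - b * q) :: complex) = 1 - b * q"
    using bq_less_1 unfolding norm_of_real by simp
  ultimately show "norm (kernel_quotient R K t) \<le> 2 / (1 - b * q) * \<kappa>"
    unfolding kernel_quotient_def norm_mult norm_divide by simp
qed

text \<open>The zero of \<open>F_0\<close> is simple, so the residue is numerator over derivative.
  The right half-plane contains all zeros, and \<open>x < R\<close> together with
  \<open>K(x) \<noteq> 0\<close> keeps the numerator from vanishing there.\<close>

lemma kernel_quotient_residue:
  assumes x: "x \<in> zeros" "x < R" and K: "K holomorphic_on {t. 0 < Re t}" "K (of_real x) \<noteq> 0"
  shows "residue (kernel_quotient R K) (of_real x) = - of_real (zero_weight x * (1 - x\<^sup>2 / R\<^sup>2)) * K (of_real x)"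
proof -
  have x0: "0 < x" using zeros_pos[OF x(1)] .
  have bq: "complex_of_real (1 - b * q) \<noteq> 0" using bq_less_1 unfolding of_real_eq_0_iff by simp
  have R: "x\<^sup>2 < R\<^sup>2" using x0 x(2) by (intro power_strict_mono) auto
  define N where "N = (\<lambda>t. bessel 1 t * (1 - t\<^sup>2 / of_real (R\<^sup>2)) / of_real (1 - b * q) * K t)"
  have "1 - x\<^sup>2 / R\<^sup>2 \<noteq> 0" using R x0 by (auto simp: divide_simps)
  then have "complex_of_real (1 - x\<^sup>2 / R\<^sup>2) \<noteq> 0" unfolding of_real_eq_0_iff .
  moreover have "bessel 1 (of_real x) \<noteq> 0" using bessel_no_common_zero[of 0 "of_real x"] x(1) by (simp add: zeros_def)
  ultimately have Nx: "N (of_real x) \<noteq> 0" using K(2) bq by (simp add: N_def)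
  have "residue (\<lambda>t. N t / bessel 0 t) (of_real x) = N (of_real x) / deriv (bessel 0) (of_real x)"
  proof (rule residue_simple_pole_deriv[where s = "{t. 0 < Re t}"])
    show "N holomorphic_on {t. 0 < Re t}"
      unfolding N_def using bq by (intro holomorphic_intros holomorphic_bessel K(1)) (use R x0 in auto)
    show "connected {t. 0 < Re t}" by (intro convex_connected convex_halfspace_Re_gt)
    show "N (of_real x) \<noteq> 0" by (rule Nx)
    show "bessel 0 holomorphic_on {t. 0 < Re t}" by (rule holomorphic_bessel)
  qed (use x0 x(1) Nx bessel_field_derivative deriv_zeros_nonzero in \<open>auto simp: open_halfspace_Re_gt zeros_def\<close>)
  also have "(\<lambda>t. N t / bessel 0 t) = kernel_quotient R K"
    by (auto simp: N_def kernel_quotient_def fun_eq_iff)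
  also have "N (of_real x) / deriv (bessel 0) (of_real x) =
     - of_real (zero_weight x * (1 - x\<^sup>2 / R\<^sup>2)) * K (of_real x)"
    unfolding N_def zero_weight_def by (subst bessel_real, subst deriv_zero_real) simp
  finally show ?thesis .
qed

text \<open>\<open>P\<close> contains the poles of \<open>K\<close>, kept in
  \<open>Re p \<le> 0\<close> and hence apart from the positive zeros. The residues at the zeros
  carry a minus sign, so the circle estimate compares the two sums.\<close>

lemma kernel_residue_sum:
  assumes R: "0 < R" "R \<notin> zeros" and P: "finite P" "\<And>p. p \<in> P \<Longrightarrow> norm p < R \<and> Re p \<le> 0"
    and K: "K holomorphic_on - P" "\<And>t. 0 < Re t \<Longrightarrow> K t \<noteq> 0" "\<And>t. norm t = R \<Longrightarrow> norm (K t) \<le> \<kappa>"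
  shows "norm ((\<Sum>p\<in>P. residue (kernel_quotient R K) p) -
     (\<Sum>x\<in>zeros \<inter> {..<R}. of_real (zero_weight x * (1 - x\<^sup>2 / R\<^sup>2)) * K (of_real x))) \<le> R * (2 / (1 - b * q) * \<kappa>)"
proof -
  \<comment> \<open>The residue theorem is applied on the disc of radius \<open>R + 1\<close>, so
    the zeros up to there are listed; only those below \<open>R\<close> contribute.\<close>
  define Q where "Q = P \<union> of_real ` (zeros \<inter> {..R + 1})"
  define F where "F = kernel_quotient R K"
  have fin: "finite Q" using P(1) finite_zeros_atMost by (simp add: Q_def)
  have bq: "complex_of_real (1 - b * q) \<noteq> 0" using bq_less_1 unfolding of_real_eq_0_iff by simp
  have "F holomorphic_on ball 0 (R + 1) - Q"
  proof -
    have "bessel 0 t \<noteq> 0" if "t \<in> ball 0 (R + 1) - Q" for t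
      using that zeros_pos by (fastforce simp: bessel_eq_0_iff Q_def)
    moreover have "K holomorphic_on ball 0 (R + 1) - Q"
      by (rule holomorphic_on_subset[OF K(1)]) (auto simp: Q_def)
    ultimately show ?thesis
      unfolding F_def kernel_quotient_def using bq R by (intro holomorphic_intros holomorphic_bessel) auto
  qed
  moreover have "z \<notin> Q \<and> norm (F z) \<le> 2 / (1 - b * q) * \<kappa>" if "norm z = R" for z
    using kernel_quotient_bound[of R z K \<kappa>] R that K(3)[OF that] P(2)[of z]
    by (auto simp: F_def Q_def bessel_eq_0_iff)
  ultimately have "norm (\<Sum>p\<in>{p\<in>Q. norm p < R}. residue F p) \<le> R * (2 / (1 - b * q) * \<kappa>)"
    using fin R by (intro residue_sum_circle_bound[of R "R + 1"]) auto
  also have "{p\<in>Q. norm p < R} = P \<union> of_real ` (zeros \<inter> {..<R})"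
    using P(2) zeros_pos by (force simp: Q_def)
  also have "(\<Sum>p\<in>P \<union> of_real ` (zeros \<inter> {..<R}). residue F p) =
      (\<Sum>p\<in>P. residue F p) + (\<Sum>p\<in>of_real ` (zeros \<inter> {..<R}). residue F p)"
  proof (rule sum.union_disjoint)
    show "finite (complex_of_real ` (zeros \<inter> {..<R}))"
      by (rule finite_imageI, rule finite_subset[OF _ finite_zeros_atMost[of R]]) auto
    show "P \<inter> of_real ` (zeros \<inter> {..<R}) = {}" using P(2) zeros_pos by force
  qed (rule P)
  also have "(\<Sum>p\<in>of_real ` (zeros \<inter> {..<R}). residue F p) = (\<Sum>x\<in>zeros \<inter> {..<R}. residue F (of_real x))"
    by (subst sum.reindex) (auto simp: inj_on_def)
  also have "\<dots> = (\<Sum>x\<in>zeros \<inter> {..<R}. - (of_real (zero_weight x * (1 - x\<^sup>2 / R\<^sup>2)) * K (of_real x)))"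
  proof (intro sum.cong refl)
    fix x assume "x \<in> zeros \<inter> {..<R}"
    moreover have "K holomorphic_on {t. 0 < Re t}"
      by (rule holomorphic_on_subset[OF K(1)]) (use P(2) in force)
    ultimately show "residue F (of_real x) = - (of_real (zero_weight x * (1 - x\<^sup>2 / R\<^sup>2)) * K (of_real x))"
      unfolding F_def using K(2)[of "of_real x"] zeros_pos by (subst kernel_quotient_residue) auto
  qed
  finally show ?thesis by (simp add: F_def sum_negf)
qed

end

section \<open>Moments as sums over the zeros\<close>

text \<open>A monotone-convergence argument. For a fixed finite set the weights tend to 1, so its
  sum is at most \<open>L\<close>; conversely the weights are at most 1, so every weighted sum is at
  most the full sum.\<close>

lemma has_sum_weighted_limit:
  fixes a :: "'a \<Rightarrow> real" and w :: "nat \<Rightarrow> 'a \<Rightarrow> real"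
  assumes nonneg: "\<And>x. x \<in> Z \<Longrightarrow> 0 \<le> a x"
    and F: "\<And>n. finite (F n)" "\<And>n. F n \<subseteq> Z" "\<And>x. x \<in> Z \<Longrightarrow> \<forall>\<^sub>F n in sequentially. x \<in> F n"
    and w: "\<And>n x. x \<in> F n \<Longrightarrow> 0 \<le> w n x \<and> w n x \<le> 1" "\<And>x. x \<in> Z \<Longrightarrow> (\<lambda>n. w n x) \<longlonglongrightarrow> 1"
    and lim: "(\<lambda>n. \<Sum>x\<in>F n. a x * w n x) \<longlonglongrightarrow> L"
  shows "(a has_sum L) Z"
proof -
  have upper: "sum a B \<le> L" if B: "finite B" "B \<subseteq> Z" for B
  proof (rule tendsto_le[OF _ lim])
    have "(\<lambda>n. \<Sum>x\<in>B. a x * w n x) \<longlonglongrightarrow> (\<Sum>x\<in>B. a x * 1)"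
      by (intro tendsto_sum tendsto_mult tendsto_const w(2)) (use B in auto)
    then show "(\<lambda>n. \<Sum>x\<in>B. a x * w n x) \<longlonglongrightarrow> sum a B" by simp
    have "\<forall>\<^sub>F n in sequentially. \<forall>x\<in>B. x \<in> F n"
      by (rule eventually_ball_finite) (use B F(3) in auto)
    then show "\<forall>\<^sub>F n in sequentially. (\<Sum>x\<in>B. a x * w n x) \<le> (\<Sum>x\<in>F n. a x * w n x)"
    proof eventually_elim
      case (elim n)
      then show ?case
        using F(1,2)[of n] nonneg w(1)[of _ n] by (intro sum_mono2) (auto intro!: mult_nonneg_nonneg)
    qed
  qed simp
  have summable: "a summable_on Z"
    by (rule nonneg_bdd_above_summable_on) (use nonneg upper in \<open>auto intro!: bdd_aboveI[of _ L]\<close>)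
  have "L \<le> infsum a Z"
  proof (rule LIMSEQ_le_const2[OF lim], intro exI allI impI)
    fix n
    have "(\<Sum>x\<in>F n. a x * w n x) \<le> sum a (F n)"
      using F(2)[of n] nonneg w(1)[of _ n] by (intro sum_mono) (auto intro: mult_right_le_one_le)
    also have "\<dots> \<le> infsum a Z"
      by (rule finite_sum_le_infsum[OF summable]) (use F nonneg in auto)
    finally show "(\<Sum>x\<in>F n. a x * w n x) \<le> infsum a Z" .
  qed
  moreover have "infsum a Z \<le> L"
    by (rule infsum_le_finite_sums[OF summable]) (rule upper)
  ultimately have "infsum a Z = L" by simp
  then show ?thesis using has_sum_infsum[OF summable] by simp
qed

section \<open>Contour integrals over circles of growing radius\<close>

context q_bessel
begin

lemma radius_sequence:
  obtains R :: "nat \<Rightarrow> real" where "\<And>n. real n < R n" "\<And>n. R n \<notin> zeros"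
proof -
  have "\<exists>r. real n < r \<and> r \<notin> zeros" for n
  proof -
    have "infinite {real n<..<real n + 1}" by (rule infinite_Ioo) simp
    then have "infinite ({real n<..<real n + 1} - (zeros \<inter> {..real n + 1}))"
      using finite_zeros_atMost by (rule Diff_infinite_finite[rotated])
    then have "{real n<..<real n + 1} - (zeros \<inter> {..real n + 1}) \<noteq> {}"
      by (rule infinite_imp_nonempty)
    then obtain r where "r \<in> {real n<..<real n + 1} - (zeros \<inter> {..real n + 1})" by blast
    then show ?thesis by (intro exI[of _ r]) auto
  qed
  then show thesis using that by metis
qed

text \<open>The weights \<open>1 - x^2 / R^2\<close> lie between 0 and 1 inside the circle and tend
  to 1 as \<open>R\<close> grows.\<close>

lemma zero_sum_limit:
  assumes R: "\<And>n. real n < R n" "\<And>n. R n \<notin> zeros"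
    and k: "\<And>x. x \<in> zeros \<Longrightarrow> 0 \<le> k x"
    and lim: "(\<lambda>n. \<Sum>x\<in>zeros \<inter> {..<R n}. zero_weight x * (1 - x\<^sup>2 / (R n)\<^sup>2) * k x) \<longlonglongrightarrow> L"
  shows "((\<lambda>x. zero_weight x * k x) has_sum L) zeros"
proof (rule has_sum_weighted_limit[where F = "\<lambda>n. zeros \<inter> {..<R n}" and w = "\<lambda>n x. 1 - x\<^sup>2 / (R n)\<^sup>2"])
  have Rpos: "0 < R n" for n using R(1)[of n] by (rule order_le_less_trans[rotated]) simp
  have Rinf: "filterlim R at_top sequentially"
    by (rule filterlim_at_top_mono[OF filterlim_real_sequentially]) (intro always_eventually allI less_imp_le R(1))
  show "0 \<le> zero_weight x * k x" if "x \<in> zeros" for x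
    using zero_weight_pos[OF that] k[OF that] by simp
  show "finite (zeros \<inter> {..<R n})" for n
    by (rule finite_subset[OF _ finite_zeros_atMost[of "R n"]]) auto
  show "\<forall>\<^sub>F n in sequentially. x \<in> zeros \<inter> {..<R n}" if "x \<in> zeros" for x
    using filterlim_at_top_dense[THEN iffD1, OF Rinf, rule_format, of x] that by simp
  show "0 \<le> 1 - x\<^sup>2 / (R n)\<^sup>2 \<and> 1 - x\<^sup>2 / (R n)\<^sup>2 \<le> 1" if "x \<in> zeros \<inter> {..<R n}" for n x
  proof -
    have "x\<^sup>2 \<le> (R n)\<^sup>2" using that zeros_pos[of x] by (intro power_mono) auto
    then show ?thesis using Rpos[of n] by simp
  qed
  show "(\<lambda>n. 1 - x\<^sup>2 / (R n)\<^sup>2) \<longlonglongrightarrow> 1" for x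
    using tendsto_diff[OF tendsto_const[of 1] tendsto_divide_0[OF tendsto_const[of "x\<^sup>2"]
      filterlim_at_top_imp_at_infinity[OF filterlim_pow_at_top[OF _ Rinf, of 2]]]] by simp
  show "(\<lambda>n. \<Sum>x\<in>zeros \<inter> {..<R n}. zero_weight x * k x * (1 - x\<^sup>2 / (R n)\<^sup>2)) \<longlonglongrightarrow> L"
    using lim by (simp only: mult.assoc mult.commute mult.left_commute)
qed auto

definition bessel_quot :: "complex \<Rightarrow> complex" where
  "bessel_quot t = bessel 1 t / (of_real (1 - b * q) * bessel 0 t)"

lemma one_minus_bq_nonzero: "complex_of_real (1 - b * q) \<noteq> 0"
  using bq_less_1 unfolding of_real_eq_0_iff by simp

text \<open>After multiplication by the denominator, this is \<open>bessel_ratio_mult\<close> read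
  coefficientwise over the complex numbers.\<close>

lemma bessel_quot_has_fps_expansion: "bessel_quot has_fps_expansion Abs_fps (\<lambda>m. of_real (moment m))"
proof -
  define c where "c = complex_of_real (1 - b * q)"
  have c: "c \<noteq> 0" unfolding c_def by (rule one_minus_bq_nonzero)
  have n1: "bessel_normal 1 $ n = bessel_coeff 1 n / (1 - b * q)" for n
    by (simp add: bessel_normal_def bessel_fps_def qfact_Suc)
  have n0: "bessel_normal 0 $ n = bessel_coeff 0 n" for n
    by (simp add: bessel_normal_def bessel_fps_def)
  have "(Abs_fps (\<lambda>m. of_real (moment m)) * bessel_cfps 0) * fps_const c = bessel_cfps 1"
  proof (rule fps_ext)
    fix n
    have "(\<Sum>i=0..n. moment i * bessel_coeff 0 (n - i)) = bessel_coeff 1 n / (1 - b * q)"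
      using arg_cong[OF bessel_ratio_mult, of "\<lambda>F. fps_nth F n"]
      by (simp only: fps_mult_nth moment_def n0 n1)
    then have "complex_of_real (\<Sum>i=0..n. moment i * bessel_coeff 0 (n - i)) * c = of_real (bessel_coeff 1 n / (1 - b * q)) * c"
      by simp
    also have "\<dots> = of_real (bessel_coeff 1 n)"
      using c by (simp add: c_def)
    finally have "(\<Sum>i=0..n. of_real (moment i) * of_real (bessel_coeff 0 (n - i))) * c = of_real (bessel_coeff 1 n)"
      by simp
    then show "((Abs_fps (\<lambda>m. of_real (moment m)) * bessel_cfps 0) * fps_const c) $ n = bessel_cfps 1 $ n"
      unfolding fps_mult_right_const_nth by (simp add: fps_mult_nth bessel_cfps_def)
  qed
  then have "Abs_fps (\<lambda>m. of_real (moment m)) * (fps_const c * bessel_cfps 0) = bessel_cfps 1"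
    by (simp only: mult_ac)
  moreover have nz: "(fps_const c * bessel_cfps 0) $ 0 \<noteq> 0"
    using c by (simp add: bessel_cfps_def)
  then have "fps_const c * bessel_cfps 0 \<noteq> 0" by (metis fps_zero_nth)
  ultimately have "bessel_cfps 1 / (fps_const c * bessel_cfps 0) = Abs_fps (\<lambda>m. of_real (moment m))"
    by (metis nonzero_mult_div_cancel_right)
  moreover have "(\<lambda>t. bessel 1 t / (c * bessel 0 t)) has_fps_expansion bessel_cfps 1 / (fps_const c * bessel_cfps 0)"
    by (intro has_fps_expansion_divide' has_fps_expansion_cmult_left bessel_has_fps_expansion nz)
  ultimately show ?thesis by (simp add: bessel_quot_def[abs_def] c_def)
qed

lemma kernel_quotient_eq: "kernel_quotient R K t = bessel_quot t * (1 - t\<^sup>2 / of_real (R\<^sup>2)) * K t"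
  by (simp add: kernel_quotient_def bessel_quot_def)

text \<open>The factor \<open>1 - t^2 / R^2\<close> adds a shifted moment of size
  \<open>O(1 / R^2)\<close>, which disappears as \<open>R\<close> grows.\<close>

lemma residue_power_kernel:
  "residue (kernel_quotient R (\<lambda>t. 1 / t ^ Suc m)) 0 =
     of_real (moment m - (if m < 2 then 0 else moment (m - 2)) / R\<^sup>2)"
proof -
  define G where "G = Abs_fps (\<lambda>m. complex_of_real (moment m))"
  have "(\<lambda>t. bessel_quot t - of_real (1 / R\<^sup>2) * (t ^ 2 * bessel_quot t)) has_fps_expansion
      (G - fps_const (of_real (1 / R\<^sup>2)) * (fps_X ^ 2 * G))"
    unfolding G_def
    by (intro has_fps_expansion_diff has_fps_expansion_cmult_left has_fps_expansion_mult
        has_fps_expansion_fps_X_power bessel_quot_has_fps_expansion)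
  from residue_fps_expansion_over_power_at_0[OF this, of m]
  have "residue (\<lambda>t. (bessel_quot t - of_real (1 / R\<^sup>2) * (t ^ 2 * bessel_quot t)) / t ^ Suc m) 0 =
     of_real (moment m - (if m < 2 then 0 else moment (m - 2)) / R\<^sup>2)"
    by (simp add: G_def fps_X_power_mult_nth)
  moreover have "(\<lambda>t. (bessel_quot t - of_real (1 / R\<^sup>2) * (t ^ 2 * bessel_quot t)) / t ^ Suc m) =
     kernel_quotient R (\<lambda>t. 1 / t ^ Suc m)"
    by (simp add: fun_eq_iff kernel_quotient_eq field_simps)
  ultimately show ?thesis by simp
qed

text \<open>With kernel \<open>1 / t^(m+2)\<close> the circle estimate is
  \<open>C / R^(m+1)\<close>, which tends to 0. The kernel \<open>1 / t\<close> for order zero would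
  leave the constant \<open>C\<close>, so that moment is treated separately.\<close>

lemma moment_has_sum_Suc: "((\<lambda>x. zero_weight x * (1 / x ^ Suc (Suc m))) has_sum moment (Suc m)) zeros"
proof -
  obtain R where R: "\<And>n. real n < R n" "\<And>n. R n \<notin> zeros" by (rule radius_sequence) blast
  have Rpos: "0 < R n" for n using R(1)[of n] by (rule order_le_less_trans[rotated]) simp
  have Rinf: "filterlim R at_top sequentially"
    by (rule filterlim_at_top_mono[OF filterlim_real_sequentially]) (intro always_eventually allI less_imp_le R(1))
  define S where "S = (\<lambda>n. \<Sum>x\<in>zeros \<inter> {..<R n}. zero_weight x * (1 - x\<^sup>2 / (R n)\<^sup>2) * (1 / x ^ Suc (Suc m)))"
  define e where "e = (if Suc m < 2 then 0 else moment (Suc m - 2))"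
  define C where "C = 2 / (1 - b * q)"
  have C: "0 \<le> C" using bq_less_1 by (simp add: C_def)
  have bound: "\<bar>moment (Suc m) - e / (R n)\<^sup>2 - S n\<bar> \<le> C / R n ^ Suc m" for n
  proof -
    define K where "K = (\<lambda>t. 1 / t ^ Suc (Suc m) :: complex)"
    have "norm ((\<Sum>p\<in>{0}. residue (kernel_quotient (R n) K) p) -
       (\<Sum>x\<in>zeros \<inter> {..<R n}. of_real (zero_weight x * (1 - x\<^sup>2 / (R n)\<^sup>2)) * K (of_real x)))
       \<le> R n * (2 / (1 - b * q) * (1 / R n ^ Suc (Suc m)))"
    proof (rule kernel_residue_sum)
      show "K holomorphic_on - {0}" unfolding K_def by (intro holomorphic_intros) auto
    qed (use Rpos R(2) in \<open>auto simp: K_def norm_divide norm_mult norm_power\<close>)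
    also have "(\<Sum>p\<in>{0}. residue (kernel_quotient (R n) K) p) = of_real (moment (Suc m) - e / (R n)\<^sup>2)"
      unfolding K_def e_def by (simp only: residue_power_kernel sum.insert sum.empty finite.emptyI empty_iff not_False_eq_True add_0_right)
    also have "(\<Sum>x\<in>zeros \<inter> {..<R n}. of_real (zero_weight x * (1 - x\<^sup>2 / (R n)\<^sup>2)) * K (of_real x)) = of_real (S n)"
      by (simp add: K_def S_def)
    also have "R n * (2 / (1 - b * q) * (1 / R n ^ Suc (Suc m))) = C / R n ^ Suc m"
      using Rpos[of n] by (simp add: C_def)
    finally show ?thesis unfolding of_real_diff[symmetric] norm_of_real .
  qed
  have "(\<lambda>n. moment (Suc m) - e / (R n)\<^sup>2 - S n) \<longlonglongrightarrow> 0"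
  proof (rule Lim_null_comparison[OF always_eventually, OF allI])
    show "norm (moment (Suc m) - e / (R n)\<^sup>2 - S n) \<le> C / R n ^ Suc m" for n using bound by simp
    show "(\<lambda>n. C / R n ^ Suc m) \<longlonglongrightarrow> 0"
      by (rule tendsto_divide_0[OF tendsto_const
            filterlim_at_top_imp_at_infinity[OF filterlim_pow_at_top[OF _ Rinf]]]) simp
  qed
  moreover have "(\<lambda>n. moment (Suc m) - e / (R n)\<^sup>2) \<longlonglongrightarrow> moment (Suc m) - 0"
    by (rule tendsto_diff[OF tendsto_const tendsto_divide_0[OF tendsto_const
            filterlim_at_top_imp_at_infinity[OF filterlim_pow_at_top[OF _ Rinf]]]]) simp
  ultimately have "(\<lambda>n. (moment (Suc m) - e / (R n)\<^sup>2) - (moment (Suc m) - e / (R n)\<^sup>2 - S n)) \<longlonglongrightarrow> moment (Suc m) - 0 - 0"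
    by (rule tendsto_diff[rotated])
  then have "S \<longlonglongrightarrow> moment (Suc m)" by simp
  then show ?thesis
    unfolding S_def by (intro zero_sum_limit[OF R]) (use zeros_pos in \<open>auto intro: less_imp_le\<close>)
qed

section \<open>The moment of order zero: \<open>G\<close> on the negative axis\<close>

definition quot_neg :: "real \<Rightarrow> real" where
  "quot_neg T = (\<Sum>n. \<bar>bessel_coeff 1 n\<bar> * T ^ n) / ((1 - b * q) * (\<Sum>n. \<bar>bessel_coeff 0 n\<bar> * T ^ n))"

lemma bessel_quot_neg: "bessel_quot (- of_real T) = of_real (quot_neg T)"
  by (simp add: bessel_quot_def quot_neg_def bessel_neg)

lemma quot_neg_nonneg: "0 \<le> T \<Longrightarrow> 0 \<le> quot_neg T"
  using bessel_neg_ge_1[of T 1] bessel_neg_ge_1[of T 0] bq_less_1 by (simp add: quot_neg_def)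

lemma moment_0: "moment 0 = 1 / (1 - b * q)"
  by (simp add: moment_def bessel_ratio_def fps_divide_unit bessel_fps_0_nth_0)

text \<open>Split \<open>F_1(-T)\<close> after degree \<open>M\<close>. The tail is at most
  \<open>q ^ Suc M\<close> times \<open>F_0(-T)\<close>. The head is \<open>O(T^M)\<close>, while
  \<open>F_0(-T)\<close> is at least its term of degree \<open>Suc M\<close>.\<close>

lemma quot_neg_bound:
  assumes "1 \<le> T"
  shows "(1 - b * q) * quot_neg T \<le> (\<Sum>n\<le>M. \<bar>bessel_coeff 0 n\<bar>) / (\<bar>bessel_coeff 0 (Suc M)\<bar> * T) + q ^ Suc M"
proof -
  define a where "a = (\<lambda>n. \<bar>bessel_coeff 0 n\<bar>)"
  define A where "A = (\<Sum>n\<le>M. a n)"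
  define f0 where "f0 = (\<Sum>n. a n * T ^ n)"
  define f1 where "f1 = (\<Sum>n. \<bar>bessel_coeff 1 n\<bar> * T ^ n)"
  have T: "0 \<le> T" "0 < T" using assms by auto
  have s0: "summable (\<lambda>n. a n * T ^ n)" and s1: "summable (\<lambda>n. \<bar>bessel_coeff 1 n\<bar> * T ^ n)"
    unfolding a_def by (rule summable_abs_bessel_coeff[OF T(1)])+
  have f0: "1 \<le> f0" unfolding f0_def a_def by (rule bessel_neg_ge_1[OF T(1)])
  have aM: "0 < a (Suc M)"
    unfolding a_def abs_bessel_coeff using q_pos b_pos qfact_q_pos[of "Suc M"] qfact_bq_0_pos[of "Suc M"] by simp
  have f0M: "a (Suc M) * T ^ Suc M \<le> f0" unfolding f0_def a_def by (rule bessel_neg_ge[OF T(1)])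
  have trm: "\<bar>bessel_coeff 1 n\<bar> * T ^ n \<le> q ^ n * (a n * T ^ n)" for n
    using abs_bessel_coeff_le[of 1 n] T by (simp add: a_def mult_right_mono mult.assoc[symmetric])
  have "(\<Sum>n. \<bar>bessel_coeff 1 (n + Suc M)\<bar> * T ^ (n + Suc M)) \<le> (\<Sum>n. q ^ Suc M * (a (n + Suc M) * T ^ (n + Suc M)))"
  proof (rule suminf_le)
    fix n
    have "q ^ (n + Suc M) * (a (n + Suc M) * T ^ (n + Suc M)) \<le> q ^ Suc M * (a (n + Suc M) * T ^ (n + Suc M))"
      using q_pos q_less_1 T by (intro mult_right_mono power_decreasing) (auto simp: a_def)
    then show "\<bar>bessel_coeff 1 (n + Suc M)\<bar> * T ^ (n + Suc M) \<le> q ^ Suc M * (a (n + Suc M) * T ^ (n + Suc M))"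
      using trm[of "n + Suc M"] by linarith
  qed (rule summable_ignore_initial_segment[OF s1] summable_mult[OF summable_ignore_initial_segment[OF s0]])+
  also have "\<dots> = q ^ Suc M * (\<Sum>n. a (n + Suc M) * T ^ (n + Suc M))"
    by (rule suminf_mult[OF summable_ignore_initial_segment[OF s0]])
  also have "\<dots> \<le> q ^ Suc M * f0"
  proof (rule mult_left_mono)
    have "0 \<le> (\<Sum>n<Suc M. a n * T ^ n)" using T by (intro sum_nonneg) (auto simp: a_def)
    then show "(\<Sum>n. a (n + Suc M) * T ^ (n + Suc M)) \<le> f0"
      using suminf_split_initial_segment[OF s0, of "Suc M"] unfolding f0_def by linarith
  qed (use q_pos in simp)
  finally have tail: "(\<Sum>n. \<bar>bessel_coeff 1 (n + Suc M)\<bar> * T ^ (n + Suc M)) \<le> q ^ Suc M * f0" .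
  have "(\<Sum>n<Suc M. \<bar>bessel_coeff 1 n\<bar> * T ^ n) \<le> (\<Sum>n<Suc M. a n * T ^ M)"
  proof (rule sum_mono)
    fix n assume n: "n \<in> {..<Suc M}"
    have "\<bar>bessel_coeff 1 n\<bar> \<le> q ^ (1 * n) * a n" unfolding a_def by (rule abs_bessel_coeff_le)
    also have "\<dots> \<le> 1 * a n" using q_pos q_less_1 by (intro mult_right_mono power_le_one) (auto simp: a_def)
    finally have "\<bar>bessel_coeff 1 n\<bar> \<le> a n" by simp
    moreover have "T ^ n \<le> T ^ M" using n assms by (intro power_increasing) auto
    ultimately show "\<bar>bessel_coeff 1 n\<bar> * T ^ n \<le> a n * T ^ M"
      using T by (intro mult_mono) (auto simp: a_def)
  qed
  also have "\<dots> = A * T ^ M" unfolding A_def sum_distrib_right lessThan_Suc_atMost ..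
  also have "\<dots> \<le> A / (a (Suc M) * T) * f0"
  proof -
    have "A * T ^ M = A / (a (Suc M) * T) * (a (Suc M) * T ^ Suc M)" using aM T by simp
    also have "\<dots> \<le> A / (a (Suc M) * T) * f0"
      using aM T by (intro mult_left_mono f0M divide_nonneg_pos) (auto simp: A_def a_def intro: sum_nonneg)
    finally show ?thesis .
  qed
  finally have "f1 \<le> (A / (a (Suc M) * T) + q ^ Suc M) * f0"
    using suminf_split_initial_segment[OF s1, of "Suc M"] tail unfolding f1_def ring_distribs by linarith
  then have "f1 / f0 \<le> A / (a (Suc M) * T) + q ^ Suc M" using f0 by (simp add: pos_divide_le_eq)
  moreover have "(1 - b * q) * quot_neg T = f1 / f0"
    using bq_less_1 by (simp add: quot_neg_def f1_def f0_def a_def)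
  ultimately show ?thesis by (simp only: A_def a_def)
qed

lemma quot_neg_arbitrarily_small:
  assumes "0 < \<epsilon>"
  obtains T where "1 \<le> T" "quot_neg T < \<epsilon>"
proof -
  define \<delta> where "\<delta> = (1 - b * q) * \<epsilon>"
  have \<delta>: "0 < \<delta>" using assms bq_less_1 by (simp add: \<delta>_def)
  have "(\<lambda>M. q ^ Suc M) \<longlonglongrightarrow> 0" using q_pos q_less_1 by (intro LIMSEQ_Suc LIMSEQ_power_zero) auto
  then have "\<forall>\<^sub>F M in sequentially. q ^ Suc M < \<delta> / 2" by (rule order_tendstoD) (use \<delta> in simp)
  then obtain M where M: "q ^ Suc M < \<delta> / 2" by (auto simp: eventually_sequentially)
  define D where "D = (\<Sum>n\<le>M. \<bar>bessel_coeff 0 n\<bar>) / \<bar>bessel_coeff 0 (Suc M)\<bar>"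
  have D: "0 \<le> D" unfolding D_def by (intro divide_nonneg_nonneg sum_nonneg) auto
  \<comment> \<open>\<open>M\<close> is already fixed by the tail; \<open>T\<close> is now taken
    large enough for the head \<open>D / T\<close> to fall below
    \<open>\<delta> / 2\<close>.\<close>
  define T where "T = max 1 (2 * D / \<delta> + 1)"
  have T: "1 \<le> T" "2 * D / \<delta> < T" by (auto simp: T_def)
  then have "D / T < \<delta> / 2" using \<delta> by (simp add: field_simps)
  moreover have "(1 - b * q) * quot_neg T \<le> D / T + q ^ Suc M"
    using quot_neg_bound[OF T(1), of M] by (simp only: D_def divide_divide_eq_left)
  ultimately have "(1 - b * q) * quot_neg T < (1 - b * q) * \<epsilon>" using M unfolding \<delta>_def by linarith
  then have "quot_neg T < \<epsilon>" using bq_less_1 by (subst (asm) mult_less_cancel_left_pos) auto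
  with T(1) show thesis by (rule that)
qed

lemma open_bessel_nonzero: "open {t. bessel 0 t \<noteq> 0}"
  by (intro open_Collect_neq holomorphic_on_imp_continuous_on holomorphic_bessel continuous_on_const)

text \<open>The kernel \<open>1 / (t (t + T))\<close> decays like \<open>1 / t^2\<close>, so the
  circle integral vanishes in the limit. Its poles at 0 and \<open>-T\<close> contribute
  \<open>G(0) / T\<close> and, in the limit, \<open>- G(-T) / T\<close>.\<close>

lemma stieltjes_has_sum:
  assumes T: "0 < T"
  shows "((\<lambda>x. zero_weight x * (1 / (x * (x + T)))) has_sum (moment 0 - quot_neg T) / T) zeros"
proof -
  obtain R where R: "\<And>n. real n < R n" "\<And>n. R n \<notin> zeros" by (rule radius_sequence) blast
  have Rpos: "0 < R n" for n using R(1)[of n] by (rule order_le_less_trans[rotated]) simp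
  have Rinf: "filterlim R at_top sequentially"
    by (rule filterlim_at_top_mono[OF filterlim_real_sequentially]) (intro always_eventually allI less_imp_le R(1))
  define S where "S = (\<lambda>n. \<Sum>x\<in>zeros \<inter> {..<R n}. zero_weight x * (1 - x\<^sup>2 / (R n)\<^sup>2) * (1 / (x * (x + T))))"
  define C where "C = 2 / (1 - b * q)"
  define K where "K = (\<lambda>t. 1 / (t * (t + of_real T)) :: complex)"
  have res0: "residue (kernel_quotient r K) 0 = of_real (moment 0 / T)" for r
  proof -
    define N where "N = (\<lambda>t. bessel_quot t * (1 - t\<^sup>2 / of_real (r\<^sup>2)) / (t + of_real T))"
    \<comment> \<open>The half-plane \<open>Re t > -T\<close> isolates the pole at 0 from the one at
      \<open>-T\<close>; the latter is treated below on \<open>Re t < 0\<close>.\<close>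
    have "residue (\<lambda>t. N t / (t - 0)) 0 = N 0"
    proof (rule residue_simple[of "{t. bessel 0 t \<noteq> 0} \<inter> {t. - T < Re t}"])
      have "t + of_real T \<noteq> 0" if "- T < Re t" for t
        using that by (auto dest: arg_cong[where f = Re])
      then show "N holomorphic_on {t. bessel 0 t \<noteq> 0} \<inter> {t. - T < Re t}"
        unfolding N_def bessel_quot_def using one_minus_bq_nonzero
        by (cases "r = 0") (auto intro!: holomorphic_intros holomorphic_bessel)
    qed (use T in \<open>auto intro!: open_Int open_bessel_nonzero open_halfspace_Re_gt\<close>)
    moreover have "(\<lambda>t. N t / (t - 0)) = kernel_quotient r K"
      by (simp add: fun_eq_iff N_def kernel_quotient_eq K_def mult.commute)
    moreover have "N 0 = of_real (moment 0 / T)"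
      by (simp add: N_def bessel_quot_def moment_0)
    ultimately show ?thesis by simp
  qed
  have res1: "residue (kernel_quotient r K) (- of_real T) = of_real (quot_neg T * (1 - T\<^sup>2 / r\<^sup>2) / - T)" for r
  proof -
    define N where "N = (\<lambda>t. bessel_quot t * (1 - t\<^sup>2 / of_real (r\<^sup>2)) / t)"
    have "residue (\<lambda>t. N t / (t - (- of_real T))) (- of_real T) = N (- of_real T)"
    proof (rule residue_simple[of "{t. bessel 0 t \<noteq> 0} \<inter> {t. Re t < 0}"])
      show "N holomorphic_on {t. bessel 0 t \<noteq> 0} \<inter> {t. Re t < 0}"
        unfolding N_def bessel_quot_def using one_minus_bq_nonzero
        by (cases "r = 0") (auto intro!: holomorphic_intros holomorphic_bessel)
      have "bessel 0 (- of_real T) \<noteq> 0"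
        using bessel_neg_ge_1[of T 0] T unfolding bessel_neg of_real_eq_0_iff by simp
      then show "- of_real T \<in> {t. bessel 0 t \<noteq> 0} \<inter> {t. Re t < 0}" using T by simp
    qed (auto intro!: open_Int open_bessel_nonzero open_halfspace_Re_lt)
    moreover have "(\<lambda>t. N t / (t - (- of_real T))) = kernel_quotient r K"
      by (simp add: fun_eq_iff N_def kernel_quotient_eq K_def)
    moreover have "N (- of_real T) = of_real (quot_neg T * (1 - T\<^sup>2 / r\<^sup>2) / - T)"
      by (simp add: N_def bessel_quot_neg)
    ultimately show ?thesis by simp
  qed
  define E where "E = (\<lambda>n. moment 0 / T + quot_neg T * (1 - T\<^sup>2 / (R n)\<^sup>2) / - T)"
  have bound: "\<bar>E n - S n\<bar> \<le> C / (R n - T)" if RT: "T < R n" for n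
  proof -
    have "norm ((\<Sum>p\<in>{0, - of_real T}. residue (kernel_quotient (R n) K) p) -
       (\<Sum>x\<in>zeros \<inter> {..<R n}. of_real (zero_weight x * (1 - x\<^sup>2 / (R n)\<^sup>2)) * K (of_real x)))
       \<le> R n * (2 / (1 - b * q) * (1 / (R n * (R n - T))))"
    proof (rule kernel_residue_sum)
      show "K holomorphic_on - {0, - of_real T}"
        unfolding K_def by (intro holomorphic_intros) (auto simp: add_eq_0_iff)
      show "norm p < R n \<and> Re p \<le> 0" if "p \<in> {0, - of_real T}" for p
        using that T RT Rpos[of n] by auto
      show "K t \<noteq> 0" if "0 < Re t" for t
      proof -
        have "t \<noteq> 0" "t + of_real T \<noteq> 0" using that T by (auto dest: arg_cong[where f = Re])
        then show ?thesis by (simp add: K_def)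
      qed
      show "norm (K t) \<le> 1 / (R n * (R n - T))" if "norm t = R n" for t
      proof -
        have "R n - T \<le> norm (t + of_real T)"
          using norm_triangle_ineq2[of t "- of_real T"] that T by simp
        then show ?thesis
          using that RT Rpos[of n] unfolding K_def norm_divide norm_mult
          by (intro frac_le mult_left_mono mult_pos_pos) auto
      qed
    qed (use Rpos R(2) in auto)
    also have "(\<Sum>p\<in>{0, - of_real T}. residue (kernel_quotient (R n) K) p) = of_real (E n)"
      using T by (simp add: res0 res1 E_def)
    also have "(\<Sum>x\<in>zeros \<inter> {..<R n}. of_real (zero_weight x * (1 - x\<^sup>2 / (R n)\<^sup>2)) * K (of_real x)) = of_real (S n)"
      by (simp add: K_def S_def)
    also have "R n * (2 / (1 - b * q) * (1 / (R n * (R n - T)))) = C / (R n - T)"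
      using Rpos[of n] by (simp add: C_def)
    finally show ?thesis unfolding of_real_diff[symmetric] norm_of_real .
  qed
  have "(\<lambda>n. E n - S n) \<longlonglongrightarrow> 0"
  proof (rule Lim_null_comparison)
    show "\<forall>\<^sub>F n in sequentially. norm (E n - S n) \<le> C / (R n - T)"
      using filterlim_at_top_dense[THEN iffD1, OF Rinf, rule_format, of T]
      by eventually_elim (use bound in simp)
    have "filterlim (\<lambda>n. - T + R n) at_top sequentially"
      by (rule filterlim_tendsto_add_at_top[OF tendsto_const Rinf])
    then have "filterlim (\<lambda>n. R n - T) at_top sequentially" by simp
    then show "(\<lambda>n. C / (R n - T)) \<longlonglongrightarrow> 0"
      by (intro tendsto_divide_0[OF tendsto_const] filterlim_at_top_imp_at_infinity)
  qed
  moreover have "E \<longlonglongrightarrow> moment 0 / T + quot_neg T * (1 - 0) / - T"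
    unfolding E_def using T
    by (intro tendsto_intros tendsto_divide_0[OF tendsto_const]
          filterlim_at_top_imp_at_infinity filterlim_pow_at_top Rinf) auto
  ultimately have "(\<lambda>n. E n - (E n - S n)) \<longlonglongrightarrow> moment 0 / T + quot_neg T * (1 - 0) / - T - 0"
    by (rule tendsto_diff[rotated])
  then have "S \<longlonglongrightarrow> (moment 0 - quot_neg T) / T" by (simp add: diff_divide_distrib)
  then show ?thesis
    unfolding S_def by (intro zero_sum_limit[OF R]) (use zeros_pos T in \<open>auto intro!: less_imp_le add_pos_pos mult_pos_pos\<close>)
qed

end

text \<open>Start at the least element and pass repeatedly to the next larger one. A missed element
  would bound all values from above, forcing infinitely many points below it.\<close>

lemma discrete_unbounded_enumeration:
  fixes Z :: "real set"
  assumes inf: "infinite Z" and fin: "\<And>r. finite (Z \<inter> {..r})"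
  obtains j :: "nat \<Rightarrow> real" where "strict_mono j" "range j = Z"
proof -
  have least: "\<exists>m\<in>Z. P m \<and> (\<forall>y\<in>Z. P y \<longrightarrow> m \<le> y)" if "z \<in> Z" "P z" for P z
  proof -
    define A where "A = {y \<in> Z \<inter> {..z}. P y}"
    have A: "finite A" "A \<noteq> {}"
      using that by (auto simp: A_def intro: finite_subset[OF _ fin[of z]])
    then have "Min A \<in> A" by (rule Min_in)
    moreover have "Min A \<le> y" if "y \<in> Z" "P y" for y
      using A(1) that \<open>Min A \<in> A\<close> Min_le[OF A(1), of y] by (cases "y \<le> z") (auto simp: A_def)
    ultimately show ?thesis by (intro bexI[of _ "Min A"]) (auto simp: A_def)
  qed
  obtain z0 where z0: "z0 \<in> Z" "\<And>y. y \<in> Z \<Longrightarrow> z0 \<le> y"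
    using least[of _ "\<lambda>_. True"] infinite_imp_nonempty[OF inf] by blast
  have "\<exists>s\<in>Z. x < s \<and> (\<forall>y\<in>Z. x < y \<longrightarrow> s \<le> y)" for x
  proof -
    have "\<not> Z \<subseteq> Z \<inter> {..x}" using inf fin[of x] finite_subset by blast
    then obtain z where "z \<in> Z" "x < z" by (force simp: not_le)
    then show ?thesis by (rule least)
  qed
  then obtain s where s: "\<And>x. s x \<in> Z" "\<And>x. x < s x" "\<And>x y. y \<in> Z \<Longrightarrow> x < y \<Longrightarrow> s x \<le> y"
    by metis
  define j where "j = rec_nat z0 (\<lambda>_. s)"
  have j: "j 0 = z0" "\<And>n. j (Suc n) = s (j n)" by (auto simp: j_def)
  have mono: "strict_mono j" by (rule strict_monoI_Suc) (simp add: j s)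
  have jZ: "j n \<in> Z" for n by (cases n) (auto simp: j z0 s)
  have "Z \<subseteq> range j"
  proof (rule subsetI, rule ccontr)
    fix z assume z: "z \<in> Z" "z \<notin> range j"
    have "j n < z" for n
    proof (induction n)
      case 0
      then show ?case using z0(2)[OF z(1)] z(2) j(1) by (metis rangeI order_le_less)
    next
      case (Suc n)
      then show ?case using s(3)[OF z(1) Suc] z(2) j(2) by (metis rangeI order_le_less)
    qed
    then have "range j \<subseteq> Z \<inter> {..z}" using jZ by (auto intro: less_imp_le)
    then have "finite (range j)" using fin finite_subset by blast
    then show False using strict_mono_imp_inj_on[OF mono] finite_imageD by blast
  qed
  then have "range j = Z" using jZ by blast
  with mono show thesis by (rule that)
qed

text \<open>This gives the uniqueness behind the definite description in
  \<open>jackson_zero\<close>.\<close>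

lemma strict_mono_range_unique:
  fixes f g :: "nat \<Rightarrow> real"
  assumes f: "strict_mono f" and g: "strict_mono g" and eq: "range f = range g"
  shows "f = g"
proof
  fix n
  show "f n = g n"
  proof (induction n rule: less_induct)
    case (less n)
    obtain m where m: "f n = g m" using eq by (metis rangeE rangeI)
    obtain k where k: "g n = f k" using eq by (metis rangeE rangeI)
    have "n \<le> m"
    proof (rule ccontr)
      assume "\<not> n \<le> m"
      then have "f m = g m" using less.IH by simp
      moreover have "f m < f n" using strict_monoD[OF f] \<open>\<not> n \<le> m\<close> by simp
      ultimately show False using m k by simp
    qed
    moreover have "n \<le> k"
    proof (rule ccontr)
      assume "\<not> n \<le> k"
      then have "f k = g k" using less.IH by simp
      moreover have "g k < g n" using strict_monoD[OF g] \<open>\<not> n \<le> k\<close> by simp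
      ultimately show False using m k by simp
    qed
    ultimately have "g n \<le> g m" "f n \<le> f k"
      using f g by (simp_all add: strict_mono_less_eq)
    then show ?case using m k by simp
  qed
qed

context q_bessel
begin

text \<open>Multiplied by \<open>T\<close>, the expansion above says that the terms
  \<open>a x\<close> damped by \<open>T / (x + T)\<close> sum to \<open>G(0) - G(-T)\<close>.
  Letting \<open>T = n\<close> grow bounds finite sums of \<open>a\<close> by \<open>G(0)\<close>;
  dropping the damping and making \<open>G(-T)\<close> small gives the reverse inequality.\<close>

lemma moment_has_sum_0: "((\<lambda>x. zero_weight x * (1 / x)) has_sum moment 0) zeros"
proof -
  define a where "a = (\<lambda>x. zero_weight x * (1 / x))"
  have nonneg: "0 \<le> a x" if "x \<in> zeros" for x
    using zeros_pos[OF that] zero_weight_pos[OF that] by (simp add: a_def)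
  define c where "c = (\<lambda>T x. zero_weight x * (1 / (x * (x + T))) * T)"
  have c: "(c T has_sum (moment 0 - quot_neg T)) zeros" if "0 < T" for T
    using has_sum_cmult_left[OF stieltjes_has_sum[OF that], of T] that by (simp add: c_def)
  have c_eq: "c T x = a x * (T / (x + T))" if "x \<in> zeros" for T x
    using zeros_pos[OF that] by (simp add: a_def c_def)
  have upper: "sum a B \<le> moment 0" if B: "finite B" "B \<subseteq> zeros" for B
  proof (rule LIMSEQ_le_const2)
    have "(\<lambda>n. real n / (x + real n)) \<longlonglongrightarrow> 1" for x :: real by real_asymp
    then have "(\<lambda>n. \<Sum>x\<in>B. a x * (real n / (x + real n))) \<longlonglongrightarrow> (\<Sum>x\<in>B. a x * 1)"
      by (intro tendsto_sum tendsto_mult tendsto_const)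
    then show "(\<lambda>n. \<Sum>x\<in>B. a x * (real n / (x + real n))) \<longlonglongrightarrow> sum a B" by simp
    show "\<exists>N. \<forall>n\<ge>N. (\<Sum>x\<in>B. a x * (real n / (x + real n))) \<le> moment 0"
    proof (intro exI[of _ 1] allI impI)
      fix n :: nat assume "1 \<le> n"
      then have n: "0 < real n" by simp
      have "(\<Sum>x\<in>B. a x * (real n / (x + real n))) = sum (c (real n)) B"
        using B c_eq by (intro sum.cong) auto
      also have "\<dots> \<le> moment 0 - quot_neg (real n)"
      proof (rule finite_sum_le_has_sum[OF c[OF n] B])
        fix x assume "x \<in> zeros - B"
        then show "0 \<le> c (real n) x" using nonneg[of x] zeros_pos[of x] c_eq[of x] n by simp
      qed
      also have "\<dots> \<le> moment 0" using quot_neg_nonneg[of "real n"] by simp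
      finally show "(\<Sum>x\<in>B. a x * (real n / (x + real n))) \<le> moment 0" .
    qed
  qed
  have summable: "a summable_on zeros"
    by (rule nonneg_bdd_above_summable_on) (use nonneg upper in \<open>auto intro!: bdd_aboveI[of _ "moment 0"]\<close>)
  have "moment 0 \<le> infsum a zeros"
  proof (rule field_le_epsilon)
    fix e :: real assume "0 < e"
    then obtain T where T: "1 \<le> T" "quot_neg T < e" by (rule quot_neg_arbitrarily_small)
    have "moment 0 - quot_neg T \<le> infsum a zeros"
    proof (rule has_sum_mono[OF c has_sum_infsum[OF summable]])
      fix x assume x: "x \<in> zeros"
      have "a x * (T / (x + T)) \<le> a x * 1"
        using zeros_pos[OF x] T nonneg[OF x] by (intro mult_left_mono) auto
      then show "c T x \<le> a x" using c_eq[OF x] by simp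
    qed (use T in simp)
    then show "moment 0 \<le> infsum a zeros + e" using T by linarith
  qed
  moreover have "infsum a zeros \<le> moment 0"
    by (rule infsum_le_finite_sums[OF summable]) (rule upper)
  ultimately have "infsum a zeros = moment 0" by simp
  then show ?thesis using has_sum_infsum[OF summable] by (simp add: a_def)
qed

lemma moment_has_sum: "((\<lambda>x. zero_weight x / x ^ Suc m) has_sum moment m) zeros"
  using moment_has_sum_0 moment_has_sum_Suc[of "m - 1"] by (cases m) simp_all

text \<open>With finitely many zeros the moments would come from a measure with finitely many atoms, and the
  polynomial vanishing at the atoms would be a kernel vector of a Hankel matrix.\<close>

lemma infinite_zeros: "infinite zeros"
proof
  assume fin: "finite zeros"
  define P where "P = (\<Prod>x\<in>zeros. [:- 1 / x, 1:])"
  have P0: "P \<noteq> 0" using fin by (simp add: P_def prod_zero_iff)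
  have root: "poly P (1 / x) = 0" if "x \<in> zeros" for x
    using fin that by (auto simp: P_def poly_prod intro!: prod_zero bexI[of _ x])
  have m: "moment m = (\<Sum>x\<in>zeros. zero_weight x / x ^ Suc m)" for m
    using has_sum_unique[OF moment_has_sum has_sum_finite[OF fin]] .
  have "(\<Sum>a\<le>degree P. moment (i + a) * coeff P a) = 0" for i
  proof -
    have "(\<Sum>a\<le>degree P. moment (i + a) * coeff P a) =
        (\<Sum>a\<le>degree P. \<Sum>x\<in>zeros. zero_weight x / x ^ Suc (i + a) * coeff P a)"
      unfolding m sum_distrib_right ..
    also have "\<dots> = (\<Sum>x\<in>zeros. \<Sum>a\<le>degree P. zero_weight x / x ^ Suc (i + a) * coeff P a)"
      by (rule sum.swap)
    also have "\<dots> = (\<Sum>x\<in>zeros. zero_weight x / x ^ Suc i * poly P (1 / x))"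
    proof (rule sum.cong[OF refl])
      fix x assume "x \<in> zeros"
      then have "x \<noteq> 0" using zeros_pos by fastforce
      then show "(\<Sum>a\<le>degree P. zero_weight x / x ^ Suc (i + a) * coeff P a) = zero_weight x / x ^ Suc i * poly P (1 / x)"
        unfolding poly_altdef sum_distrib_left by (intro sum.cong refl) (simp add: power_add power_divide)
    qed
    also have "\<dots> = 0" using root by simp
    finally show ?thesis .
  qed
  then have "coeff P (degree P) = 0" by (intro hankel_nonsingular[of "degree P" "coeff P"]) auto
  with P0 show False by simp
qed

end

section \<open>Jackson's Bessel function\<close>

lemma qpoch_inf_convergent:
  fixes a q :: real
  assumes "0 \<le> q" "q < 1"
  shows "convergent_prod (\<lambda>m. 1 - a * q ^ m)"
proof (rule abs_convergent_prod_imp_convergent_prod, rule summable_imp_abs_convergent_prod)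
  have "summable (\<lambda>m. \<bar>a\<bar> * q ^ m)"
    using assms by (intro summable_mult summable_geometric) simp
  then show "summable (\<lambda>i. norm (1 - a * q ^ i - 1))"
    using assms by (simp add: abs_mult power_abs)
qed

lemma qpoch_inf_nonzero:
  fixes a q :: real
  assumes "0 \<le> q" "q < 1" "a < 1"
  shows "qpoch_inf a q \<noteq> 0"
  unfolding qpoch_inf_def
  using prodinf_nonzero[OF qpoch_inf_convergent[OF assms(1,2)]] one_minus_mult_power_pos[OF assms]
  by (metis less_irrefl)

lemma qpoch_inf_split:
  fixes a q :: real
  assumes "0 \<le> q" "q < 1" "a < 1"
  shows "qpoch_inf a q = qpoch_inf (a * q ^ n) q * qfact a q n"
proof -
  have "1 - a * q ^ i \<noteq> 0" for i
    using one_minus_mult_power_pos[OF assms, of i] by simp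
  from prodinf_split_initial_segment[OF qpoch_inf_convergent[OF assms(1,2)] this, of n]
  have "qpoch_inf a q = (\<Prod>i. 1 - a * q ^ (i + n)) * qfact a q n"
    by (simp only: qpoch_inf_def qfact_def)
  also have "(\<lambda>i. 1 - a * q ^ (i + n)) = (\<lambda>i. 1 - a * q ^ n * q ^ i)"
    by (simp add: fun_eq_iff power_add)
  finally show ?thesis by (simp only: qpoch_inf_def)
qed

lemma qpoch_eq_qfact:
  fixes a q :: real
  assumes "0 \<le> q" "q < 1" "a < 1"
  shows "qpoch a q (int n) = qfact a q n"
proof -
  have "a * q ^ n < 1" using one_minus_mult_power_pos[OF assms, of n] by simp
  then have "qpoch_inf (a * q ^ n) q \<noteq> 0" using assms by (intro qpoch_inf_nonzero) auto
  then show ?thesis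
    unfolding qpoch_def power_int_of_nat using qpoch_inf_split[OF assms, of n] by simp
qed

section \<open>Translation between \<open>J_(\<nu>+k)\<close> and \<open>F_k\<close>, with
  \<open>b = q^\<nu>\<close>\<close>

locale jackson =
  fixes q \<nu> :: real
  assumes q_pos: "0 < q" and q_less_1: "q < 1" and nu: "- 1 < \<nu>"
begin

lemma powr_b: "q powr \<nu> * q = q powr (\<nu> + 1)"
  using q_pos by (simp add: powr_add)

lemma q_powr_less_1: "q powr (\<nu> + 1) < 1"
  using powr_less_mono'[of q 0 "\<nu> + 1"] q_pos q_less_1 nu by simp

sublocale q_bessel q "q powr \<nu>"
  by unfold_locales (use q_pos q_less_1 q_powr_less_1 in \<open>auto simp: powr_b\<close>)

lemma qpoch_b: "qpoch (q powr (\<nu> + 1)) q (int n) = qfact (q powr \<nu> * q) q n"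
  using q_pos q_less_1 q_powr_less_1 by (simp add: qpoch_eq_qfact powr_b)

lemma qpoch_q: "qpoch q q (int n) = qfact q q n"
  using q_pos q_less_1 by (simp add: qpoch_eq_qfact)

lemma powr_shift: "q powr (\<nu> + real k) = q powr \<nu> * q ^ k"
  using q_pos by (simp add: powr_add powr_realpow)

lemma powr_Suc_shift: "q powr (\<nu> + real k + 1) = q powr \<nu> * q ^ Suc k"
  using powr_shift[of "Suc k"] by (simp add: add_ac)

definition jackson_factor :: "nat \<Rightarrow> real" where
  "jackson_factor k = qpoch_inf (q powr \<nu> * q ^ Suc k) q / qpoch_inf q q"

lemma jackson_factor_nonzero: "jackson_factor k \<noteq> 0"
  unfolding jackson_factor_def using q_pos q_less_1 bq_pow_less_1[of k]
  by (simp add: qpoch_inf_nonzero del: power_Suc)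

text \<open>This quotient of prefactors is the origin of the constant \<open>1 - b q\<close> in the
  denominator of \<open>G\<close>.\<close>

lemma jackson_factor_0: "jackson_factor 0 = (1 - q powr \<nu> * q) * jackson_factor 1"
  using qpoch_inf_split[of q "q powr \<nu> * q" 1] q_pos q_less_1 bq_less_1
  by (simp add: jackson_factor_def qfact_def power2_eq_square mult.assoc)

definition bessel_re :: "nat \<Rightarrow> real \<Rightarrow> real" where
  "bessel_re k x = Re (bessel k (of_real x))"

lemma bessel_re_eq: "bessel_re k x = (\<Sum>n. bessel_coeff k n * x ^ n)"
  by (simp add: bessel_re_def bessel_of_real)

lemma summable_bessel_re: "summable (\<lambda>n. bessel_coeff k n * x ^ n)"
  by (rule summable_rabs_cancel)
    (use summable_abs_bessel_coeff[of "\<bar>x\<bar>" k] in \<open>simp add: abs_mult power_abs\<close>)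

lemma jackson_J2_eq:
  assumes z: "0 < z"
  shows "jackson_J2 (\<nu> + real k) q z = jackson_factor k * ((z / 2) powr (\<nu> + real k) * bessel_re k (z\<^sup>2 / 4))"
proof -
  define c where "c = (z / 2) powr (\<nu> + real k)"
  have tm: "(- 1) ^ n * q powr (real n * (\<nu> + real k + real n)) /
            (qpoch q q (int n) * qpoch (q powr (\<nu> + real k + 1)) q (int n)) *
            (z / 2) powr (\<nu> + real k + 2 * real n) = c * (bessel_coeff k n * (z\<^sup>2 / 4) ^ n)" for n
  proof -
    have "(z / 2) powr (\<nu> + real k + real (2 * n)) = c * (z / 2) ^ (2 * n)"
      unfolding c_def using z by (simp only: powr_add powr_realpow)
    also have "(z / 2) ^ (2 * n) = (z\<^sup>2 / 4) ^ n" by (simp add: power_mult power_divide)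
    finally have 1: "(z / 2) powr (\<nu> + real k + 2 * real n) = c * (z\<^sup>2 / 4) ^ n" by simp
    have "q powr (real n * (\<nu> + real k + real n)) = q powr ((\<nu> + real k) * real n) * q powr (real (n\<^sup>2))"
      by (simp add: powr_add[symmetric] algebra_simps power2_eq_square)
    also have "\<dots> = (q powr \<nu> * q ^ k) ^ n * q ^ n\<^sup>2"
      using q_pos by (simp add: powr_powr[symmetric] powr_realpow powr_shift del: of_nat_power)
    finally have 2: "q powr (real n * (\<nu> + real k + real n)) = (q powr \<nu> * q ^ k) ^ n * q ^ n\<^sup>2" .
    have 3: "qpoch (q powr (\<nu> + real k + 1)) q (int n) = qfact (q powr \<nu> * q ^ Suc k) q n"
      unfolding powr_Suc_shift using q_pos q_less_1 bq_pow_less_1[of k] by (intro qpoch_eq_qfact) auto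
    show ?thesis unfolding 1 2 3 qpoch_q bessel_coeff_def by simp
  qed
  have "jackson_J2 (\<nu> + real k) q z = jackson_factor k * (\<Sum>n. c * (bessel_coeff k n * (z\<^sup>2 / 4) ^ n))"
    unfolding jackson_J2_def jackson_factor_def tm by (simp only: powr_Suc_shift)
  also have "(\<Sum>n. c * (bessel_coeff k n * (z\<^sup>2 / 4) ^ n)) = c * bessel_re k (z\<^sup>2 / 4)"
    unfolding bessel_re_eq by (rule suminf_mult[OF summable_bessel_re])
  finally show ?thesis by (simp only: c_def)
qed

lemma zeros_iff: "x \<in> zeros \<longleftrightarrow> bessel_re 0 x = 0"
  by (simp add: zeros_def bessel_re_def bessel_of_real)

lemma jackson_zeros: "{z. 0 < z \<and> z powr (- \<nu>) * jackson_J2 \<nu> q z = 0} = (\<lambda>x. 2 * sqrt x) ` zeros"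
proof -
  have iff: "z powr (- \<nu>) * jackson_J2 \<nu> q z = 0 \<longleftrightarrow> z\<^sup>2 / 4 \<in> zeros" if "0 < z" for z
    using jackson_J2_eq[OF that, of 0] that jackson_factor_nonzero[of 0] by (simp add: zeros_iff)
  show ?thesis
  proof (intro equalityI subsetI)
    fix z assume "z \<in> {z. 0 < z \<and> z powr (- \<nu>) * jackson_J2 \<nu> q z = 0}"
    then have "0 < z" "z\<^sup>2 / 4 \<in> zeros" using iff by auto
    moreover have "2 * sqrt (z\<^sup>2 / 4) = z" using \<open>0 < z\<close> by (simp add: real_sqrt_divide)
    ultimately show "z \<in> (\<lambda>x. 2 * sqrt x) ` zeros" by (metis imageI)
  next
    fix z assume "z \<in> (\<lambda>x. 2 * sqrt x) ` zeros"
    then obtain x where x: "x \<in> zeros" "z = 2 * sqrt x" by auto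
    then have "0 < x" using zeros_pos by blast
    then have "0 < z" "z\<^sup>2 / 4 = x" using x(2) by (auto simp: power_mult_distrib)
    then show "z \<in> {z. 0 < z \<and> z powr (- \<nu>) * jackson_J2 \<nu> q z = 0}" using iff x(1) by auto
  qed
qed

lemma jackson_zero_eq:
  fixes j :: "nat \<Rightarrow> real"
  assumes j: "strict_mono j" "range j = zeros"
  shows "jackson_zero \<nu> q = (\<lambda>l. 2 * sqrt (j l))"
proof -
  have s: "strict_mono (\<lambda>l. 2 * sqrt (j l))"
    using j(1) by (simp add: strict_mono_def)
  have r: "range (\<lambda>l. 2 * sqrt (j l)) = {z. 0 < z \<and> z powr (- \<nu>) * jackson_J2 \<nu> q z = 0}"
    unfolding jackson_zeros j(2)[symmetric] image_image ..
  show ?thesis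
    unfolding jackson_zero_def
  proof (rule the_equality)
    fix j' :: "nat \<Rightarrow> real"
    assume "strict_mono j' \<and> range j' = {z. 0 < z \<and> z powr (- \<nu>) * jackson_J2 \<nu> q z = 0}"
    then show "j' = (\<lambda>l. 2 * sqrt (j l))"
      using strict_mono_range_unique[of j'] s r by simp
  qed (use s r in simp)
qed

text \<open>In the product rule the derivative of \<open>(z/2)^\<nu>\<close> is multiplied by
  \<open>F_0(x) = 0\<close>. The remaining \<open>sqrt x\<close> is \<open>z / 2\<close>, the
  derivative of \<open>z^2 / 4\<close>.\<close>

lemma jackson_J2_deriv:
  assumes x: "x \<in> zeros"
  shows "deriv (jackson_J2 \<nu> q) (2 * sqrt x) =
    jackson_factor 0 * (sqrt x powr \<nu> * (Re (deriv (bessel 0) (of_real x)) * sqrt x))"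
proof (rule DERIV_imp_deriv)
  define z where "z = 2 * sqrt x"
  define d where "d = Re (deriv (bessel 0) (of_real x))"
  have x0: "0 < x" using zeros_pos[OF x] .
  then have z: "0 < z" "z\<^sup>2 / 4 = x" "z / 2 = sqrt x" by (auto simp: z_def power_mult_distrib)
  have bd: "(bessel_re 0 has_real_derivative d) (at (z\<^sup>2 / 4))"
    using bessel_real_derivative[of 0 x] by (simp add: bessel_re_def[abs_def] d_def z(2))
  have 1: "((\<lambda>z. z\<^sup>2 / 4) has_real_derivative z / 2) (at z)"
    by (auto intro!: derivative_eq_intros)
  have 2: "((\<lambda>z. (z / 2) powr \<nu>) has_real_derivative \<nu> * (z / 2) powr (\<nu> - 1) * (1 / 2)) (at z)"
    using z(1) by (auto intro!: derivative_eq_intros)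
  have "((\<lambda>z. (z / 2) powr \<nu> * bessel_re 0 (z\<^sup>2 / 4)) has_real_derivative
      (\<nu> * (z / 2) powr (\<nu> - 1) * (1 / 2) * bessel_re 0 (z\<^sup>2 / 4) + d * (z / 2) * (z / 2) powr \<nu>)) (at z)"
    by (rule DERIV_mult[OF 2 DERIV_chain2[OF bd 1]])
  moreover have "bessel_re 0 (z\<^sup>2 / 4) = 0" using x z(2) by (simp add: zeros_iff)
  ultimately have "((\<lambda>z. (z / 2) powr \<nu> * bessel_re 0 (z\<^sup>2 / 4)) has_real_derivative
      sqrt x powr \<nu> * (d * sqrt x)) (at z)"
    by (simp add: z(3) mult_ac)
  then have D: "((\<lambda>z. jackson_factor 0 * ((z / 2) powr \<nu> * bessel_re 0 (z\<^sup>2 / 4))) has_real_derivative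
      jackson_factor 0 * (sqrt x powr \<nu> * (d * sqrt x))) (at z)"
    by (rule DERIV_cmult)
  have "(jackson_J2 \<nu> q has_real_derivative
      jackson_factor 0 * (sqrt x powr \<nu> * (d * sqrt x))) (at z)"
  \<comment> \<open>The product formula for \<open>jackson_J2\<close> is available only for positive
    arguments, so the derivative is transferred through a neighbourhood of \<open>z\<close>.\<close>
  proof (rule DERIV_cong_ev[OF refl _ refl, THEN iffD2, OF _ D])
    have "\<forall>\<^sub>F z in nhds z. z \<in> {0<..}" by (rule eventually_nhds_in_open) (use z in auto)
    then show "\<forall>\<^sub>F z in nhds z. jackson_J2 \<nu> q z = jackson_factor 0 * ((z / 2) powr \<nu> * bessel_re 0 (z\<^sup>2 / 4))"
      by eventually_elim (use jackson_J2_eq[of _ 0] in simp)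
  qed
  then show "(jackson_J2 \<nu> q has_real_derivative jackson_factor 0 * (sqrt x powr \<nu> *
     (Re (deriv (bessel 0) (of_real x)) * sqrt x))) (at (2 * sqrt x))"
    by (simp only: z_def d_def)
qed

text \<open>The powers of \<open>sqrt x\<close> cancel and \<open>jackson_factor_0\<close> turns the
  prefactors into \<open>1 / (1 - b q)\<close>, leaving \<open>-4\<close> times the residue of
  \<open>G\<close>.\<close>

lemma jackson_weight_eq:
  fixes j :: "nat \<Rightarrow> real"
  assumes j: "strict_mono j" "range j = zeros"
  shows "jackson_weight \<nu> q l = 4 * zero_weight (j l)"
proof -
  define x where "x = j l"
  have x: "x \<in> zeros" using j(2) by (auto simp: x_def)
  have x0: "0 < x" using zeros_pos[OF x] .
  have z: "jackson_zero \<nu> q l = 2 * sqrt x" by (simp add: jackson_zero_eq[OF j] x_def)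
  define d where "d = Re (deriv (bessel 0) (of_real x))"
  define u where "u = Re (bessel 1 (of_real x))"
  have d: "d \<noteq> 0" using zero_weight_sign[OF x] by (auto simp: d_def)
  have J1: "jackson_J2 (\<nu> + 1) q (2 * sqrt x) = jackson_factor 1 * (sqrt x powr \<nu> * sqrt x * u)"
    using jackson_J2_eq[of "2 * sqrt x" 1] x0 by (simp add: bessel_re_def u_def powr_add power_mult_distrib)
  have "jackson_weight \<nu> q l = - 4 * (jackson_factor 1 * (sqrt x powr \<nu> * sqrt x * u)) /
      ((1 - q powr \<nu> * q) * jackson_factor 1 * (sqrt x powr \<nu> * (d * sqrt x)))"
    unfolding jackson_weight_def z J1 jackson_J2_deriv[OF x] d_def[symmetric] jackson_factor_0 ..
  also have "\<dots> = 4 * (- u / ((1 - q powr \<nu> * q) * d))"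
    using x0 d jackson_factor_nonzero[of 1] bq_less_1 by (simp add: divide_simps)
  finally show ?thesis by (simp add: zero_weight_def u_def d_def x_def)
qed

text \<open>A zero \<open>2 * sqrt x\<close> contributes \<open>4 w / (4 x)^(m+1)\<close> for
  \<open>w = zero_weight x\<close>, so one factor 4 cancels and \<open>4 ^ m\<close> remains. The
  index shift reflects that \<open>moment m\<close> has \<open>x^(m+1)\<close> in its
  denominators.\<close>

lemma rayleigh_sum_eq: "rayleigh_sum \<nu> q (Suc m) = moment m / 4 ^ m"
proof -
  obtain j :: "nat \<Rightarrow> real" where j: "strict_mono j" "range j = zeros"
    by (rule discrete_unbounded_enumeration[OF infinite_zeros finite_zeros_atMost])
  have bij: "bij_betw j UNIV zeros"
    using j strict_mono_imp_inj_on[OF j(1)] by (simp add: bij_betw_def)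
  have tm: "jackson_weight \<nu> q l / jackson_zero \<nu> q l ^ (2 * Suc m) = zero_weight (j l) / j l ^ Suc m * (1 / 4 ^ m)" for l
  proof -
    have "j l \<in> zeros" using j(2) by blast
    then have "0 < j l" by (rule zeros_pos)
    then have "(2 * sqrt (j l))\<^sup>2 = 4 * j l" by (simp add: power_mult_distrib)
    then have "(2 * sqrt (j l)) ^ (2 * Suc m) = (4 * j l) ^ Suc m" by (simp only: power_mult)
    then have "jackson_weight \<nu> q l / jackson_zero \<nu> q l ^ (2 * Suc m) = 4 * zero_weight (j l) / (4 * j l) ^ Suc m"
      by (simp only: jackson_weight_eq[OF j] jackson_zero_eq[OF j])
    also have "\<dots> = zero_weight (j l) / j l ^ Suc m * (1 / 4 ^ m)"
      unfolding power_mult_distrib power_Suc[of 4] by simp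
    finally show ?thesis .
  qed
  have "((\<lambda>l. zero_weight (j l) / j l ^ Suc m) has_sum moment m) UNIV"
    unfolding has_sum_reindex_bij_betw[OF bij, of "\<lambda>x. zero_weight x / x ^ Suc m"] by (rule moment_has_sum)
  then have "(\<lambda>l. zero_weight (j l) / j l ^ Suc m * (1 / 4 ^ m)) sums (moment m * (1 / 4 ^ m))"
    by (intro sums_mult2 has_sum_imp_sums)
  then have "rayleigh_sum \<nu> q (Suc m) = moment m * (1 / 4 ^ m)"
    unfolding rayleigh_sum_def tm by (rule sums_unique[symmetric])
  then show ?thesis by simp
qed

lemma rayleigh_hankel_eq: "rayleigh_hankel \<nu> q n = hankel n"
  unfolding rayleigh_hankel_def hankel_def
proof (rule cong_mat)
  show "(case (j, k) of (j, k) \<Rightarrow> rayleigh_sum \<nu> q (j + k + 1)) = (case (j, k) of (j, k) \<Rightarrow> moment (j + k) / 4 ^ (j + k))"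
    for j k
    using rayleigh_sum_eq[of "j + k"] by simp
qed simp_all

end

lemma qfact_square_base: "(\<Prod>l<n. 1 - a * q ^ Suc (2 * l)) = qfact (a * q) (q\<^sup>2) n"
  by (simp add: qfact_def power_mult mult.assoc)

section \<open>Explicit powers of \<open>q\<close>; determinant, inverse and eigenvalue
  bound\<close>

context jackson
begin

lemma lead_powr: "lead k = q powr (real k * \<nu> + real k * (real k + 1) / 2)"
proof (induction k)
  case 0
  show ?case using q_pos by (simp add: lead_def)
next
  case (Suc k)
  have "lead (Suc k) = lead k * (q powr \<nu> * q ^ Suc k)"
    by (simp add: lead_def algebra_simps)
  also have "q powr \<nu> * q ^ Suc k = q powr (\<nu> + real (Suc k))"
    by (rule powr_shift[symmetric])
  also have "lead k * \<dots> = q powr (real k * \<nu> + real k * (real k + 1) / 2 + (\<nu> + real (Suc k)))"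
    unfolding Suc.IH powr_add ..
  also have "real k * \<nu> + real k * (real k + 1) / 2 + (\<nu> + real (Suc k)) =
      real (Suc k) * \<nu> + real (Suc k) * (real (Suc k) + 1) / 2"
    by (simp add: field_simps)
  finally show ?case .
qed

lemma lead_even: "lead (2 * l) = q powr (2 * real l * \<nu> + real l * (2 * real l + 1))"
  unfolding lead_powr by (rule arg_cong[where f = "\<lambda>r. q powr r"]) (simp add: field_simps)

lemma weight_numerator: "1 - q powr \<nu> * q ^ Suc (2 * l) = 1 - q powr (2 * real l + \<nu> + 1)"
  using powr_shift[of "Suc (2 * l)"] by (simp add: add_ac)

lemma lommel_weight_powr:
  "lommel_weight l = (1 - q powr (2 * real l + \<nu> + 1)) * q powr - (2 * real l * \<nu> + real l * (2 * real l + 1))"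
  unfolding lommel_weight_def lead_even weight_numerator powr_minus divide_inverse ..

definition lommel_factor :: "nat \<Rightarrow> nat \<Rightarrow> real" where
  "lommel_factor l a = qbinom (l + a) (l - a) q *
     (qpoch (q powr (\<nu> + 1)) q (int (l + a)) / qpoch (q powr (\<nu> + 1)) q (int (l - a)))"

lemma lommel_factor_pos: "0 < lommel_factor l a"
  unfolding lommel_factor_def qbinom_def qpoch_b qpoch_q
  by (intro mult_pos_pos divide_pos_pos qfact_q_pos qfact_bq_0_pos)

text \<open>Column \<open>a\<close> carries the coefficient of index \<open>l - a\<close> of
  \<open>R_(2l)\<close>. Its sign is isolated as \<open>(-1)^(l+a)\<close>, because
  \<open>lommel_factor\<close> is positive; the absolute row sums rely on this.\<close>

lemma lommel_mat_entry:
  assumes "a \<le> l" "l \<le> n"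
  shows "lommel_mat n $$ (l, a) = (- 1) ^ (l + a) * 4 ^ a *
    q powr ((real l - real a) * \<nu> + (real l - real a)\<^sup>2) * lommel_factor l a"
proof -
  obtain d where l: "l = a + d" using assms(1) le_Suc_ex by blast
  have "q powr (real d * \<nu> + (real d)\<^sup>2) = q powr (\<nu> * real d) * q powr real (d\<^sup>2)"
    by (simp add: powr_add mult.commute)
  also have "\<dots> = (q powr \<nu>) ^ d * q ^ d\<^sup>2"
    using q_pos by (simp add: powr_powr[symmetric] powr_realpow del: of_nat_power)
  finally have pw: "q powr (real d * \<nu> + (real d)\<^sup>2) = (q powr \<nu>) ^ d * q ^ d\<^sup>2" .
  have sgn: "(- 1) ^ (l + a) = ((- 1) ^ d :: real)"
    by (simp add: l power_add)
  have idx: "2 * l - d = l + a" "2 * l - 2 * d = 2 * a" "l + a - d = 2 * a" "2 * d \<le> 2 * l" "l - a = d" using l by auto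
  have "lommel_mat n $$ (l, a) = lommel_coeff (2 * l) d * 4 ^ a"
    using assms idx by (simp add: lommel_mat_def)
  also have "lommel_coeff (2 * l) d = (- (q powr \<nu>)) ^ d * q ^ d\<^sup>2 * lommel_factor l a"
    unfolding lommel_coeff_def lommel_factor_def qbinom_def qpoch_b qpoch_q idx using idx(4) by simp
  also have "(- (q powr \<nu>)) ^ d * q ^ d\<^sup>2 = (- 1) ^ d * q powr (real d * \<nu> + (real d)\<^sup>2)"
    unfolding pw by (subst power_minus) (simp add: mult.assoc)
  finally show ?thesis using l sgn by simp
qed

definition inverse_entry :: "nat \<Rightarrow> nat \<Rightarrow> nat \<Rightarrow> real" where
  "inverse_entry j k l = qbinom (l + j) (l - j) q * qbinom (l + k) (l - k) q *
     ((1 - q powr (2 * real l + \<nu> + 1)) / q ^ ((2 * j + 2 * k + 1) * l)) *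
     (qpoch (q powr (\<nu> + 1)) q (int (l + j)) / qpoch (q powr (\<nu> + 1)) q (int (l - j))) *
     (qpoch (q powr (\<nu> + 1)) q (int (l + k)) / qpoch (q powr (\<nu> + 1)) q (int (l - k)))"

lemma inverse_entry_eq:
  assumes "j \<le> l" "k \<le> l" "l \<le> n"
  shows "lommel_weight l * lommel_mat n $$ (l, j) * lommel_mat n $$ (l, k) =
    (- 4) ^ (j + k) * q powr (real j * (real j - \<nu>) + real k * (real k - \<nu>)) * inverse_entry j k l"
proof -
  define w where "w = 1 - q powr (2 * real l + \<nu> + 1)"
  define e where "e = (\<lambda>a. (real l - real a) * \<nu> + (real l - real a)\<^sup>2)"
  define f where "f = real j * (real j - \<nu>) + real k * (real k - \<nu>)"
  define N where "N = (2 * j + 2 * k + 1) * l"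
  \<comment> \<open>In \<open>e j + e k\<close> the terms \<open>2 l \<nu>\<close> and
    \<open>2 l^2\<close> cancel against the weight, so \<open>l\<close> survives only through the
    linear exponent \<open>N\<close>.\<close>
  have "- (2 * real l * \<nu> + real l * (2 * real l + 1)) + e j + e k = f - real N"
    by (simp add: e_def f_def N_def power2_eq_square algebra_simps)
  then have "q powr - (2 * real l * \<nu> + real l * (2 * real l + 1)) * q powr e j * q powr e k = q powr (f - real N)"
    by (simp only: powr_add[symmetric])
  also have "\<dots> = q powr f / q ^ N"
    using q_pos by (simp add: powr_diff powr_realpow)
  finally have p: "q powr - (2 * real l * \<nu> + real l * (2 * real l + 1)) * q powr e j * q powr e k = q powr f / q ^ N" .
  have "(- 1) ^ (l + j) * (- 1) ^ (l + k) = (((- 1) ^ l * (- 1) ^ l) * (- 1) ^ (j + k) :: real)"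
    by (simp only: power_add mult_ac)
  then have s: "(- 1) ^ (l + j) * (- 1) ^ (l + k) = ((- 1) ^ (j + k) :: real)" by simp
  have "lommel_weight l * lommel_mat n $$ (l, j) * lommel_mat n $$ (l, k) =
     w * q powr - (2 * real l * \<nu> + real l * (2 * real l + 1)) *
     ((- 1) ^ (l + j) * 4 ^ j * q powr e j * lommel_factor l j) * ((- 1) ^ (l + k) * 4 ^ k * q powr e k * lommel_factor l k)"
    unfolding lommel_weight_powr lommel_mat_entry[OF assms(1,3)] lommel_mat_entry[OF assms(2,3)] w_def e_def ..
  also have "\<dots> = ((- 1) ^ (l + j) * (- 1) ^ (l + k)) * (4 ^ j * 4 ^ k) * w *
     (q powr - (2 * real l * \<nu> + real l * (2 * real l + 1)) * q powr e j * q powr e k) * lommel_factor l j * lommel_factor l k"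
    by (simp only: mult_ac)
  also have "\<dots> = ((- 1) ^ (j + k) * 4 ^ (j + k)) * w * (q powr f / q ^ N) * lommel_factor l j * lommel_factor l k"
    unfolding p s by (simp only: power_add[of 4])
  also have "(- 1) ^ (j + k) * 4 ^ (j + k) = ((- 4) ^ (j + k) :: real)"
    by (simp add: power_mult_distrib[symmetric])
  also have "(- 4) ^ (j + k) * w * (q powr f / q ^ N) * lommel_factor l j * lommel_factor l k =
     (- 4) ^ (j + k) * q powr f * inverse_entry j k l"
    by (simp add: inverse_entry_def lommel_factor_def w_def N_def)
  finally show ?thesis by (simp only: f_def)
qed

lemma inverse_matrix_eq:
  "triangular_orthogonalization.inv_mat (Suc n) (lommel_mat n) lommel_weight =
     Matrix.mat (Suc n) (Suc n) (\<lambda>(j, k). (- 4) ^ (j + k) *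
       q powr (real j * (real j - \<nu>) + real k * (real k - \<nu>)) * (\<Sum>l = max j k..n. inverse_entry j k l))"
  unfolding triangular_orthogonalization.inv_mat_def[OF hankel_orthogonalization]
proof (rule cong_mat, goal_cases)
  case (3 j k)
  have "(\<Sum>l<Suc n. lommel_weight l * lommel_mat n $$ (l, j) * lommel_mat n $$ (l, k)) =
      (\<Sum>l = max j k..n. lommel_weight l * lommel_mat n $$ (l, j) * lommel_mat n $$ (l, k))"
    using 3 by (intro sum.mono_neutral_right) (auto simp: lommel_mat_def not_le less_max_iff_disj)
  also have "\<dots> = (\<Sum>l = max j k..n. (- 4) ^ (j + k) *
      q powr (real j * (real j - \<nu>) + real k * (real k - \<nu>)) * inverse_entry j k l)"
    by (intro sum.cong refl inverse_entry_eq) auto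
  finally show ?case by (simp only: sum_distrib_left prod.case)
qed auto

text \<open>The exponents \<open>2 l \<nu> + l (2 l + 1)\<close> are summed over
  \<open>l \<le> n\<close>; the part free of \<open>\<nu>\<close> gives
  \<open>n (n+1) (4n+5) / 6\<close>, whence the divisor 6.\<close>

lemma prod_lead_even: "(\<Prod>l<Suc n. lead (2 * l)) = q powr (real n * (real n + 1) * (4 * real n + 6 * \<nu> + 5) / 6)"
proof (induction n)
  case 0
  show ?case using q_pos by (simp add: lead_def)
next
  case (Suc n)
  have "(\<Prod>l<Suc (Suc n). lead (2 * l)) = q powr (real n * (real n + 1) * (4 * real n + 6 * \<nu> + 5) / 6
      + (2 * real (Suc n) * \<nu> + real (Suc n) * (2 * real (Suc n) + 1)))"
    unfolding prod.lessThan_Suc[of _ "Suc n"] Suc.IH lead_even[of "Suc n"] powr_add ..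
  also have "real n * (real n + 1) * (4 * real n + 6 * \<nu> + 5) / 6
      + (2 * real (Suc n) * \<nu> + real (Suc n) * (2 * real (Suc n) + 1)) =
      real (Suc n) * (real (Suc n) + 1) * (4 * real (Suc n) + 6 * \<nu> + 5) / 6"
    by (simp add: field_simps)
  finally show ?case .
qed

lemma prod_four_power: "(\<Prod>l<Suc n. (4 :: real) ^ l)\<^sup>2 = 2 ^ (2 * n * (n + 1))"
proof (induction n)
  case (Suc n)
  have "((4 :: real) ^ Suc n)\<^sup>2 = 2 ^ (4 * Suc n)"
  proof -
    have "((4 :: real) ^ Suc n)\<^sup>2 = ((2\<^sup>2) ^ Suc n)\<^sup>2" by simp
    also have "\<dots> = 2 ^ (2 * Suc n * 2)" by (simp only: power_mult)
    also have "2 * Suc n * 2 = 4 * Suc n" by simp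
    finally show ?thesis .
  qed
  then have "(\<Prod>l<Suc (Suc n). (4 :: real) ^ l)\<^sup>2 = 2 ^ (2 * n * (n + 1)) * 2 ^ (4 * Suc n)"
    unfolding prod.lessThan_Suc[of _ "Suc n"] power_mult_distrib Suc.IH by simp
  also have "\<dots> = 2 ^ (2 * n * (n + 1) + 4 * Suc n)" by (rule power_add[symmetric])
  also have "2 * n * (n + 1) + 4 * Suc n = 2 * Suc n * (Suc n + 1)" by simp
  finally show ?case .
qed simp

text \<open>\<open>C\<close> and its transpose each contribute the product of the diagonal entries
  \<open>(bq;q)_(2l) 4^l\<close>. Hence the squares in the denominator and the exponent
  \<open>2 n (n+1)\<close> of \<open>1 / 2\<close>. The odd powers of \<open>q\<close> in the
  weights form the factorial with base \<open>q^2\<close>.\<close>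

lemma det_hankel:
  "Determinant.det (hankel n) = (1 / 2) ^ (2 * n * (n + 1)) *
       q powr (real n * (real n + 1) * (4 * real n + 6 * \<nu> + 5) / 6) /
       (qpoch (q powr (\<nu> + 1)) (q ^ 2) (int (n + 1)) *
        (\<Prod>m = 1..n. (qpoch (q powr (\<nu> + 1)) q (int (2 * m))) ^ 2))"
proof -
  define P where "P = (\<Prod>l<Suc n. qfact (q powr \<nu> * q) q (2 * l))"
  define F where "F = (\<Prod>l<Suc n. (4 :: real) ^ l)"
  define W where "W = (\<Prod>l<Suc n. 1 - q powr \<nu> * q ^ Suc (2 * l))"
  have P: "0 < P" unfolding P_def by (intro prod_pos ballI qfact_bq_0_pos)
  have W: "0 < W" unfolding W_def using bq_pow_less_1 by (intro prod_pos ballI) simp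
  have F: "0 < F" unfolding F_def by (intro prod_pos) auto
  have "(\<Prod>l<Suc n. lommel_mat n $$ (l, l)) = P * F"
    unfolding P_def F_def prod.distrib[symmetric] by (intro prod.cong) (auto simp: lommel_mat_diag)
  moreover have "(\<Prod>l<Suc n. 1 / lommel_weight l) = (\<Prod>l<Suc n. lead (2 * l)) / W"
    unfolding W_def prod_dividef[symmetric] by (intro prod.cong) (auto simp: lommel_weight_def)
  ultimately have "Determinant.det (hankel n) * (P * F)\<^sup>2 = (\<Prod>l<Suc n. lead (2 * l)) / W"
    using triangular_orthogonalization.det_eq[OF hankel_orthogonalization, of n] by simp
  then have "Determinant.det (hankel n) = (1 / F\<^sup>2) * (\<Prod>l<Suc n. lead (2 * l)) / (W * P\<^sup>2)"
    using P F W by (simp add: field_simps power_mult_distrib)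
  also have "1 / F\<^sup>2 = (1 / 2) ^ (2 * n * (n + 1))"
    unfolding F_def prod_four_power by (simp add: power_one_over)
  also have "W = qpoch (q powr (\<nu> + 1)) (q ^ 2) (int (n + 1))"
  proof -
    have "qpoch (q powr (\<nu> + 1)) (q ^ 2) (int (n + 1)) = qfact (q powr (\<nu> + 1)) (q\<^sup>2) (n + 1)"
      using q_pos q_less_1 q_powr_less_1 by (intro qpoch_eq_qfact) (auto intro: power_less_one_iff[THEN iffD2] simp: power_less_one_iff)
    moreover have "W = qfact (q powr (\<nu> + 1)) (q\<^sup>2) (Suc n)"
      unfolding W_def qfact_square_base powr_b ..
    ultimately show ?thesis by simp
  qed
  also have "P\<^sup>2 = (\<Prod>m = 1..n. (qpoch (q powr (\<nu> + 1)) q (int (2 * m))) ^ 2)"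
  proof -
    have "P\<^sup>2 = (\<Prod>l\<in>{..<Suc n}. (qfact (q powr \<nu> * q) q (2 * l))\<^sup>2)"
      unfolding P_def by (rule prod_power_distrib)
    \<comment> \<open>The factor with \<open>l = 0\<close> is an empty product, so the range may
      start at 1.\<close>
    also have "\<dots> = (\<Prod>l = 1..n. (qfact (q powr \<nu> * q) q (2 * l))\<^sup>2)"
      by (rule prod.mono_neutral_right) (auto simp: not_le Suc_le_eq)
    finally show ?thesis by (simp only: qpoch_b)
  qed
  finally show ?thesis unfolding prod_lead_even .
qed

text \<open>At the imaginary unit \<open>- 4 x^2\<close> becomes 4, so all terms of the q-Lommel
  polynomial have the sign \<open>(-1)^l\<close> and nothing cancels. Its modulus is then exactly
  the absolute row sum.\<close>

lemma abs_lommel_row_sum: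
  assumes "l \<le> n"
  shows "(\<Sum>a<Suc n. \<bar>lommel_mat n $$ (l, a)\<bar>)\<^sup>2 = (Re (q_lommel_even l (\<nu> + 1) q \<i>))\<^sup>2"
proof -
  define t where "t = (\<lambda>a. 4 ^ a * q powr ((real l - real a) * \<nu> + (real l - real a)\<^sup>2) * lommel_factor l a)"
  have "(\<Sum>a<Suc n. \<bar>lommel_mat n $$ (l, a)\<bar>) = (\<Sum>a\<le>l. \<bar>lommel_mat n $$ (l, a)\<bar>)"
    using assms by (intro sum.mono_neutral_right) (auto simp: lommel_mat_def)
  also have "\<dots> = (\<Sum>a\<le>l. t a)"
  proof (intro sum.cong refl)
    fix a assume "a \<in> {..l}"
    then show "\<bar>lommel_mat n $$ (l, a)\<bar> = t a"
      using assms lommel_factor_pos[of l a] by (simp add: lommel_mat_entry t_def abs_mult power_abs)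
  qed
  finally have row: "(\<Sum>a<Suc n. \<bar>lommel_mat n $$ (l, a)\<bar>) = (\<Sum>a\<le>l. t a)" .
  define h where "h = (\<lambda>k. qpoch (q powr (\<nu> + 1)) q (int (l + k)) * qpoch q q (int (l + k)) * 4 ^ k *
     q powr (real k * (real k - 2 * real l - (\<nu> + 1) + 1)) /
     ((- 1) ^ l * (qpoch (q powr (\<nu> + 1)) q (int (l - k)) * qpoch q q (int (l - k))) * qpoch q q (int (2 * k))))"
  have i4: "(- 4 * \<i>\<^sup>2) ^ k = complex_of_real (4 ^ k)" for k by simp
  have "q_lommel_even l (\<nu> + 1) q \<i> =
     of_real (q powr (real l * (real l + (\<nu> + 1) - 1)) * (\<Sum>k\<le>l. h k))"
    unfolding q_lommel_even_def h_def i4 of_real_mult of_real_sum of_real_divide by simp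
  then have "Re (q_lommel_even l (\<nu> + 1) q \<i>) = q powr (real l * (real l + (\<nu> + 1) - 1)) * (\<Sum>k\<le>l. h k)"
    by (simp only: Re_complex_of_real)
  also have "\<dots> = (\<Sum>k\<le>l. (- 1) ^ l * t k)"
    unfolding sum_distrib_left
  proof (intro sum.cong refl)
    fix k assume "k \<in> {..l}"
    then have kl: "l + k - (l - k) = 2 * k" by auto
    have "real l * (real l + (\<nu> + 1) - 1) + real k * (real k - 2 * real l - (\<nu> + 1) + 1) =
       (real l - real k) * \<nu> + (real l - real k)\<^sup>2"
      by (simp add: power2_eq_square algebra_simps)
    then have p: "q powr (real l * (real l + (\<nu> + 1) - 1)) * q powr (real k * (real k - 2 * real l - (\<nu> + 1) + 1)) =
       q powr ((real l - real k) * \<nu> + (real l - real k)\<^sup>2)"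
      by (simp only: powr_add[symmetric])
    have sgn: "X / ((- 1) ^ l * Y * Z) = (- 1) ^ l * (X / (Y * Z))" for X Y Z :: real
      by (cases "even l") auto
    have "q powr (real l * (real l + (\<nu> + 1) - 1)) * h k = (- 1) ^ l *
       ((q powr (real l * (real l + (\<nu> + 1) - 1)) * q powr (real k * (real k - 2 * real l - (\<nu> + 1) + 1))) * 4 ^ k * lommel_factor l k)"
      unfolding h_def sgn lommel_factor_def qbinom_def kl by (simp add: mult_ac)
    then show "q powr (real l * (real l + (\<nu> + 1) - 1)) * h k = (- 1) ^ l * t k"
      unfolding p t_def by (simp only: mult_ac)
  qed
  also have "\<dots> = (- 1) ^ l * (\<Sum>k\<le>l. t k)" by (simp only: sum_distrib_left)
  finally show ?thesis unfolding row by (simp add: power_mult_distrib power_mult[symmetric])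
qed

text \<open>The matrix argument gives a bound with \<open>2 l + 1\<close> in the exponent. Since
  \<open>l \<le> n\<close> and \<open>q < 1\<close>, replacing it by \<open>2 n + 1\<close> only
  enlarges the sum, and so weakens the bound to the stated form.\<close>

lemma Min_spectrum_hankel:
  "inverse (\<Sum>l = 0..n. (1 - q powr (2 * real l + \<nu> + 1)) * (Re (q_lommel_even l (\<nu> + 1) q \<i>)) ^ 2 /
     q powr (2 * real l * \<nu> + real l * (2 * real n + 1))) \<le> Min (spectrum (hankel n))"
proof (rule triangular_orthogonalization.Min_spectrum_lower_bound[OF hankel_orthogonalization])
  have "(\<Sum>l<Suc n. lommel_weight l * (\<Sum>a<Suc n. \<bar>lommel_mat n $$ (l, a)\<bar>)\<^sup>2) \<le>
    (\<Sum>l<Suc n. (1 - q powr (2 * real l + \<nu> + 1)) * (Re (q_lommel_even l (\<nu> + 1) q \<i>)) ^ 2 /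
     q powr (2 * real l * \<nu> + real l * (2 * real n + 1)))"
  proof (rule sum_mono)
    fix l assume "l \<in> {..<Suc n}"
    then have l: "l \<le> n" by simp
    have w: "0 < 1 - q powr (2 * real l + \<nu> + 1)"
      using bq_pow_less_1[of "2 * l"] weight_numerator[of l] by linarith
    have "q powr (2 * real l * \<nu> + real l * (2 * real n + 1)) \<le> q powr (2 * real l * \<nu> + real l * (2 * real l + 1))"
      using q_pos q_less_1 l by (intro powr_mono') (auto intro!: mult_left_mono)
    then have "(1 - q powr (2 * real l + \<nu> + 1)) * (Re (q_lommel_even l (\<nu> + 1) q \<i>)) ^ 2 /
       q powr (2 * real l * \<nu> + real l * (2 * real l + 1)) \<le>
      (1 - q powr (2 * real l + \<nu> + 1)) * (Re (q_lommel_even l (\<nu> + 1) q \<i>)) ^ 2 /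
       q powr (2 * real l * \<nu> + real l * (2 * real n + 1))"
      using w q_pos by (intro divide_left_mono mult_nonneg_nonneg mult_pos_pos) auto
    then show "lommel_weight l * (\<Sum>a<Suc n. \<bar>lommel_mat n $$ (l, a)\<bar>)\<^sup>2 \<le>
      (1 - q powr (2 * real l + \<nu> + 1)) * (Re (q_lommel_even l (\<nu> + 1) q \<i>)) ^ 2 /
       q powr (2 * real l * \<nu> + real l * (2 * real n + 1))"
      unfolding abs_lommel_row_sum[OF l] lommel_weight_def lead_even weight_numerator by simp
  qed
  also have "\<dots> = (\<Sum>l = 0..n. (1 - q powr (2 * real l + \<nu> + 1)) * (Re (q_lommel_even l (\<nu> + 1) q \<i>)) ^ 2 /
     q powr (2 * real l * \<nu> + real l * (2 * real n + 1)))"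
    by (rule sum.cong) auto
  finally show "(\<Sum>l<Suc n. lommel_weight l * (\<Sum>a<Suc n. \<bar>lommel_mat n $$ (l, a)\<bar>)\<^sup>2) \<le>
    (\<Sum>l = 0..n. (1 - q powr (2 * real l + \<nu> + 1)) * (Re (q_lommel_even l (\<nu> + 1) q \<i>)) ^ 2 /
     q powr (2 * real l * \<nu> + real l * (2 * real n + 1)))" .
qed

end

theorem theorem6:
  fixes q \<nu> :: real and n :: nat
  assumes "0 < q" and "q < 1" and "\<nu> > -1"
  defines "M \<equiv> rayleigh_hankel \<nu> q n"
  defines "\<Gamma> \<equiv> Matrix.mat (n + 1) (n + 1) (\<lambda>(j, k).
      (- 4) ^ (j + k) * q powr (real j * (real j - \<nu>) + real k * (real k - \<nu>)) *
      (\<Sum>l = max j k..n.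
         qbinom (l + j) (l - j) q * qbinom (l + k) (l - k) q *
         ((1 - q powr (2 * real l + \<nu> + 1)) / q ^ ((2 * j + 2 * k + 1) * l)) *
         (qpoch (q powr (\<nu> + 1)) q (int (l + j)) / qpoch (q powr (\<nu> + 1)) q (int (l - j))) *
         (qpoch (q powr (\<nu> + 1)) q (int (l + k)) / qpoch (q powr (\<nu> + 1)) q (int (l - k)))))"
  shows
    "Determinant.det M =
       (1 / 2) ^ (2 * n * (n + 1)) *
       q powr (real n * (real n + 1) * (4 * real n + 6 * \<nu> + 5) / 6) /
       (qpoch (q powr (\<nu> + 1)) (q ^ 2) (int (n + 1)) *
        (\<Prod>m = 1..n. (qpoch (q powr (\<nu> + 1)) q (int (2 * m))) ^ 2)) \<and>
     (inverts_mat M \<Gamma> \<and> inverts_mat \<Gamma> M) \<and>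
     Min (spectrum M) \<ge>
       inverse (\<Sum>l = 0..n.
         (1 - q powr (2 * real l + \<nu> + 1)) * (Re (q_lommel_even l (\<nu> + 1) q \<i>)) ^ 2 /
         q powr (2 * real l * \<nu> + real l * (2 * real n + 1)))"
proof -
  interpret jackson q \<nu>
    by unfold_locales (use assms in auto)
  interpret T: triangular_orthogonalization "Suc n" "hankel n" "lommel_mat n" lommel_weight
    by (rule hankel_orthogonalization)
  have M: "M = hankel n" unfolding M_def by (rule rayleigh_hankel_eq)
  have G: "\<Gamma> = T.inv_mat"
    using inverse_matrix_eq[of n] unfolding \<Gamma>_def inverse_entry_def Suc_eq_plus1 by (rule sym)
  have "inverts_mat M \<Gamma>" "inverts_mat \<Gamma> M"
    unfolding inverts_mat_def M G using T.right_inverse T.left_inverse T.M T.inv_mat_carrier by auto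
  then show ?thesis
    using det_hankel[of n] Min_spectrum_hankel[of n] unfolding M by blast
qed

end
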